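(* Let $K$ be a complete and large multicomplex. Then for every $n\in\mathbb{N}$ the canonical map $$H^n_b(\phi^* )\colon H^n_b(|K|)\to H^n_b(K)$$ from the singular bounded cohomology of the geometric realization $|K|$ to the simplicial bounded cohomology of $K$ (both with real coefficients) is an isometric isomorphism.
   Context: **Multicomplexes.** A multicomplex is a triple $K=(V,I,\Omega)$, where $V$ is a set (the vertices), $I=\bigcup_A I_A$ with $A$ ranging over the finite subsets of $V$, each $I_A$ is a (possibly empty) set (the simplices with vertex set $A$), $I_A$ is a singleton when $A$ is a singleton, and $\Omega$ is a family of maps $\partial_{A,B}\colon I_A\to I_B$ (for $A\supseteq B$) such that $\partial_{A,A}=\mathrm{Id}$ and $\partial_{B,C}\circ\partial_{A,B}=\partial_{A,C}$ for $A\supseteq B\supseteq C$. A simplex in $I_A$ has dimension $|A|-1$. A simplicial map $K\to K'$ consists of a map $f\colon V\to V'$ and maps $f_A\colon I_A\to I'_{f(A)}$ commuting with the boundary maps; it is a simplicial embedding if $f$ and all the $f_A$ are injective. The geometric realization $|K|$ is the CW complex obtained by taking one affine simplex with vertex set $A$ for every $\sigma\in I_A$ and gluing the face spanned by $B\subseteq A$ to the simplex corresponding to $\partial_{A,B}\sigma$ via the affine map that is the identity on $B$, with the weak topology. Points of $|K|$ are written $(\sigma,t_0a_0+\dots+t_na_n)$ (convex combinations of the vertices of $\sigma$, possibly with repeated entries). Simplicial maps induce continuous maps on geometric realizations; the standard simplex $\Delta^n$ and its boundary $\partial\Delta^n$ are regarded as multicomplexes. **Complete.** $K$ is complete if every continuous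 map $f\colon|\Delta^n|\to|K|$ ($n\ge 1$) whose restriction to $\partial|\Delta^n|$ is (induced by) a simplicial embedding is homotopic relative to $\partial|\Delta^n|$ to (the realization of) a simplicial embedding $\Delta^n\to K$. **Large.** $K$ is large if every connected component of $K$ contains infinitely many vertices. **Simplicial bounded cohomology.** $C_n(K)$ is the real vector space with basis the algebraic simplices $(\sigma,(v_0,\dots,v_n))$, where $\sigma\in I_A$ and $\{v_0,\dots,v_n\}=A$ (repetitions among the $v_i$ allowed), with boundary $\partial(\sigma,(v_0,\dots,v_n))=\sum_{i=0}^n(-1)^i(\partial_{A,B_i}\sigma,(v_0,\dots,\widehat{v_i},\dots,v_n))$, $B_i=\{v_0,\dots,\widehat{v_i},\dots,v_n\}$. $C^n_b(K)$ is the space of linear functionals $\varphi$ on $C_n(K)$ such that $\|\varphi\|_\infty=\sup|\varphi(s)|<\infty$, where $s$ ranges over algebraic $n$-simplices; $H^n_b(K)$ is the cohomology of $C^*_b(K)$, endowed with the quotient seminorm $\|\cdot\|_\infty$. **Singular bounded cohomology.** For a space $Y$, $C^n_b(Y)$ is the space of real singular $n$-cochains $\varphi$ with $\|\varphi\|_\infty=\sup|\varphi(s)|<\infty$, $s$ ranging over singular $n$-simplices; $H^n_b(Y)$ is the cohomology of $C^*_b(Y)$, endowed with the quotient seminorm. **The map.** $\phi_*\colon C_*(K)\to C_*(|K|)$ sends $(\sigma,(v_0,\dots,v_n))$ to the singular simplex $\Delta^n\to|K|$, $(t_0,\dots,t_n)\mapsto(\sigma,t_0v_0+\dots+t_nv_n)$.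 $\phi^*\colon C^*_b(|K|)\to C^*_b(K)$ is the dual map and $H^n_b(\phi^* )$ the induced map. An isometric isomorphism is a linear isomorphism preserving the seminorms. *)

theory Defs
  imports "HOL-Analysis.Analysis" "HOL-Homology.Homology"
begin

section \<open>Multicomplexes and simplicial maps\<close>

text \<open>
  \<open>simps K A\<close> is the set $I_A$ and \<open>bdry K A B\<close> the map $\partial_{A,B}$. Vertex sets of
  simplices are nonempty. The sets \<open>simps K A\<close> are not required to be disjoint for different
  \<open>A\<close>: a simplex is always accompanied by its vertex set, so $I$ is their disjoint union.
\<close>

record ('v, 's) multicomplex =
  verts :: "'v set"
  simps :: "'v set \<Rightarrow> 's set"
  bdry :: "'v set \<Rightarrow> 'v set \<Rightarrow> 's \<Rightarrow> 's"

definition multicomplex :: "('v, 's) multicomplex \<Rightarrow> bool" where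
  "multicomplex K \<longleftrightarrow>
     (\<forall>A. simps K A \<noteq> {} \<longrightarrow> finite A \<and> A \<noteq> {} \<and> A \<subseteq> verts K) \<and>
     (\<forall>v\<in>verts K. is_singleton (simps K {v})) \<and>
     (\<forall>A B. \<forall>\<sigma>\<in>simps K A. B \<subseteq> A \<and> B \<noteq> {} \<longrightarrow> bdry K A B \<sigma> \<in> simps K B) \<and>
     (\<forall>A. \<forall>\<sigma>\<in>simps K A. bdry K A A \<sigma> = \<sigma>) \<and>
     (\<forall>A B C. \<forall>\<sigma>\<in>simps K A. B \<subseteq> A \<and> C \<subseteq> B \<and> C \<noteq> {} \<longrightarrow>
        bdry K B C (bdry K A B \<sigma>) = bdry K A C \<sigma>)"

definition simplicial_map ::
  "('v, 's) multicomplex \<Rightarrow> ('w, 'r) multicomplex \<Rightarrow> ('v \<Rightarrow> 'w) \<Rightarrow> ('v set \<Rightarrow> 's \<Rightarrow> 'r) \<Rightarrow> bool"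
where
  "simplicial_map K L f F \<longleftrightarrow>
     f ` verts K \<subseteq> verts L \<and>
     (\<forall>A. \<forall>\<sigma>\<in>simps K A. F A \<sigma> \<in> simps L (f ` A)) \<and>
     (\<forall>A B. \<forall>\<sigma>\<in>simps K A. B \<subseteq> A \<and> B \<noteq> {} \<longrightarrow>
        F B (bdry K A B \<sigma>) = bdry L (f ` A) (f ` B) (F A \<sigma>))"

definition simplicial_embedding ::
  "('v, 's) multicomplex \<Rightarrow> ('w, 'r) multicomplex \<Rightarrow> ('v \<Rightarrow> 'w) \<Rightarrow> ('v set \<Rightarrow> 's \<Rightarrow> 'r) \<Rightarrow> bool"
where
  "simplicial_embedding K L f F \<longleftrightarrow>
     simplicial_map K L f F \<and> inj_on f (verts K) \<and> (\<forall>A. inj_on (F A) (simps K A))"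

definition simplex_mc :: "nat \<Rightarrow> (nat, unit) multicomplex" where
  "simplex_mc n =
     \<lparr>verts = {..n}, simps = (\<lambda>A. if A \<noteq> {} \<and> A \<subseteq> {..n} then UNIV else {}),
      bdry = (\<lambda>A B \<sigma>. \<sigma>)\<rparr>"

text \<open>For \<open>n = 0\<close> the vertex set below is empty, so the boundary is the empty multicomplex.\<close>

definition simplex_boundary_mc :: "nat \<Rightarrow> (nat, unit) multicomplex" where
  "simplex_boundary_mc n =
     \<lparr>verts = (if n = 0 then {} else {..n}),
      simps = (\<lambda>A. if A \<noteq> {} \<and> A \<subset> {..n} then UNIV else {}),
      bdry = (\<lambda>A B \<sigma>. \<sigma>)\<rparr>"

lemma multicomplex_simplex_mc: "multicomplex (simplex_mc n)"
  unfolding multicomplex_def simplex_mc_def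
  by (auto simp: is_singleton_def UNIV_unit finite_subset intro: finite_subset[of _ "{..n}"])

lemma multicomplex_simplex_boundary_mc: "multicomplex (simplex_boundary_mc n)"
proof -
  have "{v} \<noteq> {..n}" if "n \<noteq> 0" for v :: nat
  proof
    assume "{v} = {..n}"
    then have "card {..n} = card {v}" by simp
    with that show False by simp
  qed
  then show ?thesis
    unfolding multicomplex_def simplex_boundary_mc_def
    by (auto simp: is_singleton_def UNIV_unit intro: finite_subset[of _ "{..n}"])
qed

section \<open>Geometric realization\<close>

text \<open>The affine simplex spanned by \<open>A\<close>, in barycentric coordinates.\<close>

definition affine_simplex :: "'v set \<Rightarrow> ('v \<Rightarrow> real) set" where
  "affine_simplex A = {t. (\<forall>v. 0 \<le> t v) \<and> (\<forall>v. v \<notin> A \<longrightarrow> t v = 0) \<and> sum t A = 1}"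

type_synonym ('v, 's) pre_point = "('v set \<times> 's) \<times> ('v \<Rightarrow> real)"

definition simplex_sum :: "('v, 's) multicomplex \<Rightarrow> ('v, 's) pre_point topology" where
  "simplex_sum K =
     sum_topology (\<lambda>(A, \<sigma>). subtopology (powertop_real UNIV) (affine_simplex A))
       (Sigma UNIV (simps K))"

text \<open>
  In barycentric coordinates extended by zero, the affine identification of the face spanned
  by \<open>B\<close> with the simplex \<open>bdry K A B \<sigma>\<close> does not change \<open>t\<close>.
\<close>

definition gluing :: "('v, 's) multicomplex \<Rightarrow> ('v, 's) pre_point rel" where
  "gluing K = {(((A, \<sigma>), t), ((B, bdry K A B \<sigma>), t)) | A B \<sigma> t.
                 \<sigma> \<in> simps K A \<and> B \<subseteq> A \<and> B \<noteq> {} \<and> t \<in> affine_simplex B}"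

definition glue_class :: "('v, 's) multicomplex \<Rightarrow> ('v, 's) pre_point \<Rightarrow> ('v, 's) pre_point set"
where
  "glue_class K x = (gluing K \<union> (gluing K)\<inverse>)\<^sup>* `` {x}"

definition quotient_topology :: "'a topology \<Rightarrow> ('a \<Rightarrow> 'b) \<Rightarrow> 'b topology" where
  "quotient_topology X q =
     topology (\<lambda>U. U \<subseteq> q ` topspace X \<and> openin X {x \<in> topspace X. q x \<in> U})"

lemma openin_quotient_topology:
  "openin (quotient_topology X q) U \<longleftrightarrow>
     U \<subseteq> q ` topspace X \<and> openin X {x \<in> topspace X. q x \<in> U}"
proof -
  have "istopology (\<lambda>U. U \<subseteq> q ` topspace X \<and> openin X {x \<in> topspace X. q x \<in> U})"
    unfolding istopology_def
  proof (intro conjI allI impI)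
    fix S T
    assume "S \<subseteq> q ` topspace X \<and> openin X {x \<in> topspace X. q x \<in> S}"
      and "T \<subseteq> q ` topspace X \<and> openin X {x \<in> topspace X. q x \<in> T}"
    moreover have "{x \<in> topspace X. q x \<in> S \<inter> T} =
        {x \<in> topspace X. q x \<in> S} \<inter> {x \<in> topspace X. q x \<in> T}"
      by auto
    ultimately show "S \<inter> T \<subseteq> q ` topspace X" "openin X {x \<in> topspace X. q x \<in> S \<inter> T}"
      by auto
  next
    fix \<K>
    assume *: "\<forall>U\<in>\<K>. U \<subseteq> q ` topspace X \<and> openin X {x \<in> topspace X. q x \<in> U}"
    then show "\<Union>\<K> \<subseteq> q ` topspace X" by blast
    have "{x \<in> topspace X. q x \<in> \<Union>\<K>} = (\<Union>U\<in>\<K>. {x \<in> topspace X. q x \<in> U})"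
      by auto
    with * show "openin X {x \<in> topspace X. q x \<in> \<Union>\<K>}" by auto
  qed
  then show ?thesis
    by (simp add: quotient_topology_def)
qed

lemma topspace_quotient_topology: "topspace (quotient_topology X q) = q ` topspace X"
proof
  show "topspace (quotient_topology X q) \<subseteq> q ` topspace X"
    unfolding topspace_def openin_quotient_topology by blast
  have "{x \<in> topspace X. q x \<in> q ` topspace X} = topspace X" by auto
  then show "q ` topspace X \<subseteq> topspace (quotient_topology X q)"
    by (intro openin_subset) (simp add: openin_quotient_topology)
qed

lemma quotient_map_quotient_topology: "quotient_map X (quotient_topology X q) q"
  by (auto simp: quotient_map_def topspace_quotient_topology openin_quotient_topology)

definition realization :: "('v, 's) multicomplex \<Rightarrow> ('v, 's) pre_point set topology" where
  "realization K = quotient_topology (simplex_sum K) (glue_class K)"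

lemma affine_simplex_support:
  assumes "finite A" "t \<in> affine_simplex A"
  shows "{v. t v \<noteq> 0} \<subseteq> A" "{v. t v \<noteq> 0} \<noteq> {}"
    and "\<And>B. finite B \<Longrightarrow> {v. t v \<noteq> 0} \<subseteq> B \<Longrightarrow> t \<in> affine_simplex B"
proof -
  show 1: "{v. t v \<noteq> 0} \<subseteq> A"
    using assms by (auto simp: affine_simplex_def)
  have "sum t A = 1"
    using assms by (simp add: affine_simplex_def)
  then show "{v. t v \<noteq> 0} \<noteq> {}"
    using sum.neutral[of A t] by fastforce
  fix B assume B: "finite B" "{v. t v \<noteq> 0} \<subseteq> B"
  have "sum t B = sum t {v. t v \<noteq> 0}"
    using B by (intro sum.mono_neutral_right) auto
  also have "\<dots> = sum t A"
    using 1 assms by (intro sum.mono_neutral_left) auto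
  finally show "t \<in> affine_simplex B"
    using assms B by (auto simp: affine_simplex_def)
qed

text \<open>
  A point of the realization has a unique representative whose barycentric coordinates are
  all nonzero on its vertex set.
\<close>

lemma glue_class_eq:
  assumes K: "multicomplex K" and \<sigma>: "\<sigma> \<in> simps K A" and t: "t \<in> affine_simplex A"
  shows "glue_class K ((A, \<sigma>), t) =
    {((B, \<tau>), t) | B \<tau>. \<tau> \<in> simps K B \<and> t \<in> affine_simplex B \<and>
       bdry K B {v. t v \<noteq> 0} \<tau> = bdry K A {v. t v \<noteq> 0} \<sigma>}"
proof -
  define S where "S = {v. t v \<noteq> 0}"
  note K' = K[unfolded multicomplex_def]
  have fin: "finite B" if "\<tau> \<in> simps K B" for B \<tau>
    using conjunct1[OF K'] that by blast
  have face: "bdry K B C \<tau> \<in> simps K C" if "\<tau> \<in> simps K B" "C \<subseteq> B" "C \<noteq> {}" for B C \<tau>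
    using conjunct1[OF conjunct2[OF conjunct2[OF K']]] that by simp
  have comp: "bdry K C D (bdry K B C \<tau>) = bdry K B D \<tau>"
    if "\<tau> \<in> simps K B" "C \<subseteq> B" "D \<subseteq> C" "D \<noteq> {}" for B C D \<tau>
    using conjunct2[OF conjunct2[OF conjunct2[OF conjunct2[OF K']]]] that by simp
  have supp: "S \<subseteq> B" "S \<noteq> {}" "\<And>C. finite C \<Longrightarrow> S \<subseteq> C \<Longrightarrow> t \<in> affine_simplex C"
    if "finite B" "t \<in> affine_simplex B" for B
    using affine_simplex_support[OF that] unfolding S_def by auto
  have finS: "finite S"
    using supp(1)[OF fin[OF \<sigma>] t] fin[OF \<sigma>] by (rule finite_subset)
  have red: "(((B, \<tau>), t), ((S, bdry K B S \<tau>), t)) \<in> gluing K"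
    if "\<tau> \<in> simps K B" "t \<in> affine_simplex B" for B \<tau>
    using that supp(1,2)[OF fin[OF that(1)] that(2)] supp(3)[OF fin[OF that(1)] that(2) finS]
    unfolding gluing_def by simp
  let ?R = "{((B, \<tau>), t) | B \<tau>. \<tau> \<in> simps K B \<and> t \<in> affine_simplex B \<and>
    bdry K B S \<tau> = bdry K A S \<sigma>}"
  let ?E = "gluing K \<union> (gluing K)\<inverse>"
  have "glue_class K ((A, \<sigma>), t) = ?R"
  proof
    show "glue_class K ((A, \<sigma>), t) \<subseteq> ?R"
    proof
      fix x assume "x \<in> glue_class K ((A, \<sigma>), t)"
      then have "(((A, \<sigma>), t), x) \<in> ?E\<^sup>*" by (simp add: glue_class_def)
      then show "x \<in> ?R"
      proof (induction rule: rtrancl_induct)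
        case base
        show ?case using \<sigma> t by blast
      next
        case (step y z)
        then obtain B \<tau> where y: "y = ((B, \<tau>), t)" "\<tau> \<in> simps K B" "t \<in> affine_simplex B"
          "bdry K B S \<tau> = bdry K A S \<sigma>" by blast
        from step(2) consider "(y, z) \<in> gluing K" | "(z, y) \<in> gluing K" by blast
        then show ?case
        proof cases
          case 1
          then obtain C where C: "z = ((C, bdry K B C \<tau>), t)" "C \<subseteq> B" "C \<noteq> {}" "t \<in> affine_simplex C"
            unfolding gluing_def y(1) by auto
          have "finite C" using C(2) fin[OF y(2)] by (rule finite_subset)
          then have "bdry K C S (bdry K B C \<tau>) = bdry K B S \<tau>"
            using comp[OF y(2) C(2)] supp(1,2)[OF _ C(4)] by simp
          moreover have "bdry K B C \<tau> \<in> simps K C"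
            using face[OF y(2) C(2,3)] .
          ultimately show ?thesis using C(1,4) y(4) by simp
        next
          case 2
          then obtain D \<rho> where D: "z = ((D, \<rho>), t)" "\<rho> \<in> simps K D" "B \<subseteq> D" "B \<noteq> {}" "\<tau> = bdry K D B \<rho>"
            unfolding gluing_def y(1) by auto
          have "bdry K B S \<tau> = bdry K D S \<rho>"
            using supp(1,2)[OF fin[OF y(2)] y(3)] comp[OF D(2,3)] D(5) by simp
          moreover have "t \<in> affine_simplex D"
            using supp[OF fin[OF y(2)] y(3)] fin[OF D(2)] D(3) by simp
          ultimately show ?thesis using D(1,2) y(4) by simp
        qed
      qed
    qed
    show "?R \<subseteq> glue_class K ((A, \<sigma>), t)"
    proof
      fix x assume "x \<in> ?R"
      then obtain B \<tau> where x: "x = ((B, \<tau>), t)" "\<tau> \<in> simps K B" "t \<in> affine_simplex B"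
        "bdry K B S \<tau> = bdry K A S \<sigma>" by blast
      have "(((A, \<sigma>), t), ((S, bdry K A S \<sigma>), t)) \<in> ?E" "(((S, bdry K A S \<sigma>), t), x) \<in> ?E"
        using red[OF \<sigma> t] red[OF x(2,3)] unfolding x by simp_all
      then show "x \<in> glue_class K ((A, \<sigma>), t)"
        unfolding glue_class_def by (simp add: converse_rtrancl_into_rtrancl)
    qed
  qed
  then show ?thesis unfolding S_def .
qed

text \<open>
  The union below is over the representatives of the point \<open>p\<close>; all of them give the same
  class if \<open>(f, F)\<close> is a simplicial map.
\<close>

definition realization_map ::
  "('w, 'r) multicomplex \<Rightarrow> ('v \<Rightarrow> 'w) \<Rightarrow> ('v set \<Rightarrow> 's \<Rightarrow> 'r) \<Rightarrow>
     ('v, 's) pre_point set \<Rightarrow> ('w, 'r) pre_point set"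
where
  "realization_map L f F p =
     (\<Union>((A, \<sigma>), t)\<in>p.
        glue_class L ((f ` A, F A \<sigma>), (\<lambda>w. \<Sum>v | v \<in> A \<and> f v = w. t v)))"

definition vertex_point :: "('v, 's) multicomplex \<Rightarrow> 'v \<Rightarrow> ('v, 's) pre_point set" where
  "vertex_point K v =
     glue_class K (({v}, the_elem (simps K {v})), (\<lambda>w. if w = v then 1 else 0))"

section \<open>Complete and large multicomplexes\<close>

abbreviation boundary_inclusion :: "nat \<Rightarrow> (nat, unit) pre_point set \<Rightarrow> (nat, unit) pre_point set"
where
  "boundary_inclusion n \<equiv> realization_map (simplex_mc n) id (\<lambda>A. id)"

definition complete_multicomplex :: "('v, 's) multicomplex \<Rightarrow> bool" where
  "complete_multicomplex K \<longleftrightarrow>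
     (\<forall>n\<ge>1. \<forall>f. continuous_map (realization (simplex_mc n)) (realization K) f \<and>
        (\<exists>g G. simplicial_embedding (simplex_boundary_mc n) K g G \<and>
           (\<forall>p\<in>topspace (realization (simplex_boundary_mc n)).
              f (boundary_inclusion n p) = realization_map K g G p)) \<longrightarrow>
        (\<exists>h H. simplicial_embedding (simplex_mc n) K h H \<and>
           homotopic_with
             (\<lambda>k. \<forall>p\<in>topspace (realization (simplex_boundary_mc n)).
                    k (boundary_inclusion n p) = f (boundary_inclusion n p))
             (realization (simplex_mc n)) (realization K) f (realization_map K h H)))"

definition large_multicomplex :: "('v, 's) multicomplex \<Rightarrow> bool" where
  "large_multicomplex K \<longleftrightarrow>
     (\<forall>C\<in>connected_components_of (realization K). infinite {v \<in> verts K. vertex_point K v \<in> C})"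

section \<open>Bounded cohomology\<close>

text \<open>
  Singular simplices and algebraic simplices are both families of cells with face maps;
  \<open>face X n i\<close> is the \<open>i\<close>-th face of an \<open>n\<close>-dimensional cell.
\<close>

record 'a cell_system =
  cells :: "nat \<Rightarrow> 'a set"
  face :: "nat \<Rightarrow> nat \<Rightarrow> 'a \<Rightarrow> 'a"

definition chains :: "'a cell_system \<Rightarrow> nat \<Rightarrow> ('a \<Rightarrow>\<^sub>0 real) set" where
  "chains X n = {c. Poly_Mapping.keys c \<subseteq> cells X n}"

definition chain_scale :: "real \<Rightarrow> ('a \<Rightarrow>\<^sub>0 real) \<Rightarrow> ('a \<Rightarrow>\<^sub>0 real)" where
  "chain_scale r c = Poly_Mapping.map ((*) r) c"

definition linear_extend :: "('a \<Rightarrow> 'b \<Rightarrow>\<^sub>0 real) \<Rightarrow> ('a \<Rightarrow>\<^sub>0 real) \<Rightarrow> ('b \<Rightarrow>\<^sub>0 real)" where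
  "linear_extend f c =
     (\<Sum>s\<in>Poly_Mapping.keys c. chain_scale (Poly_Mapping.lookup c s) (f s))"

abbreviation basis_chain :: "'a \<Rightarrow> ('a \<Rightarrow>\<^sub>0 real)" where
  "basis_chain s \<equiv> Poly_Mapping.single s 1"

definition boundary :: "'a cell_system \<Rightarrow> nat \<Rightarrow> ('a \<Rightarrow>\<^sub>0 real) \<Rightarrow> ('a \<Rightarrow>\<^sub>0 real)" where
  "boundary X n =
     (if n = 0 then (\<lambda>c. 0)
      else linear_extend (\<lambda>s. \<Sum>i\<le>n. chain_scale ((-1) ^ i) (basis_chain (face X n i s))))"

text \<open>A functional on the subspace \<open>chains X n\<close> is represented by its extension by zero.\<close>

definition cochains :: "'a cell_system \<Rightarrow> nat \<Rightarrow> (('a \<Rightarrow>\<^sub>0 real) \<Rightarrow> real) set" where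
  "cochains X n =
     {\<phi>. (\<forall>a\<in>chains X n. \<forall>b\<in>chains X n. \<phi> (a + b) = \<phi> a + \<phi> b) \<and>
         (\<forall>r. \<forall>a\<in>chains X n. \<phi> (chain_scale r a) = r * \<phi> a) \<and>
         (\<forall>a. a \<notin> chains X n \<longrightarrow> \<phi> a = 0)}"

definition bounded_cochains :: "'a cell_system \<Rightarrow> nat \<Rightarrow> (('a \<Rightarrow>\<^sub>0 real) \<Rightarrow> real) set" where
  "bounded_cochains X n =
     {\<phi> \<in> cochains X n. bdd_above ((\<lambda>s. \<bar>\<phi> (basis_chain s)\<bar>) ` cells X n)}"

text \<open>Inserting \<open>0\<close> only matters when there are no cells: the supremum is then \<open>0\<close>.\<close>

definition cochain_norm :: "'a cell_system \<Rightarrow> nat \<Rightarrow> (('a \<Rightarrow>\<^sub>0 real) \<Rightarrow> real) \<Rightarrow> real" where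
  "cochain_norm X n \<phi> = Sup (insert 0 ((\<lambda>s. \<bar>\<phi> (basis_chain s)\<bar>) ` cells X n))"

definition coboundary ::
  "'a cell_system \<Rightarrow> nat \<Rightarrow> (('a \<Rightarrow>\<^sub>0 real) \<Rightarrow> real) \<Rightarrow> (('a \<Rightarrow>\<^sub>0 real) \<Rightarrow> real)"
where
  "coboundary X n \<phi> = (\<lambda>c. if c \<in> chains X (Suc n) then \<phi> (boundary X (Suc n) c) else 0)"

definition bounded_cocycles :: "'a cell_system \<Rightarrow> nat \<Rightarrow> (('a \<Rightarrow>\<^sub>0 real) \<Rightarrow> real) set" where
  "bounded_cocycles X n = {\<phi> \<in> bounded_cochains X n. coboundary X n \<phi> = (\<lambda>c. 0)}"

definition bounded_coboundaries :: "'a cell_system \<Rightarrow> nat \<Rightarrow> (('a \<Rightarrow>\<^sub>0 real) \<Rightarrow> real) set" where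
  "bounded_coboundaries X n =
     (case n of 0 \<Rightarrow> {\<lambda>c. 0} | Suc m \<Rightarrow> coboundary X m ` bounded_cochains X m)"

definition bounded_cocycle_group ::
  "'a cell_system \<Rightarrow> nat \<Rightarrow> (('a \<Rightarrow>\<^sub>0 real) \<Rightarrow> real) monoid"
where
  "bounded_cocycle_group X n =
     \<lparr>carrier = bounded_cocycles X n, monoid.mult = (\<lambda>\<phi> \<psi> c. \<phi> c + \<psi> c), one = (\<lambda>c. 0)\<rparr>"

definition bounded_cohomology ::
  "'a cell_system \<Rightarrow> nat \<Rightarrow> (('a \<Rightarrow>\<^sub>0 real) \<Rightarrow> real) set monoid"
where
  "bounded_cohomology X n = bounded_cocycle_group X n Mod bounded_coboundaries X n"

definition cohomology_class ::
  "'a cell_system \<Rightarrow> nat \<Rightarrow> (('a \<Rightarrow>\<^sub>0 real) \<Rightarrow> real) \<Rightarrow> (('a \<Rightarrow>\<^sub>0 real) \<Rightarrow> real) set"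
where
  "cohomology_class X n \<phi> = bounded_coboundaries X n #>\<^bsub>bounded_cocycle_group X n\<^esub> \<phi>"

text \<open>
  The scalar multiplication of the quotient space \<open>bounded_cohomology X n\<close>; its addition is
  the group operation.
\<close>

definition class_scale ::
  "'a cell_system \<Rightarrow> nat \<Rightarrow> real \<Rightarrow> (('a \<Rightarrow>\<^sub>0 real) \<Rightarrow> real) set \<Rightarrow> (('a \<Rightarrow>\<^sub>0 real) \<Rightarrow> real) set"
where
  "class_scale X n r \<alpha> = (\<Union>\<phi>\<in>\<alpha>. cohomology_class X n (\<lambda>c. r * \<phi> c))"

definition class_seminorm :: "'a cell_system \<Rightarrow> nat \<Rightarrow> (('a \<Rightarrow>\<^sub>0 real) \<Rightarrow> real) set \<Rightarrow> real" where
  "class_seminorm X n \<alpha> = (INF \<phi>\<in>\<alpha>. cochain_norm X n \<phi>)"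

definition isometric_isomorphism ::
  "'a cell_system \<Rightarrow> 'b cell_system \<Rightarrow> nat \<Rightarrow>
     ((('a \<Rightarrow>\<^sub>0 real) \<Rightarrow> real) set \<Rightarrow> (('b \<Rightarrow>\<^sub>0 real) \<Rightarrow> real) set) \<Rightarrow> bool"
where
  "isometric_isomorphism X Y n T \<longleftrightarrow>
     T \<in> iso (bounded_cohomology X n) (bounded_cohomology Y n) \<and>
     (\<forall>r. \<forall>\<alpha>\<in>carrier (bounded_cohomology X n).
        T (class_scale X n r \<alpha>) = class_scale Y n r (T \<alpha>)) \<and>
     (\<forall>\<alpha>\<in>carrier (bounded_cohomology X n). class_seminorm Y n (T \<alpha>) = class_seminorm X n \<alpha>)"

section \<open>Singular and algebraic simplices, and the canonical map\<close>

definition singular_system :: "'a topology \<Rightarrow> ((nat \<Rightarrow> real) \<Rightarrow> 'a) cell_system" where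
  "singular_system X = \<lparr>cells = (\<lambda>n. singular_simplex_set n X), face = singular_face\<rparr>"

definition delete_nth :: "nat \<Rightarrow> 'a list \<Rightarrow> 'a list" where
  "delete_nth i xs = take i xs @ drop (Suc i) xs"

definition algebraic_system :: "('v, 's) multicomplex \<Rightarrow> ('s \<times> 'v list) cell_system" where
  "algebraic_system K =
     \<lparr>cells = (\<lambda>n. {(\<sigma>, vs). length vs = Suc n \<and> \<sigma> \<in> simps K (set vs)}),
      face = (\<lambda>n i (\<sigma>, vs).
        (bdry K (set vs) (set (delete_nth i vs)) \<sigma>, delete_nth i vs))\<rparr>"

definition canonical_simplex ::
  "('v, 's) multicomplex \<Rightarrow> nat \<Rightarrow> 's \<times> 'v list \<Rightarrow> (nat \<Rightarrow> real) \<Rightarrow> ('v, 's) pre_point set"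
where
  "canonical_simplex K n = (\<lambda>(\<sigma>, vs).
     restrict (\<lambda>t. glue_class K ((set vs, \<sigma>), (\<lambda>v. \<Sum>i | i \<le> n \<and> vs ! i = v. t i)))
       (standard_simplex n))"

definition canonical_chain_map ::
  "('v, 's) multicomplex \<Rightarrow> nat \<Rightarrow> ('s \<times> 'v list \<Rightarrow>\<^sub>0 real) \<Rightarrow>
     (((nat \<Rightarrow> real) \<Rightarrow> ('v, 's) pre_point set) \<Rightarrow>\<^sub>0 real)"
where
  "canonical_chain_map K n = linear_extend (\<lambda>s. basis_chain (canonical_simplex K n s))"

definition canonical_cochain_map ::
  "('v, 's) multicomplex \<Rightarrow> nat \<Rightarrow>
     ((((nat \<Rightarrow> real) \<Rightarrow> ('v, 's) pre_point set) \<Rightarrow>\<^sub>0 real) \<Rightarrow> real) \<Rightarrow>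
     ('s \<times> 'v list \<Rightarrow>\<^sub>0 real) \<Rightarrow> real"
where
  "canonical_cochain_map K n \<psi> =
     (\<lambda>c. if c \<in> chains (algebraic_system K) n then \<psi> (canonical_chain_map K n c) else 0)"

definition canonical_cohomology_map ::
  "('v, 's) multicomplex \<Rightarrow> nat \<Rightarrow>
     ((((nat \<Rightarrow> real) \<Rightarrow> ('v, 's) pre_point set) \<Rightarrow>\<^sub>0 real) \<Rightarrow> real) set \<Rightarrow>
     (('s \<times> 'v list \<Rightarrow>\<^sub>0 real) \<Rightarrow> real) set"
where
  "canonical_cohomology_map K n \<alpha> =
     (\<Union>\<psi>\<in>\<alpha>. cohomology_class (algebraic_system K) n (canonical_cochain_map K n \<psi>))"

end

theory Submission
  imports Defs
begin

text \<open>
  The inverse of the canonical map is induced by straightening singular simplices to simplices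
  of \<open>K\<close>, averaged over the vertices to which their vertices are moved.

  Let \<open>s\<close> be a singular \<open>n\<close>-simplex and let \<open>w\<close> be a list of \<open>n + 1\<close> distinct vertices of \<open>K\<close> in the
  path component of \<open>s\<close>. Move the vertices of \<open>s\<close> along paths to the entries of \<open>w\<close> and continue by
  induction on the dimension of the faces of \<open>s\<close>. Once the proper faces have been deformed to
  simplices of \<open>K\<close>, homotopy extension (\<open>simplex_homotopy_extension\<close>) deforms the simplex itself to a
  map that is a simplicial embedding on the boundary, and completeness deforms this map, relative to
  the boundary, to a simplex of \<open>K\<close> with vertices \<open>w\<close> (\<open>straightening_exists\<close>). The homotopies are
  chosen by recursion on the set of labels, so the choice for a simplex extends the choices for its
  faces, and they are chosen constant if \<open>s\<close> already is the simplex of \<open>K\<close> labelled by its own vertices.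

  The labels of \<open>s\<close> have to be distinct even where the vertices of \<open>s\<close> coincide, so no assignment of
  labels to points of the realization works for all simplices at once. Instead, the labels are averaged
  out. Every component contains infinitely many vertices, hence it carries a mean that ignores finite sets of
  vertices (\<open>vertex_mean_exists\<close>). The iterated mean of a function of vertex lists only depends on its values
  at lists of distinct vertices outside any prescribed finite set (\<open>iterated_mean_cong\<close>), and it does not
  change when a dummy variable is added (\<open>iterated_mean_delete\<close>). Sending a cochain \<open>f\<close> to the
  iterated mean of \<open>f\<close> on the straightenings of \<open>s\<close> is therefore a cochain map, and it does not increase norms
  (\<open>mean_contraction\<close>).

  Both composites with the canonical map are homotopic to the identity by averaged prisms
  (\<open>mean_homotopy\<close>). For singular simplices, the prisms are cut out of the straightening homotopy. For an
  algebraic simplex \<open>(\<sigma>, v)\<close>, take \<open>w\<close> disjoint from \<open>v\<close> and straighten the map from the simplex with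
  vertices \<open>v\<close> and \<open>w\<close> that collapses each entry of \<open>w\<close> to the corresponding entry of \<open>v\<close>. This gives one simplex of \<open>K\<close>
  with \<open>\<sigma>\<close> as its face on \<open>v\<close> and the straightening of \<open>\<sigma>\<close> as its face on \<open>w\<close>
  (\<open>join_simplex_faces\<close>), and the prism between them consists of faces of this simplex.

  Thus the canonical map and the averaged straightening induce mutually inverse maps in bounded
  cohomology. Neither increases the seminorm, so both preserve it
  (\<open>isometric_isomorphism_criterion\<close>).
\<close>

section \<open>Cochains as functions on cells\<close>

lemma lookup_chain_scale [simp]:
  "Poly_Mapping.lookup (chain_scale r c) s = r * Poly_Mapping.lookup c s"
  by (simp add: chain_scale_def Poly_Mapping.map.rep_eq when_def)

lemma keys_chain_scale: "Poly_Mapping.keys (chain_scale r c) \<subseteq> Poly_Mapping.keys c"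
  by (auto simp: in_keys_iff)

lemma chain_scale_simps:
  "chain_scale r (a + b) = chain_scale r a + chain_scale r b"
  "chain_scale (r + r') a = chain_scale r a + chain_scale r' a"
  "chain_scale r (chain_scale r' a) = chain_scale (r * r') a"
  "chain_scale r 0 = 0" "chain_scale 0 a = 0" "chain_scale 1 a = a"
  by (rule poly_mapping_eqI; simp add: lookup_add algebra_simps)+

lemma chain_scale_sum: "chain_scale r (sum g I) = (\<Sum>i\<in>I. chain_scale r (g i))"
  by (induction I rule: infinite_finite_induct) (auto simp: chain_scale_simps)

lemma chains_closed:
  "0 \<in> chains X n"
  "a \<in> chains X n \<Longrightarrow> b \<in> chains X n \<Longrightarrow> a + b \<in> chains X n"
  "a \<in> chains X n \<Longrightarrow> chain_scale r a \<in> chains X n"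
  "basis_chain s \<in> chains X n \<longleftrightarrow> s \<in> cells X n"
  using Poly_Mapping.keys_add[of a b] keys_chain_scale[of r a] by (auto simp: chains_def)

lemma chains_sum: "(\<And>i. i \<in> I \<Longrightarrow> g i \<in> chains X n) \<Longrightarrow> sum g I \<in> chains X n"
  by (induction I rule: infinite_finite_induct) (auto simp: chains_closed)

lemma linear_extend_superset:
  assumes "finite S" "Poly_Mapping.keys c \<subseteq> S"
  shows "linear_extend f c = (\<Sum>s\<in>S. chain_scale (Poly_Mapping.lookup c s) (f s))"
  unfolding linear_extend_def using assms
  by (intro sum.mono_neutral_left) (auto simp: chain_scale_simps in_keys_iff)

lemma linear_extend_add: "linear_extend f (a + b) = linear_extend f a + linear_extend f b"
proof -
  let ?S = "Poly_Mapping.keys a \<union> Poly_Mapping.keys b"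
  have "finite ?S" "Poly_Mapping.keys (a + b) \<subseteq> ?S" using Poly_Mapping.keys_add[of a b] by auto
  then show ?thesis
    by (simp add: linear_extend_superset[of ?S] lookup_add chain_scale_simps sum.distrib)
qed

lemma linear_extend_scale: "linear_extend f (chain_scale r a) = chain_scale r (linear_extend f a)"
  using keys_chain_scale[of r a]
  by (simp add: linear_extend_superset[of "Poly_Mapping.keys a"] chain_scale_sum chain_scale_simps)

lemma linear_extend_basis [simp]: "linear_extend f (basis_chain s) = f s"
  by (simp add: linear_extend_def chain_scale_simps)

lemma linear_extend_basis_chain: "linear_extend basis_chain c = c"
proof (rule poly_mapping_eqI)
  fix s
  have "Poly_Mapping.lookup (linear_extend basis_chain c) s
      = (\<Sum>x\<in>Poly_Mapping.keys c. Poly_Mapping.lookup c x * (if x = s then 1 else 0))"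
    unfolding linear_extend_def lookup_sum by (simp add: lookup_single when_def)
  then show "Poly_Mapping.lookup (linear_extend basis_chain c) s = Poly_Mapping.lookup c s"
    by (simp add: in_keys_iff if_distrib[of "(*) _"] cong: if_cong)
qed

lemma linear_extend_chains:
  assumes "\<And>s. s \<in> cells Y m \<Longrightarrow> D s \<in> chains X n" "c \<in> chains Y m"
  shows "linear_extend D c \<in> chains X n"
  unfolding linear_extend_def using assms
  by (intro chains_sum chains_closed) (auto simp: chains_def)

lemma cochain_add: "\<phi> \<in> cochains X n \<Longrightarrow> a \<in> chains X n \<Longrightarrow> b \<in> chains X n \<Longrightarrow> \<phi> (a + b) = \<phi> a + \<phi> b"
  and cochain_scale: "\<phi> \<in> cochains X n \<Longrightarrow> a \<in> chains X n \<Longrightarrow> \<phi> (chain_scale r a) = r * \<phi> a"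
  and cochain_outside: "\<phi> \<in> cochains X n \<Longrightarrow> a \<notin> chains X n \<Longrightarrow> \<phi> a = 0"
  by (auto simp: cochains_def)

lemma cochain_sum:
  assumes "\<phi> \<in> cochains X n" "\<And>i. i \<in> I \<Longrightarrow> g i \<in> chains X n"
  shows "\<phi> (\<Sum>i\<in>I. chain_scale (r i) (g i)) = (\<Sum>i\<in>I. r i * \<phi> (g i))"
proof -
  have 0: "\<phi> 0 = 0"
    using cochain_scale[OF assms(1) chains_closed(1), of 0] by (simp add: chain_scale_simps)
  show ?thesis using assms(2)
  proof (induction I rule: infinite_finite_induct)
    case (insert x F)
    then have "(\<Sum>i\<in>F. chain_scale (r i) (g i)) \<in> chains X n"
      by (intro chains_sum chains_closed) auto
    then show ?case
      using insert by (simp add: cochain_add[OF assms(1)] cochain_scale[OF assms(1)] chains_closed)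
  qed (simp_all add: 0)
qed

lemma cochain_eqI:
  assumes "\<phi> \<in> cochains X n" "\<psi> \<in> cochains X n"
    and "\<And>s. s \<in> cells X n \<Longrightarrow> \<phi> (basis_chain s) = \<psi> (basis_chain s)"
  shows "\<phi> = \<psi>"
proof
  fix c
  show "\<phi> c = \<psi> c"
  proof (cases "c \<in> chains X n")
    case True
    then have k: "s \<in> Poly_Mapping.keys c \<Longrightarrow> s \<in> cells X n" for s by (auto simp: chains_def)
    have "\<phi> (linear_extend basis_chain c) = \<psi> (linear_extend basis_chain c)"
      unfolding linear_extend_def
      using k assms(3) by (simp add: cochain_sum[OF assms(1)] cochain_sum[OF assms(2)] chains_closed)
    then show ?thesis by (simp add: linear_extend_basis_chain)
  qed (simp add: cochain_outside[OF assms(1)] cochain_outside[OF assms(2)])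
qed

definition cell_cochain :: "'a cell_system \<Rightarrow> nat \<Rightarrow> ('a \<Rightarrow> real) \<Rightarrow> ('a \<Rightarrow>\<^sub>0 real) \<Rightarrow> real" where
  "cell_cochain X n f = (\<lambda>c. if c \<in> chains X n
     then (\<Sum>s\<in>Poly_Mapping.keys c. Poly_Mapping.lookup c s * f s) else 0)"

lemma cell_cochain_basis [simp]:
  "s \<in> cells X n \<Longrightarrow> cell_cochain X n f (basis_chain s) = f s"
  by (simp add: cell_cochain_def chains_closed)

lemma cell_cochain_cochain: "cell_cochain X n f \<in> cochains X n"
proof -
  have *: "(\<Sum>s\<in>Poly_Mapping.keys c. Poly_Mapping.lookup c s * f s)
      = (\<Sum>s\<in>S. Poly_Mapping.lookup c s * f s)" if "finite S" "Poly_Mapping.keys c \<subseteq> S" for c S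
    using that by (intro sum.mono_neutral_left) (auto simp: in_keys_iff)
  have "cell_cochain X n f (a + b) = cell_cochain X n f a + cell_cochain X n f b"
    if "a \<in> chains X n" "b \<in> chains X n" for a b
  proof -
    let ?S = "Poly_Mapping.keys a \<union> Poly_Mapping.keys b"
    have "finite ?S" "Poly_Mapping.keys (a + b) \<subseteq> ?S" using Poly_Mapping.keys_add[of a b] by auto
    then show ?thesis using that
      using *[of ?S a] *[of ?S b] *[of ?S "a + b"]
      by (simp add: cell_cochain_def chains_closed lookup_add distrib_right sum.distrib)
  qed
  moreover have "cell_cochain X n f (chain_scale r a) = r * cell_cochain X n f a"
    if "a \<in> chains X n" for r a
    using that keys_chain_scale[of r a] *[of "Poly_Mapping.keys a" "chain_scale r a"]
    by (simp add: cell_cochain_def chains_closed sum_distrib_left mult.assoc)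
  ultimately show ?thesis
    unfolding cochains_def by (simp add: cell_cochain_def)
qed

lemma transpose_cochain:
  assumes D: "\<And>s. s \<in> cells Y m \<Longrightarrow> D s \<in> chains X n" and \<phi>: "\<phi> \<in> cochains X n"
  shows "(\<lambda>c. if c \<in> chains Y m then \<phi> (linear_extend D c) else 0) \<in> cochains Y m"
  using linear_extend_chains[of Y m D X n, OF D] unfolding cochains_def
  by (auto simp: chains_closed linear_extend_add linear_extend_scale
      cochain_add[OF \<phi>] cochain_scale[OF \<phi>])

definition closed_faces :: "'a cell_system \<Rightarrow> bool" where
  "closed_faces X \<longleftrightarrow> (\<forall>n s i. s \<in> cells X (Suc n) \<longrightarrow> i \<le> Suc n \<longrightarrow> face X (Suc n) i s \<in> cells X n)"

definition simplicial_faces :: "'a cell_system \<Rightarrow> bool" where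
  "simplicial_faces X \<longleftrightarrow> closed_faces X \<and>
     (\<forall>n s i j. s \<in> cells X (Suc (Suc n)) \<longrightarrow> i \<le> j \<longrightarrow> j \<le> Suc n \<longrightarrow>
        face X (Suc n) j (face X (Suc (Suc n)) i s) = face X (Suc n) i (face X (Suc (Suc n)) (Suc j) s))"

lemma coboundary_cochain:
  assumes "closed_faces X" "\<phi> \<in> cochains X n"
  shows "coboundary X n \<phi> \<in> cochains X (Suc n)"
proof -
  let ?D = "\<lambda>s. \<Sum>i\<le>Suc n. chain_scale ((-1) ^ i) (basis_chain (face X (Suc n) i s))"
  have "?D s \<in> chains X n" if "s \<in> cells X (Suc n)" for s
    using assms(1) that by (intro chains_sum chains_closed) (auto simp: chains_closed closed_faces_def)
  from transpose_cochain[OF this assms(2)] show ?thesis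
    unfolding coboundary_def boundary_def by simp
qed

lemma coboundary_basis:
  assumes "closed_faces X" "\<phi> \<in> cochains X n" "s \<in> cells X (Suc n)"
  shows "coboundary X n \<phi> (basis_chain s)
    = (\<Sum>i\<le>Suc n. (-1) ^ i * \<phi> (basis_chain (face X (Suc n) i s)))"
proof -
  have "basis_chain (face X (Suc n) i s) \<in> chains X n" if "i \<in> {..Suc n}" for i
    using assms that by (auto simp: chains_closed closed_faces_def)
  from cochain_sum[OF assms(2), of "{..Suc n}" "\<lambda>i. basis_chain (face X (Suc n) i s)", OF this]
  show ?thesis
    using assms(3) by (simp del: sum.atMost_Suc add: coboundary_def boundary_def chains_closed)
qed

lemma coboundary_coboundary:
  assumes X: "simplicial_faces X" and \<phi>: "\<phi> \<in> cochains X n"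
  shows "coboundary X (Suc n) (coboundary X n \<phi>) = (\<lambda>c. 0)"
proof (rule cochain_eqI)
  have cl: "closed_faces X" using X by (simp add: simplicial_faces_def)
  note d = coboundary_cochain[OF cl]
  show "coboundary X (Suc n) (coboundary X n \<phi>) \<in> cochains X (Suc (Suc n))" by (intro d \<phi>)
  show "(\<lambda>c. 0) \<in> cochains X (Suc (Suc n))" by (simp add: cochains_def)
  fix s assume s: "s \<in> cells X (Suc (Suc n))"
  \<comment> \<open>the \<open>j\<close>-th face of the \<open>i\<close>-th face, where \<open>i \<le> j\<close>, cancels against the \<open>i\<close>-th face of the \<open>Suc j\<close>-th face\<close>
  define a where "a i j = (-1) ^ (i + j) * \<phi> (basis_chain (face X (Suc n) j (face X (Suc (Suc n)) i s)))" for i j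
  have *: "face X (Suc (Suc n)) i s \<in> cells X (Suc n)" if "i \<le> Suc (Suc n)" for i
    using cl s that by (auto simp: closed_faces_def)
  have "coboundary X (Suc n) (coboundary X n \<phi>) (basis_chain s)
      = (\<Sum>i\<le>Suc (Suc n). \<Sum>j\<le>Suc n. a i j)"
    using * by (simp del: sum.atMost_Suc add: coboundary_basis[OF cl] d \<phi> s a_def sum_distrib_left power_add mult.assoc)
  also have "\<dots> = (\<Sum>(i,j)\<in>{..Suc (Suc n)} \<times> {..Suc n}. a i j)"
    by (simp only: sum.cartesian_product)
  also have "\<dots> = (\<Sum>(i,j)\<in>{(i,j). i \<le> j \<and> j \<le> Suc n}. a i j) + (\<Sum>(i,j)\<in>{(i,j). j < i \<and> i \<le> Suc (Suc n)}. a i j)"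
  proof -
    have fin: "finite {(i,j). i \<le> j \<and> j \<le> Suc n}" "finite {(i,j). j < i \<and> i \<le> Suc (Suc n)}"
      by (auto intro: finite_subset[of _ "{..Suc (Suc n)} \<times> {..Suc (Suc n)}"])
    have eq: "{..Suc (Suc n)} \<times> {..Suc n} = {(i,j). i \<le> j \<and> j \<le> Suc n} \<union> {(i,j). j < i \<and> i \<le> Suc (Suc n)}"
      by auto
    show ?thesis unfolding eq by (rule sum.union_disjoint[OF fin]) auto
  qed
  also have "(\<Sum>(i,j)\<in>{(i,j). j < i \<and> i \<le> Suc (Suc n)}. a i j) = (\<Sum>(i,j)\<in>{(i,j). i \<le> j \<and> j \<le> Suc n}. a (Suc j) i)"
    by (rule sum.reindex_bij_witness[where i="\<lambda>(i,j). (Suc j, i)" and j="\<lambda>(i,j). (j, i - 1)"]) auto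
  also have "(\<Sum>(i,j)\<in>{(i,j). i \<le> j \<and> j \<le> Suc n}. a (Suc j) i) = (\<Sum>(i,j)\<in>{(i,j). i \<le> j \<and> j \<le> Suc n}. - a i j)"
    using X s by (intro sum.cong) (auto simp: a_def simplicial_faces_def add.commute)
  finally show "coboundary X (Suc n) (coboundary X n \<phi>) (basis_chain s) = 0"
    by (simp add: case_prod_unfold sum_negf)
qed

text \<open>
  Bounded cochains vanish on basis chains that are not cells, so the bound holds on the whole type.
  Means can therefore be applied to them without restricting the lists of vertices.
\<close>

lemma bounded_cochain_bound:
  assumes "\<phi> \<in> bounded_cochains X n"
  shows "\<bar>\<phi> (basis_chain s)\<bar> \<le> cochain_norm X n \<phi>" "0 \<le> cochain_norm X n \<phi>"
proof -
  have bd: "bdd_above (insert 0 ((\<lambda>s. \<bar>\<phi> (basis_chain s)\<bar>) ` cells X n))"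
    using assms by (simp add: bounded_cochains_def)
  show 0: "0 \<le> cochain_norm X n \<phi>" unfolding cochain_norm_def by (rule cSup_upper[OF _ bd]) simp
  show "\<bar>\<phi> (basis_chain s)\<bar> \<le> cochain_norm X n \<phi>"
  proof (cases "s \<in> cells X n")
    case True
    then show ?thesis unfolding cochain_norm_def by (intro cSup_upper[OF _ bd]) simp
  next
    case False
    then have "\<phi> (basis_chain s) = 0"
      using assms by (auto simp: bounded_cochains_def cochains_def chains_closed)
    then show ?thesis using 0 by simp
  qed
qed

lemma bounded_cochainI:
  assumes "\<phi> \<in> cochains X n" "\<And>s. s \<in> cells X n \<Longrightarrow> \<bar>\<phi> (basis_chain s)\<bar> \<le> B"
  shows "\<phi> \<in> bounded_cochains X n"
  using assms by (auto simp: bounded_cochains_def bdd_above_def)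

lemma cochain_norm_le:
  assumes "0 \<le> B" "\<And>s. s \<in> cells X n \<Longrightarrow> \<bar>\<phi> (basis_chain s)\<bar> \<le> B"
  shows "cochain_norm X n \<phi> \<le> B"
  unfolding cochain_norm_def using assms by (intro cSup_least) auto

lemma bounded_cochain_cochain: "\<phi> \<in> bounded_cochains X n \<Longrightarrow> \<phi> \<in> cochains X n"
  by (simp add: bounded_cochains_def)

lemma bounded_coboundary:
  assumes cl: "closed_faces X" and \<phi>: "\<phi> \<in> bounded_cochains X n"
  shows "coboundary X n \<phi> \<in> bounded_cochains X (Suc n)"
proof (rule bounded_cochainI[where B="real (Suc (Suc n)) * cochain_norm X n \<phi>"])
  note \<phi>' = bounded_cochain_cochain[OF \<phi>]
  show "coboundary X n \<phi> \<in> cochains X (Suc n)" by (intro coboundary_cochain cl \<phi>')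
  fix s assume s: "s \<in> cells X (Suc n)"
  have "\<bar>coboundary X n \<phi> (basis_chain s)\<bar> \<le> (\<Sum>i\<le>Suc n. \<bar>(-1) ^ i * \<phi> (basis_chain (face X (Suc n) i s))\<bar>)"
    unfolding coboundary_basis[OF cl \<phi>' s] by (rule sum_abs)
  also have "\<dots> \<le> (\<Sum>i\<le>Suc n. cochain_norm X n \<phi>)"
    by (intro sum_mono) (simp add: abs_mult bounded_cochain_bound(1)[OF \<phi>])
  finally show "\<bar>coboundary X n \<phi> (basis_chain s)\<bar> \<le> real (Suc (Suc n)) * cochain_norm X n \<phi>" by simp
qed

definition function_subspace :: "('a \<Rightarrow> real) set \<Rightarrow> bool" where
  "function_subspace V \<longleftrightarrow> (\<lambda>c. 0) \<in> V \<and> (\<forall>\<phi>\<in>V. \<forall>\<psi>\<in>V. (\<lambda>c. \<phi> c + \<psi> c) \<in> V) \<and>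
     (\<forall>\<phi>\<in>V. \<forall>r. (\<lambda>c. r * \<phi> c) \<in> V)"

lemma function_subspace_diff:
  "function_subspace V \<Longrightarrow> \<phi> \<in> V \<Longrightarrow> \<psi> \<in> V \<Longrightarrow> (\<lambda>c. \<phi> c - \<psi> c) \<in> V"
proof -
  assume V: "function_subspace V" "\<phi> \<in> V" "\<psi> \<in> V"
  then have "(\<lambda>c. (-1) * \<psi> c) \<in> V" unfolding function_subspace_def by blast
  with V have "(\<lambda>c. \<phi> c + (\<lambda>c. (-1) * \<psi> c) c) \<in> V" unfolding function_subspace_def by metis
  then show ?thesis by simp
qed

lemma coboundary_add: "coboundary X n (\<lambda>c. \<phi> c + \<psi> c) = (\<lambda>c. coboundary X n \<phi> c + coboundary X n \<psi> c)"
  and coboundary_scale: "coboundary X n (\<lambda>c. r * \<phi> c) = (\<lambda>c. r * coboundary X n \<phi> c)"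
  by (auto simp: coboundary_def)

lemma bounded_cochains_subspace: "function_subspace (bounded_cochains X n)"
proof -
  have "(\<lambda>c. \<phi> c + \<psi> c) \<in> bounded_cochains X n" if "\<phi> \<in> bounded_cochains X n" "\<psi> \<in> bounded_cochains X n" for \<phi> \<psi>
  proof (rule bounded_cochainI)
    show "(\<lambda>c. \<phi> c + \<psi> c) \<in> cochains X n"
      using that by (auto simp: bounded_cochains_def cochains_def algebra_simps)
    show "\<bar>\<phi> (basis_chain s) + \<psi> (basis_chain s)\<bar> \<le> cochain_norm X n \<phi> + cochain_norm X n \<psi>" for s
      using bounded_cochain_bound(1)[OF that(1), of s] bounded_cochain_bound(1)[OF that(2), of s] by linarith
  qed
  moreover have "(\<lambda>c. r * \<phi> c) \<in> bounded_cochains X n" if "\<phi> \<in> bounded_cochains X n" for \<phi> r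
  proof (rule bounded_cochainI)
    show "(\<lambda>c. r * \<phi> c) \<in> cochains X n"
      using that by (auto simp: bounded_cochains_def cochains_def algebra_simps)
    show "\<bar>r * \<phi> (basis_chain s)\<bar> \<le> \<bar>r\<bar> * cochain_norm X n \<phi>" for s
      using bounded_cochain_bound(1)[OF that(1), of s] by (simp add: abs_mult mult_left_mono)
  qed
  moreover have "(\<lambda>c. 0) \<in> bounded_cochains X n"
    by (rule bounded_cochainI[where B=0]) (auto simp: cochains_def)
  ultimately show ?thesis by (simp add: function_subspace_def)
qed

lemma bounded_cocycles_subspace: "function_subspace (bounded_cocycles X n)"
proof -
  have "coboundary X n (\<lambda>c. 0) = (\<lambda>c. 0)" by (auto simp: coboundary_def)
  then show ?thesis
    using bounded_cochains_subspace[of X n] 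
    by (auto simp: function_subspace_def bounded_cocycles_def coboundary_add coboundary_scale)
qed

lemma bounded_coboundaries_subspace: "function_subspace (bounded_coboundaries X n)"
proof (cases n)
  case 0
  then show ?thesis by (simp add: function_subspace_def bounded_coboundaries_def)
next
  case (Suc m)
  note S = bounded_cochains_subspace[of X m, unfolded function_subspace_def]
  have "coboundary X m (\<lambda>c. 0) = (\<lambda>c. 0)" by (auto simp: coboundary_def)
  with S show ?thesis unfolding Suc bounded_coboundaries_def function_subspace_def
    by (auto simp flip: coboundary_add coboundary_scale intro!: image_eqI)
qed

lemma bounded_coboundaries_cocycles:
  assumes "simplicial_faces X"
  shows "bounded_coboundaries X n \<subseteq> bounded_cocycles X n"
proof (cases n)
  case 0
  then show ?thesis using bounded_cocycles_subspace[of X 0]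
    by (simp add: bounded_coboundaries_def function_subspace_def)
next
  case (Suc m)
  have "closed_faces X" using assms by (simp add: simplicial_faces_def)
  then show ?thesis unfolding Suc bounded_coboundaries_def bounded_cocycles_def
    using coboundary_coboundary[OF assms] bounded_coboundary bounded_cochain_cochain by fastforce
qed

section \<open>A criterion for isometric isomorphisms\<close>

lemma bounded_cocycle_comm_group: "comm_group (bounded_cocycle_group X n)"
proof -
  note S = bounded_cocycles_subspace[of X n, unfolded function_subspace_def]
  show ?thesis
  proof (rule comm_groupI)
    fix \<phi> assume "\<phi> \<in> carrier (bounded_cocycle_group X n)"
    then have "(\<lambda>c. (-1) * \<phi> c) \<in> bounded_cocycles X n"
      using S unfolding bounded_cocycle_group_def by fastforce
    then show "\<exists>\<psi>\<in>carrier (bounded_cocycle_group X n).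
        \<psi> \<otimes>\<^bsub>bounded_cocycle_group X n\<^esub> \<phi> = \<one>\<^bsub>bounded_cocycle_group X n\<^esub>"
      by (intro bexI[where x="\<lambda>c. (-1) * \<phi> c"]) (auto simp: bounded_cocycle_group_def)
  qed (use S in \<open>auto simp: bounded_cocycle_group_def algebra_simps\<close>)
qed

lemma bounded_coboundaries_normal:
  assumes "simplicial_faces X"
  shows "bounded_coboundaries X n \<lhd> bounded_cocycle_group X n"
proof -
  interpret comm_group "bounded_cocycle_group X n" by (rule bounded_cocycle_comm_group)
  note B = bounded_coboundaries_subspace[of X n, unfolded function_subspace_def]
  note sub = bounded_coboundaries_cocycles[OF assms, of n]
  have "subgroup (bounded_coboundaries X n) (bounded_cocycle_group X n)"
  proof (rule subgroupI)
    show "bounded_coboundaries X n \<subseteq> carrier (bounded_cocycle_group X n)"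
      using sub by (simp add: bounded_cocycle_group_def)
    show "bounded_coboundaries X n \<noteq> {}" using B by blast
    fix \<phi> assume \<phi>: "\<phi> \<in> bounded_coboundaries X n"
    then have m: "(\<lambda>c. (-1) * \<phi> c) \<in> bounded_coboundaries X n" using B by fast
    have "inv\<^bsub>bounded_cocycle_group X n\<^esub> \<phi> = (\<lambda>c. (-1) * \<phi> c)"
      by (rule inv_equality) (use \<phi> m sub in \<open>auto simp: bounded_cocycle_group_def\<close>)
    then show "inv\<^bsub>bounded_cocycle_group X n\<^esub> \<phi> \<in> bounded_coboundaries X n" using m by simp
  qed (use B in \<open>simp add: bounded_cocycle_group_def\<close>)
  then show ?thesis by (rule subgroup_imp_normal)
qed

lemma cohomology_class_eq:
  "cohomology_class X n \<phi> = (\<lambda>b c. b c + \<phi> c) ` bounded_coboundaries X n"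
  by (auto simp: cohomology_class_def r_coset_def bounded_cocycle_group_def)

lemma cohomology_class_eq_iff:
  "cohomology_class X n \<phi> = cohomology_class X n \<psi> \<longleftrightarrow> (\<lambda>c. \<phi> c - \<psi> c) \<in> bounded_coboundaries X n"
proof
  note S = bounded_coboundaries_subspace[of X n]
  have 0: "(\<lambda>c. 0) \<in> bounded_coboundaries X n" using S by (simp add: function_subspace_def)
  assume "cohomology_class X n \<phi> = cohomology_class X n \<psi>"
  moreover have "\<phi> \<in> cohomology_class X n \<phi>" unfolding cohomology_class_eq by (rule image_eqI[OF _ 0]) simp
  ultimately obtain b where "b \<in> bounded_coboundaries X n" "\<phi> = (\<lambda>c. b c + \<psi> c)"
    unfolding cohomology_class_eq by blast
  then show "(\<lambda>c. \<phi> c - \<psi> c) \<in> bounded_coboundaries X n" by simp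
next
  note S = bounded_coboundaries_subspace[of X n]
  assume d: "(\<lambda>c. \<phi> c - \<psi> c) \<in> bounded_coboundaries X n"
  have "(\<lambda>c. b c + \<phi> c) \<in> (\<lambda>b c. b c + \<psi> c) ` bounded_coboundaries X n"
    if "b \<in> bounded_coboundaries X n" for b
    by (rule image_eqI[where x="\<lambda>c. b c + (\<phi> c - \<psi> c)"])
       (use S d that in \<open>auto simp: function_subspace_def\<close>)
  moreover have "(\<lambda>c. b c + \<psi> c) \<in> (\<lambda>b c. b c + \<phi> c) ` bounded_coboundaries X n"
    if "b \<in> bounded_coboundaries X n" for b
    by (rule image_eqI[where x="\<lambda>c. b c - (\<phi> c - \<psi> c)"])
       (use S d that in \<open>auto intro: function_subspace_diff\<close>)
  ultimately show "cohomology_class X n \<phi> = cohomology_class X n \<psi>" unfolding cohomology_class_eq by blast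
qed

lemma mem_cohomology_class: "\<phi> \<in> cohomology_class X n \<phi>"
  unfolding cohomology_class_eq using bounded_coboundaries_subspace[of X n]
  by (intro image_eqI[where x="\<lambda>c. 0"]) (auto simp: function_subspace_def)

lemma cohomology_class_mem_iff:
  "\<psi> \<in> cohomology_class X n \<phi> \<longleftrightarrow> cohomology_class X n \<psi> = cohomology_class X n \<phi>"
proof
  assume "\<psi> \<in> cohomology_class X n \<phi>"
  then show "cohomology_class X n \<psi> = cohomology_class X n \<phi>"
    unfolding cohomology_class_eq_iff unfolding cohomology_class_eq by auto
qed (use mem_cohomology_class in blast)

lemma carrier_bounded_cohomology:
  "carrier (bounded_cohomology X n) = cohomology_class X n ` bounded_cocycles X n"
  by (auto simp: bounded_cohomology_def FactGroup_def RCOSETS_def cohomology_class_def bounded_cocycle_group_def)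

lemma cohomology_class_UN:
  assumes "\<And>\<psi>. \<psi> \<in> cohomology_class X n \<phi> \<Longrightarrow> cohomology_class Y m (G \<psi>) = cohomology_class Y m (G \<phi>)"
  shows "(\<Union>\<psi>\<in>cohomology_class X n \<phi>. cohomology_class Y m (G \<psi>)) = cohomology_class Y m (G \<phi>)"
  by (rule SUP_eq_const) (use assms mem_cohomology_class[of \<phi> X n] in blast)+

text \<open>
  What a map of cocycles has to satisfy in order to induce a linear map of bounded cohomology that does
  not increase the seminorm.
\<close>

definition cocycle_contraction ::
  "'a cell_system \<Rightarrow> 'b cell_system \<Rightarrow> nat \<Rightarrow>
    ((('a \<Rightarrow>\<^sub>0 real) \<Rightarrow> real) \<Rightarrow> (('b \<Rightarrow>\<^sub>0 real) \<Rightarrow> real)) \<Rightarrow> bool" where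
  "cocycle_contraction X Y n G \<longleftrightarrow>
     (\<forall>\<phi>\<in>bounded_cocycles X n. G \<phi> \<in> bounded_cocycles Y n \<and> cochain_norm Y n (G \<phi>) \<le> cochain_norm X n \<phi> \<and>
        (\<forall>r. G (\<lambda>c. r * \<phi> c) = (\<lambda>c. r * G \<phi> c)) \<and>
        (\<forall>\<psi>\<in>bounded_cocycles X n. G (\<lambda>c. \<phi> c + \<psi> c) = (\<lambda>c. G \<phi> c + G \<psi> c))) \<and>
     G ` bounded_coboundaries X n \<subseteq> bounded_coboundaries Y n"

lemma cocycle_contractionD:
  assumes "cocycle_contraction X Y n G"
  shows "\<phi> \<in> bounded_cocycles X n \<Longrightarrow> G \<phi> \<in> bounded_cocycles Y n"
    and "\<phi> \<in> bounded_cocycles X n \<Longrightarrow> cochain_norm Y n (G \<phi>) \<le> cochain_norm X n \<phi>"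
    and "\<phi> \<in> bounded_cocycles X n \<Longrightarrow> G (\<lambda>c. r * \<phi> c) = (\<lambda>c. r * G \<phi> c)"
    and "\<phi> \<in> bounded_cocycles X n \<Longrightarrow> \<psi> \<in> bounded_cocycles X n \<Longrightarrow>
      G (\<lambda>c. \<phi> c + \<psi> c) = (\<lambda>c. G \<phi> c + G \<psi> c)"
    and "\<phi> \<in> bounded_coboundaries X n \<Longrightarrow> G \<phi> \<in> bounded_coboundaries Y n"
  using assms unfolding cocycle_contraction_def by blast+

lemma cocycle_contraction_class:
  assumes G: "cocycle_contraction X Y n G" and X: "simplicial_faces X"
    and \<phi>: "\<phi> \<in> bounded_cocycles X n" and eq: "cohomology_class X n \<psi> = cohomology_class X n \<phi>"
  shows "\<psi> \<in> bounded_cocycles X n" "cohomology_class Y n (G \<psi>) = cohomology_class Y n (G \<phi>)"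
proof -
  define b where "b = (\<lambda>c. \<psi> c - \<phi> c)"
  have b: "b \<in> bounded_coboundaries X n" using eq unfolding b_def cohomology_class_eq_iff .
  have bz: "b \<in> bounded_cocycles X n" using b bounded_coboundaries_cocycles[OF X] by blast
  have \<psi>: "\<psi> = (\<lambda>c. b c + \<phi> c)" by (simp add: b_def)
  show "\<psi> \<in> bounded_cocycles X n"
    unfolding \<psi> using bounded_cocycles_subspace bz \<phi> by (auto simp: function_subspace_def)
  have "G \<psi> = (\<lambda>c. G b c + G \<phi> c)" "G b \<in> bounded_coboundaries Y n"
    unfolding \<psi> using cocycle_contractionD(4,5)[OF G] b bz \<phi> by blast+
  then show "cohomology_class Y n (G \<psi>) = cohomology_class Y n (G \<phi>)"
    unfolding cohomology_class_eq_iff by simp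
qed

lemma cochain_norm_nonneg_class:
  assumes "simplicial_faces Y" "\<psi> \<in> bounded_cocycles Y n" "\<theta> \<in> cohomology_class Y n \<psi>"
  shows "\<theta> \<in> bounded_cocycles Y n" "0 \<le> cochain_norm Y n \<theta>"
proof -
  from assms(3) obtain b where b: "b \<in> bounded_coboundaries Y n" "\<theta> = (\<lambda>c. b c + \<psi> c)"
    unfolding cohomology_class_eq by blast
  then show "\<theta> \<in> bounded_cocycles Y n"
    using assms bounded_coboundaries_cocycles[OF assms(1)] bounded_cocycles_subspace[of Y n]
    by (auto simp: function_subspace_def)
  then show "0 \<le> cochain_norm Y n \<theta>"
    by (intro bounded_cochain_bound(2)) (simp add: bounded_cocycles_def)
qed

lemma class_seminorm_contraction:
  assumes G: "cocycle_contraction X Y n G" and X: "simplicial_faces X" and Y: "simplicial_faces Y"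
    and \<phi>: "\<phi> \<in> bounded_cocycles X n"
  shows "class_seminorm Y n (cohomology_class Y n (G \<phi>)) \<le> class_seminorm X n (cohomology_class X n \<phi>)"
  unfolding class_seminorm_def
proof (rule cINF_mono)
  show "cohomology_class X n \<phi> \<noteq> {}" using mem_cohomology_class by blast
  have "G \<phi> \<in> bounded_cocycles Y n" using cocycle_contractionD(1)[OF G \<phi>] .
  from cochain_norm_nonneg_class(2)[OF Y this]
  show "bdd_below (cochain_norm Y n ` cohomology_class Y n (G \<phi>))"
    by (intro bdd_belowI[where m=0]) blast
  fix \<psi> assume "\<psi> \<in> cohomology_class X n \<phi>"
  then have "cohomology_class X n \<psi> = cohomology_class X n \<phi>" by (simp add: cohomology_class_mem_iff)
  note * = cocycle_contraction_class[OF G X \<phi> this]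
  show "\<exists>\<theta>\<in>cohomology_class Y n (G \<phi>). cochain_norm Y n \<theta> \<le> cochain_norm X n \<psi>"
    using cocycle_contractionD(2)[OF G *(1)] *(2) cohomology_class_mem_iff by blast
qed

text \<open>
  The induced maps are inverse to each other, and a bijection that does not increase the seminorm in
  either direction preserves it.
\<close>

lemma isometric_isomorphism_criterion:
  assumes X: "simplicial_faces X" and Y: "simplicial_faces Y"
    and G: "cocycle_contraction X Y n G" and H: "cocycle_contraction Y X n H"
    and HG: "\<And>\<phi>. \<phi> \<in> bounded_cocycles X n \<Longrightarrow> (\<lambda>c. H (G \<phi>) c - \<phi> c) \<in> bounded_coboundaries X n"
    and GH: "\<And>\<psi>. \<psi> \<in> bounded_cocycles Y n \<Longrightarrow> (\<lambda>c. G (H \<psi>) c - \<psi> c) \<in> bounded_coboundaries Y n"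
  shows "isometric_isomorphism X Y n (\<lambda>\<alpha>. \<Union>\<phi>\<in>\<alpha>. cohomology_class Y n (G \<phi>))"
proof -
  define T where "T = (\<lambda>\<alpha>. \<Union>\<phi>\<in>\<alpha>. cohomology_class Y n (G \<phi>))"
  have Gz: "G \<phi> \<in> bounded_cocycles Y n" if "\<phi> \<in> bounded_cocycles X n" for \<phi>
    using cocycle_contractionD(1)[OF G that] .
  have Hz: "H \<phi> \<in> bounded_cocycles X n" if "\<phi> \<in> bounded_cocycles Y n" for \<phi>
    using cocycle_contractionD(1)[OF H that] .
  have T: "T (cohomology_class X n \<phi>) = cohomology_class Y n (G \<phi>)" if "\<phi> \<in> bounded_cocycles X n" for \<phi>
    unfolding T_def
    by (rule cohomology_class_UN) (rule cocycle_contraction_class(2)[OF G X that cohomology_class_mem_iff[THEN iffD1]])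
  have scale: "class_scale Z n r (cohomology_class Z n \<phi>) = cohomology_class Z n (\<lambda>c. r * \<phi> c)"
    for Z :: "'c cell_system" and r \<phi>
    unfolding class_scale_def
  proof (rule cohomology_class_UN)
    fix \<psi> assume "\<psi> \<in> cohomology_class Z n \<phi>"
    then have "(\<lambda>c. \<psi> c - \<phi> c) \<in> bounded_coboundaries Z n"
      by (simp add: cohomology_class_mem_iff cohomology_class_eq_iff)
    then have "(\<lambda>c. r * (\<psi> c - \<phi> c)) \<in> bounded_coboundaries Z n"
      using bounded_coboundaries_subspace[of Z n] by (auto simp: function_subspace_def)
    then show "cohomology_class Z n (\<lambda>c. r * \<psi> c) = cohomology_class Z n (\<lambda>c. r * \<phi> c)"
      by (simp add: cohomology_class_eq_iff algebra_simps)
  qed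
  have mult: "cohomology_class Z n \<phi> \<otimes>\<^bsub>bounded_cohomology Z n\<^esub> cohomology_class Z n \<psi>
      = cohomology_class Z n (\<lambda>c. \<phi> c + \<psi> c)"
    if "simplicial_faces Z" "\<phi> \<in> bounded_cocycles Z n" "\<psi> \<in> bounded_cocycles Z n"
    for Z :: "'c cell_system" and \<phi> \<psi>
    using normal.rcos_sum[OF bounded_coboundaries_normal[OF that(1)], of \<phi> n \<psi>] that
    by (simp add: bounded_cohomology_def FactGroup_def cohomology_class_def bounded_cocycle_group_def)
  have sum: "(\<lambda>c. \<phi> c + \<psi> c) \<in> bounded_cocycles X n"
    if "\<phi> \<in> bounded_cocycles X n" "\<psi> \<in> bounded_cocycles X n" for \<phi> \<psi>
    using that bounded_cocycles_subspace[of X n] by (auto simp: function_subspace_def)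
  have HGc: "cohomology_class X n (H (G \<phi>)) = cohomology_class X n \<phi>" if "\<phi> \<in> bounded_cocycles X n" for \<phi>
    unfolding cohomology_class_eq_iff using HG that .
  have GHc: "cohomology_class Y n (G (H \<phi>)) = cohomology_class Y n \<phi>" if "\<phi> \<in> bounded_cocycles Y n" for \<phi>
    unfolding cohomology_class_eq_iff using GH that .
  have "T \<in> iso (bounded_cohomology X n) (bounded_cohomology Y n)"
  proof (rule isoI)
    show "T \<in> hom (bounded_cohomology X n) (bounded_cohomology Y n)"
    proof (rule homI)
      fix \<alpha> assume "\<alpha> \<in> carrier (bounded_cohomology X n)"
      then obtain \<phi> where \<phi>: "\<alpha> = cohomology_class X n \<phi>" "\<phi> \<in> bounded_cocycles X n"
        unfolding carrier_bounded_cohomology by blast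
      then show "T \<alpha> \<in> carrier (bounded_cohomology Y n)"
        using Gz by (simp add: T carrier_bounded_cohomology)
      fix \<beta> assume "\<beta> \<in> carrier (bounded_cohomology X n)"
      then obtain \<psi> where \<psi>: "\<beta> = cohomology_class X n \<psi>" "\<psi> \<in> bounded_cocycles X n"
        unfolding carrier_bounded_cohomology by blast
      have "G (\<lambda>c. \<phi> c + \<psi> c) = (\<lambda>c. G \<phi> c + G \<psi> c)"
        using cocycle_contractionD(4)[OF G \<phi>(2) \<psi>(2)] .
      then show "T (\<alpha> \<otimes>\<^bsub>bounded_cohomology X n\<^esub> \<beta>) = T \<alpha> \<otimes>\<^bsub>bounded_cohomology Y n\<^esub> T \<beta>"
        using \<phi> \<psi> by (simp add: mult X Y T Gz sum)
    qed
    have "inj_on T (carrier (bounded_cohomology X n))"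
    proof (rule inj_onI, unfold carrier_bounded_cohomology, clarify)
      fix \<phi> \<psi> assume *: "\<phi> \<in> bounded_cocycles X n" "\<psi> \<in> bounded_cocycles X n"
        "T (cohomology_class X n \<phi>) = T (cohomology_class X n \<psi>)"
      then have "cohomology_class Y n (G \<phi>) = cohomology_class Y n (G \<psi>)" by (simp add: T)
      from cocycle_contraction_class(2)[OF H Y Gz[OF *(2)] this]
      show "cohomology_class X n \<phi> = cohomology_class X n \<psi>" using * by (simp add: HGc)
    qed
    moreover have "T ` carrier (bounded_cohomology X n) = carrier (bounded_cohomology Y n)"
    proof (unfold carrier_bounded_cohomology, safe)
      fix \<phi> assume "\<phi> \<in> bounded_cocycles X n"
      then show "T (cohomology_class X n \<phi>) \<in> cohomology_class Y n ` bounded_cocycles Y n"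
        using Gz by (simp add: T)
    next
      fix \<phi> assume *: "\<phi> \<in> bounded_cocycles Y n"
      then have "cohomology_class Y n \<phi> = T (cohomology_class X n (H \<phi>))" by (simp add: T Hz GHc)
      then show "cohomology_class Y n \<phi> \<in> T ` cohomology_class X n ` bounded_cocycles X n"
        using Hz[OF *] by blast
    qed
    ultimately show "bij_betw T (carrier (bounded_cohomology X n)) (carrier (bounded_cohomology Y n))"
      by (simp add: bij_betw_def)
  qed
  moreover have "T (class_scale X n r \<alpha>) = class_scale Y n r (T \<alpha>)"
    if "\<alpha> \<in> carrier (bounded_cohomology X n)" for r \<alpha>
  proof -
    from that obtain \<phi> where \<phi>: "\<alpha> = cohomology_class X n \<phi>" "\<phi> \<in> bounded_cocycles X n"
      unfolding carrier_bounded_cohomology by blast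
    then have "(\<lambda>c. r * \<phi> c) \<in> bounded_cocycles X n" "G (\<lambda>c. r * \<phi> c) = (\<lambda>c. r * G \<phi> c)"
      using bounded_cocycles_subspace[of X n] cocycle_contractionD(3)[OF G]
      by (auto simp: function_subspace_def)
    then show ?thesis using \<phi> by (simp add: scale T)
  qed
  moreover have "class_seminorm Y n (T \<alpha>) = class_seminorm X n \<alpha>"
    if "\<alpha> \<in> carrier (bounded_cohomology X n)" for \<alpha>
  proof -
    from that obtain \<phi> where \<phi>: "\<alpha> = cohomology_class X n \<phi>" "\<phi> \<in> bounded_cocycles X n"
      unfolding carrier_bounded_cohomology by blast
    show ?thesis unfolding \<phi>(1) T[OF \<phi>(2)]
      using class_seminorm_contraction[OF G X Y \<phi>(2)] class_seminorm_contraction[OF H Y X Gz[OF \<phi>(2)]] HGc[OF \<phi>(2)]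
      by simp
  qed
  ultimately show ?thesis unfolding isometric_isomorphism_def T_def by blast
qed

section \<open>Cochain maps induced by maps of cells\<close>

text \<open>
  Restricting a cochain along a map of cells does not enlarge the set of its values on cells.
\<close>

lemma pullback_contraction:
  assumes X: "closed_faces X" and Y: "closed_faces Y"
    and p: "\<And>n s. s \<in> cells Y n \<Longrightarrow> p n s \<in> cells X n"
    and face: "\<And>n s i. s \<in> cells Y (Suc n) \<Longrightarrow> i \<le> Suc n \<Longrightarrow>
        face X (Suc n) i (p (Suc n) s) = p n (face Y (Suc n) i s)"
  defines "P \<equiv> \<lambda>n \<phi> c. if c \<in> chains Y n then \<phi> (linear_extend (\<lambda>s. basis_chain (p n s)) c) else 0"
  shows "cocycle_contraction X Y n (P n)"
    and "\<And>\<phi> s. s \<in> cells Y n \<Longrightarrow> P n \<phi> (basis_chain s) = \<phi> (basis_chain (p n s))"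
proof -
  have basis: "P n \<phi> (basis_chain s) = \<phi> (basis_chain (p n s))" if "s \<in> cells Y n" for \<phi> s n
    using that by (simp add: P_def chains_closed)
  have co: "P n \<phi> \<in> cochains Y n" if "\<phi> \<in> cochains X n" for \<phi> n
    unfolding P_def by (rule transpose_cochain[OF _ that]) (simp add: chains_closed p)
  have bnd: "P n \<phi> \<in> bounded_cochains Y n" if "\<phi> \<in> bounded_cochains X n" for \<phi> n
    by (rule bounded_cochainI[OF co[OF bounded_cochain_cochain[OF that]]])
       (simp add: basis, rule bounded_cochain_bound(1)[OF that])
  have d: "coboundary Y n (P n \<phi>) = P (Suc n) (coboundary X n \<phi>)" if "\<phi> \<in> cochains X n" for \<phi> n
  proof (rule cochain_eqI)
    show "coboundary Y n (P n \<phi>) \<in> cochains Y (Suc n)" "P (Suc n) (coboundary X n \<phi>) \<in> cochains Y (Suc n)"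
      using that X Y by (auto intro!: co coboundary_cochain)
    fix s assume s: "s \<in> cells Y (Suc n)"
    then have "face Y (Suc n) i s \<in> cells Y n" if "i \<le> Suc n" for i
      using Y that by (simp add: closed_faces_def)
    then show "coboundary Y n (P n \<phi>) (basis_chain s) = P (Suc n) (coboundary X n \<phi>) (basis_chain s)"
      using s by (simp del: sum.atMost_Suc add: basis p coboundary_basis[OF Y co[OF that]] coboundary_basis[OF X that] face)
  qed
  have 0: "P n (\<lambda>c. 0) = (\<lambda>c. 0)" for n by (auto simp: P_def)
  show "cocycle_contraction X Y n (P n)"
    unfolding cocycle_contraction_def
  proof (intro conjI ballI allI)
    fix \<phi> assume \<phi>: "\<phi> \<in> bounded_cocycles X n"
    then have \<phi>': "\<phi> \<in> bounded_cochains X n" "coboundary X n \<phi> = (\<lambda>c. 0)"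
      by (auto simp: bounded_cocycles_def)
    show "P n \<phi> \<in> bounded_cocycles Y n"
      using \<phi>' by (simp add: bounded_cocycles_def bnd d bounded_cochain_cochain 0)
    show "cochain_norm Y n (P n \<phi>) \<le> cochain_norm X n \<phi>"
      by (rule cochain_norm_le) (use \<phi>' in \<open>auto simp: basis bounded_cochain_bound\<close>)
  next
    show "P n ` bounded_coboundaries X n \<subseteq> bounded_coboundaries Y n"
    proof (cases n)
      case 0
      then show ?thesis by (simp add: bounded_coboundaries_def \<open>\<And>n. P n (\<lambda>c. 0) = (\<lambda>c. 0)\<close>)
    next
      case (Suc m)
      then show ?thesis
        by (auto simp: bounded_coboundaries_def d[symmetric] bounded_cochain_cochain intro: bnd)
    qed
  qed (auto simp: P_def)
  show "\<And>\<phi> s. s \<in> cells Y n \<Longrightarrow> P n \<phi> (basis_chain s) = \<phi> (basis_chain (p n s))" by (rule basis)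
qed

section \<open>Means on vertices\<close>

text \<open>
  A finitely additive probability measure on \<open>W\<close> that vanishes on finite sets, as a functional. The
  conditions only concern bounded functions.
\<close>

definition vertex_mean :: "'v set \<Rightarrow> (('v \<Rightarrow> real) \<Rightarrow> real) \<Rightarrow> bool" where
  "vertex_mean W m \<longleftrightarrow>
     (\<forall>f g. bounded (range f) \<longrightarrow> bounded (range g) \<longrightarrow> m (\<lambda>x. f x + g x) = m f + m g) \<and>
     (\<forall>f r. bounded (range f) \<longrightarrow> m (\<lambda>x. r * f x) = r * m f) \<and>
     (\<forall>f B. (\<forall>x. \<bar>f x\<bar> \<le> B) \<longrightarrow> \<bar>m f\<bar> \<le> B) \<and>
     (\<forall>f g F. bounded (range f) \<longrightarrow> bounded (range g) \<longrightarrow> finite F \<longrightarrow>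
        (\<forall>x\<in>W - F. f x = g x) \<longrightarrow> m f = m g) \<and>
     m (\<lambda>x. 1) = 1"

lemma vertex_meanD:
  assumes "vertex_mean W m"
  shows "bounded (range f) \<Longrightarrow> bounded (range g) \<Longrightarrow> m (\<lambda>x. f x + g x) = m f + m g"
    and "bounded (range f) \<Longrightarrow> m (\<lambda>x. r * f x) = r * m f"
    and "(\<And>x. \<bar>f x\<bar> \<le> B) \<Longrightarrow> \<bar>m f\<bar> \<le> B"
    and "bounded (range f) \<Longrightarrow> bounded (range g) \<Longrightarrow> finite F \<Longrightarrow> (\<And>x. x \<in> W - F \<Longrightarrow> f x = g x) \<Longrightarrow>
      m f = m g"
    and "m (\<lambda>x. c) = c"
proof -
  note a = assms[unfolded vertex_mean_def]
  note b = conjunct2[OF a]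
  note c = conjunct2[OF b]
  note d = conjunct2[OF c]
  show "bounded (range f) \<Longrightarrow> bounded (range g) \<Longrightarrow> m (\<lambda>x. f x + g x) = m f + m g"
    by (rule conjunct1[OF a, rule_format])
  show "bounded (range f) \<Longrightarrow> m (\<lambda>x. r * f x) = r * m f" by (rule conjunct1[OF b, rule_format])
  show "(\<And>x. \<bar>f x\<bar> \<le> B) \<Longrightarrow> \<bar>m f\<bar> \<le> B" by (rule conjunct1[OF c, rule_format])
  show "bounded (range f) \<Longrightarrow> bounded (range g) \<Longrightarrow> finite F \<Longrightarrow> (\<And>x. x \<in> W - F \<Longrightarrow> f x = g x) \<Longrightarrow>
      m f = m g"
    by (rule conjunct1[OF d, rule_format])
  have "m (\<lambda>x. c * 1) = c * m (\<lambda>x. 1)" by (rule conjunct1[OF b, rule_format]) simp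
  then show "m (\<lambda>x. c) = c" using conjunct2[OF d] by simp
qed

text \<open>
  The evaluations of bounded functions at the points of \<open>W\<close> lie in a compact product of intervals. A
  cluster point of the evaluations along the cofinite subsets of \<open>W\<close> satisfies every closed
  condition that holds for all evaluations outside a finite set.
\<close>

lemma vertex_mean_exists:
  assumes "infinite W"
  shows "\<exists>m. vertex_mean W m"
proof -
  define e :: "'a \<Rightarrow> ('a \<Rightarrow> real) \<Rightarrow> real" where "e x f = (if bounded (range f) then f x else 0)" for x f
  define b :: "('a \<Rightarrow> real) \<Rightarrow> real" where "b f = (SUP x. \<bar>f x\<bar>)" for f
  define U :: "(('a \<Rightarrow> real) \<Rightarrow> real) set" where "U = PiE UNIV (\<lambda>f. {- max 0 (b f)..max 0 (b f)})"
  define F where "F = filtermap e (inf cofinite (principal W))"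
  have "compactin (product_topology (\<lambda>f. euclideanreal) UNIV) U"
    unfolding U_def by (subst compactin_PiE) auto
  then have cU: "compact U" by (simp add: euclidean_product_topology)
  have "e x \<in> U" for x
  proof -
    have "\<bar>e x f\<bar> \<le> max 0 (b f)" for f
    proof (cases "bounded (range f)")
      case True
      then have "bdd_above (range (\<lambda>x. \<bar>f x\<bar>))"
        by (auto simp: bounded_iff bdd_above_def)
      then have "\<bar>f x\<bar> \<le> b f" unfolding b_def by (rule cSUP_upper2[where x=x]) auto
      then show ?thesis using True by (simp add: e_def)
    qed (simp add: e_def)
    then show ?thesis unfolding U_def by (auto simp: abs_le_iff minus_le_iff)
  qed
  then have FU: "eventually (\<lambda>m. m \<in> U) F" by (simp add: F_def eventually_filtermap)
  have "\<not> eventually (\<lambda>x. False) (inf cofinite (principal W))"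
    using assms by (simp add: eventually_inf_principal eventually_cofinite)
  then have ne: "F \<noteq> bot" unfolding F_def by (metis filtermap_bot_iff eventually_bot)
  \<comment> \<open>\<open>G\<close> refines the filter \<open>F\<close> and converges to the cluster point \<open>m\<close>, so identities pass to \<open>m\<close> by uniqueness of limits\<close>
  obtain m where m: "inf (nhds m) F \<noteq> bot"
    using cU FU ne unfolding compact_filter by blast
  define G where "G = inf (nhds m) F"
  have ne: "G \<noteq> bot" using m by (simp add: G_def)
  have lim: "((\<lambda>m. m f) \<longlongrightarrow> m f) G" for f
  proof -
    have "((\<lambda>m. m) \<longlongrightarrow> m) G" unfolding G_def by (simp add: filterlim_def filtermap_ident)
    from continuous_on_tendsto_compose[OF continuous_on_product_coordinates this, of f]
    show ?thesis by simp
  qed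
  have ev: "eventually P G" if "\<And>x. x \<in> W - S \<Longrightarrow> P (e x)" "finite S" for P S
  proof -
    have "eventually P F"
      unfolding F_def eventually_filtermap eventually_inf_principal eventually_cofinite
      by (rule finite_subset[OF _ \<open>finite S\<close>]) (use that(1) in auto)
    then show ?thesis unfolding G_def by (rule filter_leD[rotated]) simp
  qed
  note ev0 = ev[of "{}", simplified]
  have bd: "bounded (range (\<lambda>x. f x + g x))" if "bounded (range f)" "bounded (range g)" for f g :: "'a \<Rightarrow> real"
    using bounded_plus_comp[OF that] .
  have bd': "bounded (range (\<lambda>x. r * f x))" if "bounded (range f)" for f :: "'a \<Rightarrow> real" and r
    using bounded_scaleR_comp[OF that, of r] by simp
  have "vertex_mean W m"
    unfolding vertex_mean_def
  proof (intro conjI allI impI)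
    fix f g :: "'a \<Rightarrow> real" assume fg: "bounded (range f)" "bounded (range g)"
    have "eventually (\<lambda>m. m f + m g = m (\<lambda>x. f x + g x)) G"
      by (rule ev0) (auto simp: e_def fg bd)
    from Lim_transform_eventually[OF tendsto_add[OF lim lim] this]
    show "m (\<lambda>x. f x + g x) = m f + m g" by (rule tendsto_unique[OF ne lim])
  next
    fix f :: "'a \<Rightarrow> real" and r assume f: "bounded (range f)"
    have "eventually (\<lambda>m. r * m f = m (\<lambda>x. r * f x)) G"
      by (rule ev0) (auto simp: e_def f bd')
    from Lim_transform_eventually[OF tendsto_mult_left[OF lim] this]
    show "m (\<lambda>x. r * f x) = r * m f" by (rule tendsto_unique[OF ne lim])
  next
    fix f :: "'a \<Rightarrow> real" and B assume "\<forall>x. \<bar>f x\<bar> \<le> B"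
    then have "0 \<le> B" "\<And>x. \<bar>f x\<bar> \<le> B" using abs_ge_zero order_trans by blast+
    then have "eventually (\<lambda>m. \<bar>m f\<bar> \<le> B) G" by (intro ev0) (auto simp: e_def)
    then show "\<bar>m f\<bar> \<le> B"
      by (rule tendsto_upperbound[OF tendsto_rabs[OF lim] _ ne])
  next
    fix f g :: "'a \<Rightarrow> real" and S assume fg: "bounded (range f)" "bounded (range g)" "finite S" "\<forall>x\<in>W - S. f x = g x"
    have "eventually (\<lambda>m. m f = m g) G"
      by (rule ev[OF _ fg(3)]) (use fg in \<open>auto simp: e_def\<close>)
    from tendsto_unique[OF ne lim Lim_transform_eventually[OF lim this]] show "m f = m g" by simp
  next
    have "eventually (\<lambda>m. m (\<lambda>x. 1) = 1) G"
      by (rule ev0) (auto simp: e_def)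
    from tendsto_unique[OF ne lim tendsto_eventually[OF this]] show "m (\<lambda>x. 1) = 1" .
  qed
  then show ?thesis by blast
qed

primrec iterated_mean :: "(('v \<Rightarrow> real) \<Rightarrow> real) \<Rightarrow> nat \<Rightarrow> ('v list \<Rightarrow> real) \<Rightarrow> real" where
  "iterated_mean m 0 g = g []"
| "iterated_mean m (Suc k) g = m (\<lambda>x. iterated_mean m k (\<lambda>xs. g (x # xs)))"

definition generic_lists :: "'v set \<Rightarrow> 'v set \<Rightarrow> nat \<Rightarrow> 'v list set" where
  "generic_lists W F k = {w. length w = k \<and> distinct w \<and> set w \<subseteq> W - F}"

lemma iterated_mean_bound:
  assumes "vertex_mean W m" "\<And>w. \<bar>g w\<bar> \<le> B"
  shows "\<bar>iterated_mean m k g\<bar> \<le> B"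
  using assms(2)
proof (induction k arbitrary: g)
  case (Suc k)
  have "\<bar>iterated_mean m k (\<lambda>xs. g (x # xs))\<bar> \<le> B" for x by (rule Suc.IH) (rule Suc.prems)
  then show ?case by (simp add: vertex_meanD(3)[OF assms(1)])
qed simp

lemma iterated_mean_bounded:
  assumes "vertex_mean W m" "bounded (range g)"
  shows "bounded (range (\<lambda>x. iterated_mean m k (\<lambda>xs. g (x # xs))))"
proof -
  obtain B where "\<And>w. \<bar>g w\<bar> \<le> B" using assms(2) by (auto simp: bounded_iff)
  then have "\<bar>iterated_mean m k (\<lambda>xs. g (x # xs))\<bar> \<le> B" for x
    by (intro iterated_mean_bound[OF assms(1)])
  then show ?thesis by (auto simp: bounded_iff)
qed

lemma bounded_range_Cons: "bounded (range g) \<Longrightarrow> bounded (range (\<lambda>xs. g (x # xs)))"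
  by (erule bounded_subset) auto

lemma iterated_mean_add:
  assumes "vertex_mean W m" "bounded (range f)" "bounded (range g)"
  shows "iterated_mean m k (\<lambda>w. f w + g w) = iterated_mean m k f + iterated_mean m k g"
  using assms(2,3)
proof (induction k arbitrary: f g)
  case (Suc k)
  then show ?case
    using iterated_mean_bounded[OF assms(1) Suc.prems(1)] iterated_mean_bounded[OF assms(1) Suc.prems(2)]
    by (simp add: Suc.IH bounded_range_Cons vertex_meanD(1)[OF assms(1)])
qed simp

lemma iterated_mean_scale:
  assumes "vertex_mean W m" "bounded (range f)"
  shows "iterated_mean m k (\<lambda>w. r * f w) = r * iterated_mean m k f"
  using assms(2)
proof (induction k arbitrary: f)
  case (Suc k)
  then show ?case
    using iterated_mean_bounded[OF assms(1) Suc.prems(1)]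
    by (simp add: Suc.IH bounded_range_Cons vertex_meanD(2)[OF assms(1)])
qed simp

lemma iterated_mean_const:
  assumes "vertex_mean W m" shows "iterated_mean m k (\<lambda>w. c) = c"
  by (induction k) (simp_all add: vertex_meanD(5)[OF assms])

lemma bounded_range_sum:
  fixes g :: "'i \<Rightarrow> 'b \<Rightarrow> real"
  assumes "\<And>i. i \<in> I \<Longrightarrow> bounded (range (g i))"
  shows "bounded (range (\<lambda>w. \<Sum>i\<in>I. r i * g i w))"
  using assms
proof (induction I rule: infinite_finite_induct)
  case (insert i I)
  then show ?case
    using bounded_plus_comp[of "\<lambda>w. r i * g i w" UNIV "\<lambda>w. \<Sum>i\<in>I. r i * g i w"]
      bounded_scaleR_comp[of "g i" UNIV "r i"] by simp
qed auto

lemma iterated_mean_sum: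
  assumes m: "vertex_mean W m" and g: "\<And>i. i \<in> I \<Longrightarrow> bounded (range (g i))"
  shows "iterated_mean m k (\<lambda>w. \<Sum>i\<in>I. r i * g i w) = (\<Sum>i\<in>I. r i * iterated_mean m k (g i))"
  using g
proof (induction I rule: infinite_finite_induct)
  case (insert i I)
  have "bounded (range (\<lambda>w. r i * g i w))"
    using bounded_scaleR_comp[of "g i" UNIV "r i"] insert by simp
  moreover have "bounded (range (\<lambda>w. \<Sum>i\<in>I. r i * g i w))"
    by (rule bounded_range_sum) (use insert in auto)
  ultimately show ?case
    using insert by (simp add: iterated_mean_add[OF m] iterated_mean_scale[OF m])
qed (auto simp: iterated_mean_const[OF m])

text \<open>
  In an iterated mean, each entry is averaged while the earlier ones are fixed, so it may be assumed to
  avoid them: the finite set \<open>F\<close> of vertices to be avoided grows with every entry.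
\<close>

lemma iterated_mean_cong:
  assumes "vertex_mean W m" "finite F" "bounded (range f)" "bounded (range g)"
    "\<And>w. w \<in> generic_lists W F k \<Longrightarrow> f w = g w"
  shows "iterated_mean m k f = iterated_mean m k g"
  using assms(2-)
proof (induction k arbitrary: F f g)
  case 0
  then show ?case by (simp add: generic_lists_def)
next
  case (Suc k)
  have *: "iterated_mean m k (\<lambda>xs. f (x # xs)) = iterated_mean m k (\<lambda>xs. g (x # xs))" if "x \<in> W - F" for x
  proof (rule Suc.IH)
    fix w assume "w \<in> generic_lists W (insert x F) k"
    then have "x # w \<in> generic_lists W F (Suc k)" using that by (auto simp: generic_lists_def)
    then show "f (x # w) = g (x # w)" by (rule Suc.prems(4))
  qed (use Suc.prems in \<open>auto intro: bounded_range_Cons\<close>)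
  show ?case
    unfolding iterated_mean.simps
    by (rule vertex_meanD(4)[OF assms(1) _ _ Suc.prems(1) *]) (intro iterated_mean_bounded[OF assms(1)] Suc.prems)+
qed

lemma delete_nth_simps [simp]:
  "delete_nth 0 (x # xs) = xs" "delete_nth (Suc i) (x # xs) = x # delete_nth i xs"
  by (simp_all add: delete_nth_def)

text \<open>
  A variable that does not occur contributes the mean of a constant. This is what makes averaging
  over labels compatible with faces, where one label is forgotten.
\<close>

lemma iterated_mean_delete:
  assumes "vertex_mean W m" "i \<le> k"
  shows "iterated_mean m (Suc k) (\<lambda>w. g (delete_nth i w)) = iterated_mean m k g"
  using assms(2)
proof (induction k arbitrary: i g)
  case 0
  then show ?case using iterated_mean_const[OF assms(1), of "Suc 0"] by simp
next
  case (Suc k)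
  show ?case
  proof (cases i)
    case 0
    then show ?thesis using iterated_mean_const[OF assms(1), of "Suc 0"] by simp
  next
    case (Suc j)
    with Suc.prems have "j \<le> k" by simp
    have "iterated_mean m (Suc (Suc k)) (\<lambda>w. g (delete_nth i w))
        = m (\<lambda>x. iterated_mean m (Suc k) (\<lambda>w. g (x # delete_nth j w)))"
      unfolding Suc by (subst iterated_mean.simps(2)) simp
    also have "\<dots> = iterated_mean m (Suc k) g"
      using Suc.IH[OF \<open>j \<le> k\<close>, of "\<lambda>w. g (_ # w)"] by (simp del: iterated_mean.simps add: iterated_mean.simps(2)[of m k g])
    finally show ?thesis .
  qed
qed

section \<open>Averaged cochain maps and averaged homotopies\<close>

text \<open>
  A face of \<open>s\<close> is labelled by one vertex less. Adding the missing vertex as a dummy variable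
  lets all faces be averaged over the same lists as \<open>s\<close>, and for each of these lists \<open>w\<close> the images of the faces of
  \<open>s\<close> are the faces of \<open>j (Suc n) s w\<close>.
\<close>

lemma mean_contraction:
  fixes X :: "'a cell_system" and Y :: "'b cell_system" and j :: "nat \<Rightarrow> 'a \<Rightarrow> 'v list \<Rightarrow> 'b"
  assumes X: "closed_faces X" and Y: "closed_faces Y"
    and mean: "\<And>n s. s \<in> cells X n \<Longrightarrow> vertex_mean (W n s) (m n s)"
    and same: "\<And>n s k. s \<in> cells X (Suc n) \<Longrightarrow> k \<le> Suc n \<Longrightarrow> m n (face X (Suc n) k s) = m (Suc n) s"
    and cell: "\<And>n s w. s \<in> cells X n \<Longrightarrow> w \<in> generic_lists (W n s) {} (Suc n) \<Longrightarrow> j n s w \<in> cells Y n"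
    and face: "\<And>n s w k. s \<in> cells X (Suc n) \<Longrightarrow> w \<in> generic_lists (W (Suc n) s) {} (Suc (Suc n)) \<Longrightarrow> k \<le> Suc n \<Longrightarrow>
       face Y (Suc n) k (j (Suc n) s w) = j n (face X (Suc n) k s) (delete_nth k w)"
  defines "P \<equiv> \<lambda>n \<phi>. cell_cochain X n (\<lambda>s. iterated_mean (m n s) (Suc n) (\<lambda>w. \<phi> (basis_chain (j n s w))))"
  shows "cocycle_contraction Y X n (P n)"
proof -
  have co: "P n \<phi> \<in> cochains X n" for n \<phi> unfolding P_def by (rule cell_cochain_cochain)
  have basis: "P n \<phi> (basis_chain s) = iterated_mean (m n s) (Suc n) (\<lambda>w. \<phi> (basis_chain (j n s w)))"
    if "s \<in> cells X n" for n \<phi> s using that by (simp add: P_def)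
  have bd: "bounded (range (\<lambda>w. \<phi> (basis_chain (a w))))" if "\<phi> \<in> bounded_cochains Y n" for \<phi> n and a :: "'v list \<Rightarrow> 'b"
    using bounded_cochain_bound(1)[OF that] unfolding bounded_iff by auto
  have le: "\<bar>P n \<phi> (basis_chain s)\<bar> \<le> cochain_norm Y n \<phi>" if "\<phi> \<in> bounded_cochains Y n" "s \<in> cells X n" for n \<phi> s
    unfolding basis[OF that(2)] by (rule iterated_mean_bound[OF mean[OF that(2)]]) (rule bounded_cochain_bound[OF that(1)])
  have bnd: "P n \<phi> \<in> bounded_cochains X n" if "\<phi> \<in> bounded_cochains Y n" for n \<phi>
    using le[OF that] by (rule bounded_cochainI[OF co])
  have d: "coboundary X n (P n \<phi>) = P (Suc n) (coboundary Y n \<phi>)" if \<phi>: "\<phi> \<in> bounded_cochains Y n" for n \<phi>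
  proof (rule cochain_eqI)
    show "coboundary X n (P n \<phi>) \<in> cochains X (Suc n)" "P (Suc n) (coboundary Y n \<phi>) \<in> cochains X (Suc n)"
      by (intro co coboundary_cochain X)+
    fix s assume s: "s \<in> cells X (Suc n)"
    have f: "face X (Suc n) k s \<in> cells X n" if "k \<le> Suc n" for k using X s that by (simp add: closed_faces_def)
    have "coboundary X n (P n \<phi>) (basis_chain s)
        = (\<Sum>k\<le>Suc n. (-1) ^ k * iterated_mean (m (Suc n) s) (Suc n) (\<lambda>w. \<phi> (basis_chain (j n (face X (Suc n) k s) w))))"
      unfolding coboundary_basis[OF X co s] using f s by (intro sum.cong) (simp_all add: basis same)
    also have "\<dots> = (\<Sum>k\<le>Suc n. (-1) ^ k * iterated_mean (m (Suc n) s) (Suc (Suc n))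
        (\<lambda>w. \<phi> (basis_chain (j n (face X (Suc n) k s) (delete_nth k w)))))"
      by (intro sum.cong refl arg_cong2[where f="(*)"] iterated_mean_delete[symmetric, OF mean[OF s]]) auto
    also have "\<dots> = iterated_mean (m (Suc n) s) (Suc (Suc n))
        (\<lambda>w. \<Sum>k\<le>Suc n. (-1) ^ k * \<phi> (basis_chain (j n (face X (Suc n) k s) (delete_nth k w))))"
      by (rule iterated_mean_sum[symmetric, OF mean[OF s]]) (rule bd[OF \<phi>])
    also have "\<dots> = iterated_mean (m (Suc n) s) (Suc (Suc n)) (\<lambda>w. coboundary Y n \<phi> (basis_chain (j (Suc n) s w)))"
    proof (rule iterated_mean_cong[OF mean[OF s], of "{}"])
      show "bounded (range (\<lambda>w. \<Sum>k\<le>Suc n. (-1) ^ k * \<phi> (basis_chain (j n (face X (Suc n) k s) (delete_nth k w)))))"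
        by (rule bounded_range_sum) (rule bd[OF \<phi>])
      show "bounded (range (\<lambda>w. coboundary Y n \<phi> (basis_chain (j (Suc n) s w))))"
        by (rule bd[OF bounded_coboundary[OF Y \<phi>]])
      fix w assume w: "w \<in> generic_lists (W (Suc n) s) {} (Suc (Suc n))"
      show "(\<Sum>k\<le>Suc n. (-1) ^ k * \<phi> (basis_chain (j n (face X (Suc n) k s) (delete_nth k w))))
          = coboundary Y n \<phi> (basis_chain (j (Suc n) s w))"
        unfolding coboundary_basis[OF Y bounded_cochain_cochain[OF \<phi>] cell[OF s w]]
        using face[OF s w] by (intro sum.cong) auto
    qed simp
    also have "\<dots> = P (Suc n) (coboundary Y n \<phi>) (basis_chain s)" by (rule basis[OF s, symmetric])
    finally show "coboundary X n (P n \<phi>) (basis_chain s) = P (Suc n) (coboundary Y n \<phi>) (basis_chain s)" .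
  qed
  have add: "P n (\<lambda>c. \<phi> c + \<psi> c) = (\<lambda>c. P n \<phi> c + P n \<psi> c)"
    if "\<phi> \<in> bounded_cochains Y n" "\<psi> \<in> bounded_cochains Y n" for \<phi> \<psi> n
  proof (rule cochain_eqI[OF co])
    show "(\<lambda>c. P n \<phi> c + P n \<psi> c) \<in> cochains X n"
      using co[of n \<phi>] co[of n \<psi>] by (simp add: cochains_def algebra_simps)
    show "P n (\<lambda>c. \<phi> c + \<psi> c) (basis_chain s) = P n \<phi> (basis_chain s) + P n \<psi> (basis_chain s)" if "s \<in> cells X n" for s
      unfolding basis[OF that] by (rule iterated_mean_add[OF mean[OF that]]; rule bd; fact)
  qed
  have scale: "P n (\<lambda>c. r * \<phi> c) = (\<lambda>c. r * P n \<phi> c)" if "\<phi> \<in> bounded_cochains Y n" for \<phi> n r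
  proof (rule cochain_eqI[OF co])
    show "(\<lambda>c. r * P n \<phi> c) \<in> cochains X n"
      using co[of n \<phi>] by (simp add: cochains_def algebra_simps)
    show "P n (\<lambda>c. r * \<phi> c) (basis_chain s) = r * P n \<phi> (basis_chain s)" if "s \<in> cells X n" for s
      unfolding basis[OF that] by (rule iterated_mean_scale[OF mean[OF that]]; rule bd; fact)
  qed
  have 0: "P n (\<lambda>c. 0) = (\<lambda>c. 0)" for n
  proof (rule cochain_eqI[OF co])
    show "(\<lambda>c. 0) \<in> cochains X n" by (simp add: cochains_def)
  qed (simp add: basis del: iterated_mean.simps add: iterated_mean_const[OF mean])
  show ?thesis
    unfolding cocycle_contraction_def
  proof (intro conjI ballI allI)
    fix \<phi> assume \<phi>: "\<phi> \<in> bounded_cocycles Y n"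
    then have \<phi>': "\<phi> \<in> bounded_cochains Y n" "coboundary Y n \<phi> = (\<lambda>c. 0)"
      by (auto simp: bounded_cocycles_def)
    show "P n \<phi> \<in> bounded_cocycles X n"
      using \<phi>' by (simp add: bounded_cocycles_def bnd d 0)
    show "cochain_norm X n (P n \<phi>) \<le> cochain_norm Y n \<phi>"
      by (rule cochain_norm_le) (use \<phi>' in \<open>auto simp: le bounded_cochain_bound\<close>)
    show "P n (\<lambda>c. r * \<phi> c) = (\<lambda>c. r * P n \<phi> c)" for r by (rule scale[OF \<phi>'(1)])
    fix \<psi> assume "\<psi> \<in> bounded_cocycles Y n"
    then show "P n (\<lambda>c. \<phi> c + \<psi> c) = (\<lambda>c. P n \<phi> c + P n \<psi> c)"
      using \<phi>' by (intro add) (auto simp: bounded_cocycles_def)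
  next
    show "P n ` bounded_coboundaries Y n \<subseteq> bounded_coboundaries X n"
    proof (cases n)
      case 0
      then show ?thesis by (simp add: bounded_coboundaries_def \<open>\<And>n. P n (\<lambda>c. 0) = (\<lambda>c. 0)\<close>)
    next
      case (Suc m)
      then show ?thesis
        by (auto simp: bounded_coboundaries_def d[symmetric] intro: bnd)
    qed
  qed
qed

text \<open>
  The cancellation in the prism operator of a simplicial homotopy: \<open>F i k\<close> is the value on the \<open>k\<close>-th face of
  the \<open>i\<close>-th prism simplex, and \<open>G k i\<close> the value on the \<open>i\<close>-th prism simplex over the \<open>k\<close>-th face. The
  sides cancel against \<open>G\<close> by \<open>low\<close> and \<open>high\<close>, and faces between neighbouring prism simplices cancel by \<open>mid\<close>, so
  only top and bottom remain.
\<close>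

lemma prism_cancellation:
  fixes F G :: "nat \<Rightarrow> nat \<Rightarrow> real"
  assumes low: "\<And>i k. k < i \<Longrightarrow> i \<le> n \<Longrightarrow> F i k = G k (i - 1)"
    and high: "\<And>i k. i < k \<Longrightarrow> k \<le> n \<Longrightarrow> F i (Suc k) = G k i"
    and mid: "\<And>i. i < n \<Longrightarrow> F (Suc i) (Suc i) = F i (Suc i)"
  shows "(\<Sum>i\<le>n. \<Sum>k\<le>Suc n. (-1) ^ (i + k) * F i k) + (\<Sum>k\<le>n. \<Sum>i<n. (-1) ^ (k + i) * G k i)
    = F 0 0 - F n (Suc n)"
proof -
  define f where "f = (\<lambda>(i,k). (-1) ^ (i + k) * F i k)"
  define g where "g = (\<lambda>(k,i). (-1) ^ (k + i) * G k i)"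
  have sub: "A \<subseteq> {..n} \<times> {..Suc n} \<Longrightarrow> finite A" for A by (rule finite_subset) auto
  \<comment> \<open>\<open>A\<close> and \<open>B\<close> index the faces on the side of the prism, \<open>C\<close> and \<open>D\<close> those between neighbours, top and bottom\<close>
  define A where "A = {(i,k). k < i \<and> i \<le> n}"
  define B where "B = {(i,k). Suc i < k \<and> k \<le> Suc n}"
  define C where "C = (\<lambda>i. (i,i)) ` {..n}"
  define D where "D = (\<lambda>i. (i,Suc i)) ` {..n}"
  have fA: "f (i, k) = - g (k, i - 1)" if "(i, k) \<in> A" for i k
    by (cases i) (use that in \<open>auto simp: A_def f_def g_def low add.commute\<close>)
  have fB: "f (i, k) = - g (k - 1, i)" if "(i, k) \<in> B" for i k
    by (cases k) (use that in \<open>auto simp: B_def f_def g_def high add.commute\<close>)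
  have "(\<Sum>i\<le>n. \<Sum>k\<le>Suc n. (-1) ^ (i + k) * F i k) = sum f ({..n} \<times> {..Suc n})"
    unfolding f_def by (rule sum.cartesian_product)
  also have "{..n} \<times> {..Suc n} = (A \<union> B) \<union> (C \<union> D)"
    unfolding A_def B_def C_def D_def by (auto simp: image_iff)
  also have "sum f \<dots> = sum f (A \<union> B) + sum f (C \<union> D)"
    by (rule sum.union_disjoint) (auto intro!: sub simp: A_def B_def C_def D_def)
  also have "sum f (A \<union> B) = sum f A + sum f B"
    by (rule sum.union_disjoint) (auto intro!: sub simp: A_def B_def)
  also have "sum f (C \<union> D) = sum f C + sum f D"
    by (rule sum.union_disjoint) (auto intro!: sub simp: C_def D_def)
  also have "sum f C = (\<Sum>i\<le>n. F i i)"
    unfolding C_def by (subst sum.reindex) (auto simp: inj_on_def f_def)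
  also have "sum f D = (\<Sum>i\<le>n. - F i (Suc i))"
    unfolding D_def by (subst sum.reindex) (auto simp: inj_on_def f_def)
  also have "(\<Sum>i\<le>n. F i i) + (\<Sum>i\<le>n. - F i (Suc i)) = F 0 0 - F n (Suc n)"
  proof -
    have "(\<Sum>i\<le>n. F i i) = F 0 0 + (\<Sum>i<n. F (Suc i) (Suc i))"
      by (simp only: lessThan_Suc_atMost[symmetric] sum.lessThan_Suc_shift)
    also have "(\<Sum>i<n. F (Suc i) (Suc i)) = (\<Sum>i<n. F i (Suc i))" by (intro sum.cong) (auto simp: mid)
    finally show ?thesis by (simp add: lessThan_Suc_atMost[symmetric] sum_negf)
  qed
  also have "sum f A = - sum g {(k,i). k \<le> i \<and> i < n}"
    unfolding sum_negf[symmetric]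
    by (rule sum.reindex_bij_witness[where i="\<lambda>(k,i). (Suc i, k)" and j="\<lambda>(i,k). (k, i - 1)"])
       (auto simp: fA, auto simp: A_def)
  also have "sum f B = - sum g {(k,i). i < k \<and> k \<le> n}"
    unfolding sum_negf[symmetric]
    by (rule sum.reindex_bij_witness[where i="\<lambda>(k,i). (i, Suc k)" and j="\<lambda>(i,k). (k - 1, i)"])
       (auto simp: fB, auto simp: B_def)
  also have "(\<Sum>k\<le>n. \<Sum>i<n. (-1) ^ (k + i) * G k i) = sum g ({..n} \<times> {..<n})"
    unfolding g_def by (rule sum.cartesian_product)
  moreover have "{..n} \<times> {..<n} = {(k,i). k \<le> i \<and> i < n} \<union> {(k,i). i < k \<and> k \<le> n}" by auto
  moreover have "sum g ({(k,i). k \<le> i \<and> i < n} \<union> {(k,i). i < k \<and> k \<le> n})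
      = sum g {(k,i). k \<le> i \<and> i < n} + sum g {(k,i). i < k \<and> k \<le> n}"
    by (rule sum.union_disjoint) (auto intro!: sub)
  ultimately show ?thesis by simp
qed

text \<open>
  The functions \<open>h n i\<close> are the simplices of a homotopy from \<open>s\<close> to \<open>upper n s w\<close> which is
  only defined on generic lists \<open>w\<close>. Averaging the prism operator over \<open>w\<close> gives a bounded
  cochain \<open>T\<close> whose coboundary, for a cocycle \<open>\<phi>\<close>, is the difference of \<open>\<phi>\<close> on the averaged top and on the bottom.
\<close>

lemma mean_homotopy:
  fixes X :: "'a cell_system" and h :: "nat \<Rightarrow> nat \<Rightarrow> 'a \<Rightarrow> 'v list \<Rightarrow> 'a"
  assumes X: "closed_faces X"
    and mean: "\<And>n s. s \<in> cells X n \<Longrightarrow> vertex_mean (W n s) (m n s)"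
    and same: "\<And>n s k. s \<in> cells X (Suc n) \<Longrightarrow> k \<le> Suc n \<Longrightarrow> m n (face X (Suc n) k s) = m (Suc n) s"
    and fin: "\<And>n s. s \<in> cells X n \<Longrightarrow> finite (F n s)"
    and cell: "\<And>n s w i. s \<in> cells X n \<Longrightarrow> w \<in> generic_lists (W n s) (F n s) (Suc n) \<Longrightarrow> i \<le> n \<Longrightarrow>
      h n i s w \<in> cells X (Suc n)"
    and low: "\<And>n s w i k. s \<in> cells X (Suc n) \<Longrightarrow> w \<in> generic_lists (W (Suc n) s) (F (Suc n) s) (Suc (Suc n)) \<Longrightarrow>
      k \<le> i \<Longrightarrow> i \<le> n \<Longrightarrow>
      face X (Suc (Suc n)) k (h (Suc n) (Suc i) s w) = h n i (face X (Suc n) k s) (delete_nth k w)"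
    and high: "\<And>n s w i k. s \<in> cells X (Suc n) \<Longrightarrow> w \<in> generic_lists (W (Suc n) s) (F (Suc n) s) (Suc (Suc n)) \<Longrightarrow>
      i < k \<Longrightarrow> k \<le> Suc n \<Longrightarrow>
      face X (Suc (Suc n)) (Suc k) (h (Suc n) i s w) = h n i (face X (Suc n) k s) (delete_nth k w)"
    and mid: "\<And>n s w i. s \<in> cells X n \<Longrightarrow> w \<in> generic_lists (W n s) (F n s) (Suc n) \<Longrightarrow> i < n \<Longrightarrow>
      face X (Suc n) (Suc i) (h n (Suc i) s w) = face X (Suc n) (Suc i) (h n i s w)"
    and upper: "\<And>n s w. s \<in> cells X n \<Longrightarrow> w \<in> generic_lists (W n s) (F n s) (Suc n) \<Longrightarrow>
      face X (Suc n) 0 (h n 0 s w) = upper n s w"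
    and bottom: "\<And>n s w. s \<in> cells X n \<Longrightarrow> w \<in> generic_lists (W n s) (F n s) (Suc n) \<Longrightarrow>
      face X (Suc n) (Suc n) (h n n s w) = s"
    and \<phi>: "\<phi> \<in> bounded_cocycles X n"
    and \<psi>: "\<psi> \<in> cochains X n"
      "\<And>s. s \<in> cells X n \<Longrightarrow> \<psi> (basis_chain s) = iterated_mean (m n s) (Suc n) (\<lambda>w. \<phi> (basis_chain (upper n s w)))"
  shows "(\<lambda>c. \<psi> c - \<phi> c) \<in> bounded_coboundaries X n"
proof -
  have \<phi>': "\<phi> \<in> bounded_cochains X n" "coboundary X n \<phi> = (\<lambda>c. 0)" using \<phi> by (auto simp: bounded_cocycles_def)
  define B where "B = cochain_norm X n \<phi>"
  have B: "\<bar>\<phi> (basis_chain a)\<bar> \<le> B" "0 \<le> B" for a unfolding B_def by (rule bounded_cochain_bound[OF \<phi>'(1)])+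
  have bd: "bounded (range (\<lambda>w. \<phi> (basis_chain (a w))))" for a :: "'v list \<Rightarrow> 'a"
    using B(1) unfolding bounded_iff by auto
  have diff: "(\<lambda>c. \<psi> c - \<phi> c) \<in> cochains X n"
    using \<psi>(1) bounded_cochain_cochain[OF \<phi>'(1)] by (simp add: cochains_def algebra_simps)
  \<comment> \<open>with \<open>p = n - 1\<close>; for \<open>n = 0\<close> the sum is empty, so \<open>key\<close> then says that the two cochains are equal\<close>
  define Q where "Q = (\<lambda>p s w. \<Sum>i<n. (-1) ^ i * \<phi> (basis_chain (h p i s w)))"
  have bdQ: "bounded (range (\<lambda>w. Q p s (a w)))" for p s and a :: "'v list \<Rightarrow> 'v list"
    unfolding Q_def by (rule bounded_range_sum) (rule bd)
  have key: "\<psi> (basis_chain s) - \<phi> (basis_chain s)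
      = (\<Sum>k\<le>n. (-1) ^ k * iterated_mean (m n s) n (Q (n - 1) (face X n k s)))" if s: "s \<in> cells X n" for s
  proof -
    note M = mean[OF s]
    have "(\<Sum>k\<le>n. (-1) ^ k * iterated_mean (m n s) n (Q (n - 1) (face X n k s)))
        = (\<Sum>k\<le>n. (-1) ^ k * iterated_mean (m n s) (Suc n) (\<lambda>w. Q (n - 1) (face X n k s) (delete_nth k w)))"
      by (intro sum.cong refl arg_cong2[where f="(*)"] iterated_mean_delete[symmetric, OF M]) auto
    also have "\<dots> = iterated_mean (m n s) (Suc n) (\<lambda>w. \<Sum>k\<le>n. (-1) ^ k * Q (n - 1) (face X n k s) (delete_nth k w))"
      by (rule iterated_mean_sum[symmetric, OF M]) (rule bdQ)
    also have "\<dots> = iterated_mean (m n s) (Suc n) (\<lambda>w. \<phi> (basis_chain (upper n s w)) + (-1) * \<phi> (basis_chain s))"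
    proof (rule iterated_mean_cong[OF M fin[OF s]])
      show "bounded (range (\<lambda>w. \<Sum>k\<le>n. (-1) ^ k * Q (n - 1) (face X n k s) (delete_nth k w)))"
        by (rule bounded_range_sum) (rule bdQ)
      show "bounded (range (\<lambda>w. \<phi> (basis_chain (upper n s w)) + (-1) * \<phi> (basis_chain s)))"
        by (rule bounded_plus_comp[OF bd]) simp
      fix w assume w: "w \<in> generic_lists (W n s) (F n s) (Suc n)"
      define f where "f i k = \<phi> (basis_chain (face X (Suc n) k (h n i s w)))" for i k
      define g where "g k i = \<phi> (basis_chain (h (n - 1) i (face X n k s) (delete_nth k w)))" for i k
      have "(\<Sum>k\<le>Suc n. (-1) ^ k * f i k) = 0" if "i \<le> n" for i
        using coboundary_basis[OF X bounded_cochain_cochain[OF \<phi>'(1)] cell[OF s w that]] \<phi>'(2)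
        unfolding f_def by (simp del: sum.atMost_Suc)
      then have 0: "(\<Sum>i\<le>n. (-1) ^ i * (\<Sum>k\<le>Suc n. (-1) ^ k * f i k)) = 0"
        by (intro sum.neutral) simp
      have "(\<Sum>i\<le>n. \<Sum>k\<le>Suc n. (-1) ^ (i + k) * f i k) + (\<Sum>k\<le>n. \<Sum>i<n. (-1) ^ (k + i) * g k i) = f 0 0 - f n (Suc n)"
      proof (rule prism_cancellation)
        fix i k :: nat assume "k < i" "i \<le> n"
        then obtain i' n' where e: "i = Suc i'" "n = Suc n'" by (metis less_zeroE not0_implies_Suc le_zero_eq)
        then show "f i k = g k (i - 1)"
          using low[of s n' w k i'] s w \<open>k < i\<close> \<open>i \<le> n\<close> by (simp add: f_def g_def)
      next
        fix i k :: nat assume "i < k" "k \<le> n"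
        then obtain n' where e: "n = Suc n'" by (metis less_zeroE not0_implies_Suc le_zero_eq)
        then show "f i (Suc k) = g k i"
          using high[of s n' w i k] s w \<open>i < k\<close> \<open>k \<le> n\<close> by (simp add: f_def g_def)
      qed (simp add: f_def mid s w)
      then have "(\<Sum>k\<le>n. \<Sum>i<n. (-1) ^ (k + i) * g k i) = f 0 0 - f n (Suc n)"
        using 0 by (simp del: sum.atMost_Suc add: sum_distrib_left power_add mult.assoc)
      moreover have "(\<Sum>k\<le>n. \<Sum>i<n. (-1) ^ (k + i) * g k i) = (\<Sum>k\<le>n. (-1) ^ k * Q (n - 1) (face X n k s) (delete_nth k w))"
        by (simp add: Q_def g_def sum_distrib_left power_add mult.assoc)
      ultimately show "(\<Sum>k\<le>n. (-1) ^ k * Q (n - 1) (face X n k s) (delete_nth k w))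
          = \<phi> (basis_chain (upper n s w)) + (-1) * \<phi> (basis_chain s)"
        by (simp add: f_def upper bottom s w)
    qed
    also have "\<dots> = iterated_mean (m n s) (Suc n) (\<lambda>w. \<phi> (basis_chain (upper n s w))) - \<phi> (basis_chain s)"
      by (subst iterated_mean_add[OF M bd]) (simp_all del: iterated_mean.simps add: iterated_mean_const[OF M])
    finally show ?thesis using \<psi>(2)[OF s] by simp
  qed
  show ?thesis
  proof (cases n)
    case 0
    have "(\<lambda>c. \<psi> c - \<phi> c) = (\<lambda>c. 0)"
    proof (rule cochain_eqI[OF diff])
      show "\<psi> (basis_chain s) - \<phi> (basis_chain s) = 0" if "s \<in> cells X n" for s
        using key[OF that] 0 by (simp add: Q_def)
    qed (simp add: cochains_def)
    then show ?thesis using 0 by (simp add: bounded_coboundaries_def)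
  next
    case (Suc p)
    define T where "T = cell_cochain X p (\<lambda>s. iterated_mean (m p s) n (Q p s))"
    have T: "T \<in> bounded_cochains X p"
    proof (rule bounded_cochainI)
      show "T \<in> cochains X p" unfolding T_def by (rule cell_cochain_cochain)
      fix s assume s: "s \<in> cells X p"
      have "\<bar>Q p s w\<bar> \<le> real n * B" for w
      proof -
        have "\<bar>Q p s w\<bar> \<le> (\<Sum>i<n. \<bar>(-1) ^ i * \<phi> (basis_chain (h p i s w))\<bar>)" unfolding Q_def by (rule sum_abs)
        also have "\<dots> \<le> (\<Sum>i<n. B)" by (rule sum_mono) (simp add: abs_mult B)
        finally show ?thesis by simp
      qed
      then show "\<bar>T (basis_chain s)\<bar> \<le> real n * B"
        unfolding T_def cell_cochain_basis[OF s] by (rule iterated_mean_bound[OF mean[OF s]])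
    qed
    have "(\<lambda>c. \<psi> c - \<phi> c) = coboundary X p T"
    proof (rule cochain_eqI[OF diff])
      show "coboundary X p T \<in> cochains X n"
        unfolding Suc by (rule coboundary_cochain[OF X bounded_cochain_cochain[OF T]])
      fix s assume s: "s \<in> cells X n"
      have f: "face X n k s \<in> cells X p" if "k \<le> n" for k using X s that Suc by (simp add: closed_faces_def)
      have "coboundary X p T (basis_chain s) = (\<Sum>k\<le>n. (-1) ^ k * T (basis_chain (face X n k s)))"
        using coboundary_basis[OF X bounded_cochain_cochain[OF T], of s] s Suc by simp
      also have "\<dots> = (\<Sum>k\<le>n. (-1) ^ k * iterated_mean (m n s) n (Q (n - 1) (face X n k s)))"
        using f same[of s p] s Suc by (intro sum.cong) (auto simp: T_def simp del: iterated_mean.simps)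
      also have "\<dots> = \<psi> (basis_chain s) - \<phi> (basis_chain s)" using key[OF s] by simp
      finally show "\<psi> (basis_chain s) - \<phi> (basis_chain s) = coboundary X p T (basis_chain s)" by simp
    qed
    then show ?thesis using T Suc by (simp add: bounded_coboundaries_def)
  qed
qed

section \<open>Affine simplices and the realization\<close>

abbreviation simplex_space :: "'v set \<Rightarrow> ('v \<Rightarrow> real) topology" where
  "simplex_space A \<equiv> subtopology (powertop_real UNIV) (affine_simplex A)"

lemma topspace_simplex_space [simp]: "topspace (simplex_space A) = affine_simplex A"
  by simp

text \<open>
  The affine map induced by a map of vertices, in barycentric coordinates. Faces, relabellings,
  collapses and prisms are all of this form, so continuity and functoriality are proved once.
\<close>

definition push :: "('v \<Rightarrow> 'w) \<Rightarrow> 'v set \<Rightarrow> ('v \<Rightarrow> real) \<Rightarrow> 'w \<Rightarrow> real" where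
  "push f A t = (\<lambda>w. \<Sum>v | v \<in> A \<and> f v = w. t v)"

definition corner :: "'v \<Rightarrow> 'v \<Rightarrow> real" where
  "corner a = (\<lambda>w. if w = a then 1 else 0)"

lemma corner_in_affine_simplex: "finite A \<Longrightarrow> a \<in> A \<Longrightarrow> corner a \<in> affine_simplex A"
  by (auto simp: affine_simplex_def corner_def)

lemma affine_simplex_mono:
  assumes "finite A" "B \<subseteq> A" shows "affine_simplex B \<subseteq> affine_simplex A"
proof
  fix t assume "t \<in> affine_simplex B"
  from affine_simplex_support[OF finite_subset[OF assms(2,1)] this] show "t \<in> affine_simplex A"
    using assms by blast
qed

lemma affine_simplex_singleton: "affine_simplex {a} = {corner a}"
  by (auto simp: affine_simplex_def corner_def)

lemma path_connectedin_affine_simplex: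
  "path_connectedin (powertop_real UNIV) (affine_simplex (A :: 'v set))"
proof -
  define g where "g = (\<lambda>(x :: 'v \<Rightarrow> real) y u i. (1 - u) * x i + u * y i)"
  have "continuous_map (top_of_set {0..1}) (powertop_real UNIV) (g x y)" for x y
    unfolding g_def continuous_map_componentwise by (force intro: continuous_intros)
  moreover have "g x y \<in> {0..1} \<rightarrow> affine_simplex A" "g x y 0 = x" "g x y 1 = y"
    if "x \<in> affine_simplex A" "y \<in> affine_simplex A" for x y
    using that by (auto simp: g_def affine_simplex_def sum.distrib simp flip: sum_distrib_left)
  ultimately show ?thesis
    unfolding path_connectedin_def path_connected_space_def pathin_def
    by (metis continuous_map_in_subtopology euclidean_product_topology top_greatest topspace_euclidean
        topspace_euclidean_subtopology topspace_subtopology_subset)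
qed

lemma standard_simplex_affine: "standard_simplex n = affine_simplex {..n}"
proof -
  have *: "t i \<le> 1" if "\<forall>i. 0 \<le> t i" "\<forall>i. i \<notin> {..n} \<longrightarrow> t i = 0" "sum t {..n} = 1" for t :: "nat \<Rightarrow> real" and i
  proof (cases "i \<le> n")
    case True
    then have "t i \<le> sum t {..n}" using that by (intro member_le_sum) auto
    then show ?thesis using that by simp
  qed (use that in auto)
  have "t \<in> standard_simplex n \<longleftrightarrow> t \<in> affine_simplex {..n}" for t
  proof
    assume "t \<in> standard_simplex n"
    then show "t \<in> affine_simplex {..n}" by (simp add: standard_simplex_def affine_simplex_def)
  next
    assume "t \<in> affine_simplex {..n}"
    then have a: "\<forall>i. 0 \<le> t i" "\<forall>i. i \<notin> {..n} \<longrightarrow> t i = 0" "sum t {..n} = 1"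
      by (simp_all add: affine_simplex_def)
    with *[OF a] show "t \<in> standard_simplex n" by (simp add: standard_simplex_def)
  qed
  then show ?thesis by blast
qed

lemma push_in_affine_simplex:
  assumes "finite A" "t \<in> affine_simplex A"
  shows "push f A t \<in> affine_simplex (f ` A)"
proof -
  have "(\<Sum>w\<in>f ` A. \<Sum>v | v \<in> A \<and> f v = w. t v) = sum t A"
    using sum.image_gen[of A t f] assms(1) by simp
  moreover have "push f A t w = 0" if "w \<notin> f ` A" for w
    unfolding push_def using that by (intro sum.neutral) auto
  ultimately show ?thesis
    using assms by (auto simp: affine_simplex_def push_def intro!: sum_nonneg)
qed

lemma push_superset:
  assumes "finite A" "B \<subseteq> A" "\<And>v. v \<in> A - B \<Longrightarrow> t v = 0"
  shows "push f B t = push f A t"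
proof
  fix w show "push f B t w = push f A t w"
    unfolding push_def using assms by (intro sum.mono_neutral_left) auto
qed

lemma push_inj:
  assumes "inj_on f A" "a \<in> A" shows "push f A t (f a) = t a"
proof -
  have "{v \<in> A. f v = f a} = {a}" using assms by (auto simp: inj_on_def)
  then show ?thesis by (simp add: push_def)
qed

lemma push_corner: "finite A \<Longrightarrow> a \<in> A \<Longrightarrow> push f A (corner a) = corner (f a)"
proof
  fix w assume A: "finite A" "a \<in> A"
  have "push f A (corner a) w = (\<Sum>v\<in>{v \<in> A. f v = w}. if v = a then 1 else 0)"
    by (simp add: push_def corner_def)
  also have "\<dots> = corner (f a) w" using A by (auto simp: corner_def)
  finally show "push f A (corner a) w = corner (f a) w" .
qed

lemma continuous_map_push: "continuous_map (subtopology (powertop_real UNIV) S) (powertop_real UNIV) (push f A)"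
  unfolding continuous_map_componentwise_UNIV push_def
proof
  fix w
  show "continuous_map (subtopology (powertop_real UNIV) S) euclideanreal (\<lambda>t. \<Sum>v | v \<in> A \<and> f v = w. t v)"
  proof (cases "finite {v. v \<in> A \<and> f v = w}")
    case True
    then show ?thesis
      by (intro continuous_map_sum continuous_map_from_subtopology continuous_map_product_coordinates) auto
  qed simp
qed

lemma continuous_map_push_simplex:
  assumes "finite A"
  shows "continuous_map (simplex_space A) (simplex_space (f ` A)) (push f A)"
  using continuous_map_push push_in_affine_simplex[OF assms] by (auto simp: continuous_map_in_subtopology)

definition component_vertices 
  :: "('v, 's) multicomplex \<Rightarrow> ('v, 's) pre_point set \<Rightarrow> 'v set" where
  "component_vertices K x = {v \<in> verts K. path_component_of (realization K) x (vertex_point K v)}"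

lemma component_vertices_eq:
  "path_component_of (realization K) x y \<Longrightarrow> component_vertices K x = component_vertices K y"
  unfolding component_vertices_def using path_component_of_trans path_component_of_sym by metis

context
  fixes K :: "('v, 's) multicomplex" assumes K: "multicomplex K"
begin

lemma simplex_finite: "\<sigma> \<in> simps K A \<Longrightarrow> finite A"
  and simplex_nonempty: "\<sigma> \<in> simps K A \<Longrightarrow> A \<noteq> {}"
  and simplex_verts: "\<sigma> \<in> simps K A \<Longrightarrow> A \<subseteq> verts K"
  and simplex_face: "\<sigma> \<in> simps K A \<Longrightarrow> B \<subseteq> A \<Longrightarrow> B \<noteq> {} \<Longrightarrow> bdry K A B \<sigma> \<in> simps K B"
  and simplex_face_self: "\<sigma> \<in> simps K A \<Longrightarrow> bdry K A A \<sigma> = \<sigma>"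
  and simplex_face_face: "\<sigma> \<in> simps K A \<Longrightarrow> B \<subseteq> A \<Longrightarrow> C \<subseteq> B \<Longrightarrow> C \<noteq> {} \<Longrightarrow>
    bdry K B C (bdry K A B \<sigma>) = bdry K A C \<sigma>"
proof -
  note K' = K[unfolded multicomplex_def]
  show "\<sigma> \<in> simps K A \<Longrightarrow> finite A" "\<sigma> \<in> simps K A \<Longrightarrow> A \<noteq> {}" "\<sigma> \<in> simps K A \<Longrightarrow> A \<subseteq> verts K"
    using conjunct1[OF K'] by blast+
  show "\<sigma> \<in> simps K A \<Longrightarrow> B \<subseteq> A \<Longrightarrow> B \<noteq> {} \<Longrightarrow> bdry K A B \<sigma> \<in> simps K B"
    using conjunct1[OF conjunct2[OF conjunct2[OF K']]] by simp
  show "\<sigma> \<in> simps K A \<Longrightarrow> bdry K A A \<sigma> = \<sigma>"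
    using conjunct1[OF conjunct2[OF conjunct2[OF conjunct2[OF K']]]] by simp
  show "\<sigma> \<in> simps K A \<Longrightarrow> B \<subseteq> A \<Longrightarrow> C \<subseteq> B \<Longrightarrow> C \<noteq> {} \<Longrightarrow> bdry K B C (bdry K A B \<sigma>) = bdry K A C \<sigma>"
    using conjunct2[OF conjunct2[OF conjunct2[OF conjunct2[OF K']]]] by simp
qed

lemma vertex_simplex: "v \<in> verts K \<Longrightarrow> simps K {v} = {the_elem (simps K {v})}"
proof -
  assume "v \<in> verts K"
  with conjunct1[OF conjunct2[OF K[unfolded multicomplex_def]]] have "is_singleton (simps K {v})" by blast
  then show ?thesis by (simp only: is_singleton_the_elem)
qed

lemma glue_class_face:
  assumes \<sigma>: "\<sigma> \<in> simps K A" and B: "B \<subseteq> A" "B \<noteq> {}" and t: "t \<in> affine_simplex B"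
  shows "glue_class K ((A, \<sigma>), t) = glue_class K ((B, bdry K A B \<sigma>), t)"
proof -
  have fin: "finite A" "finite B" using simplex_finite[OF \<sigma>] B finite_subset by auto
  have "bdry K B {v. t v \<noteq> 0} (bdry K A B \<sigma>) = bdry K A {v. t v \<noteq> 0} \<sigma>"
    using affine_simplex_support[OF fin(2) t] by (intro simplex_face_face \<sigma> B)
  moreover have "t \<in> affine_simplex A" using affine_simplex_mono[OF fin(1) B(1)] t by blast
  ultimately show ?thesis
    by (simp add: glue_class_eq[OF K \<sigma>] glue_class_eq[OF K simplex_face[OF \<sigma> B] t])
qed

lemma glue_class_inj:
  assumes "\<sigma> \<in> simps K A" "t \<in> affine_simplex A" "\<tau> \<in> simps K B" "u \<in> affine_simplex B"
    and "glue_class K ((A, \<sigma>), t) = glue_class K ((B, \<tau>), u)"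
  shows "t = u" "bdry K A {v. t v \<noteq> 0} \<sigma> = bdry K B {v. t v \<noteq> 0} \<tau>"
proof -
  have "((A, \<sigma>), t) \<in> glue_class K ((B, \<tau>), u)"
    unfolding assms(5)[symmetric] by (simp add: glue_class_def)
  then show "t = u" "bdry K A {v. t v \<noteq> 0} \<sigma> = bdry K B {v. t v \<noteq> 0} \<tau>"
    unfolding glue_class_eq[OF K assms(3,4)] by auto
qed

text \<open>
  At the barycentre, which lies on no proper face, distinct simplices with the same vertices
  have distinct points.
\<close>

lemma simplex_determined:
  assumes "\<sigma> \<in> simps K A" "\<tau> \<in> simps K A"
    and "\<And>t. t \<in> affine_simplex A \<Longrightarrow> glue_class K ((A, \<sigma>), t) = glue_class K ((A, \<tau>), t)"
  shows "\<sigma> = \<tau>"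
proof -
  have A: "finite A" "A \<noteq> {}" using simplex_finite simplex_nonempty assms(1) by auto
  define t where "t = (\<lambda>v. if v \<in> A then 1 / real (card A) else 0)"
  have t: "t \<in> affine_simplex A" using A by (auto simp: t_def affine_simplex_def)
  have s: "{v. t v \<noteq> 0} = A" using A by (auto simp: t_def)
  show ?thesis
    using glue_class_inj(2)[OF assms(1) t assms(2) t assms(3)[OF t]] simplex_face_self assms(1,2)
    unfolding s by simp
qed

lemma topspace_realization:
  "topspace (realization K) = {glue_class K ((A, \<sigma>), t) | A \<sigma> t. \<sigma> \<in> simps K A \<and> t \<in> affine_simplex A}"
  unfolding realization_def topspace_quotient_topology simplex_sum_def
  by (fastforce simp: image_iff)

lemma continuous_map_cell:
  assumes "\<sigma> \<in> simps K A"
  shows "continuous_map (simplex_space A) (realization K) (\<lambda>t. glue_class K ((A, \<sigma>), t))"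
proof -
  let ?X = "\<lambda>(A, \<sigma>). simplex_space A"
  have "continuous_map (?X (A, \<sigma>)) (simplex_sum K) (\<lambda>t. ((A, \<sigma>), t))"
    unfolding simplex_sum_def by (rule continuous_map_component_injection) (use assms in simp)
  moreover have "continuous_map (simplex_sum K) (realization K) (glue_class K)"
    unfolding realization_def by (rule quotient_imp_continuous_map[OF quotient_map_quotient_topology])
  ultimately show ?thesis using continuous_map_compose by (fastforce simp: o_def)
qed

lemma continuous_map_from_realization:
  assumes "\<And>A \<sigma>. \<sigma> \<in> simps K A \<Longrightarrow> continuous_map (simplex_space A) Y (\<lambda>t. f (glue_class K ((A, \<sigma>), t)))"
  shows "continuous_map (realization K) Y f"
proof -
  have "continuous_map (simplex_sum K) Y (f \<circ> glue_class K)"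
    unfolding continuous_map_def
  proof (intro conjI allI impI)
    show "f \<circ> glue_class K \<in> topspace (simplex_sum K) \<rightarrow> topspace Y"
      using assms unfolding simplex_sum_def continuous_map_def by (fastforce simp: Pi_iff)
    fix U assume U: "openin Y U"
    have "openin (simplex_space A) {t. ((A, \<sigma>), t) \<in> {x \<in> topspace (simplex_sum K). (f \<circ> glue_class K) x \<in> U}}"
      if "\<sigma> \<in> simps K A" for A \<sigma>
    proof -
      have "{t. ((A, \<sigma>), t) \<in> {x \<in> topspace (simplex_sum K). (f \<circ> glue_class K) x \<in> U}}
          = {t \<in> topspace (simplex_space A). f (glue_class K ((A, \<sigma>), t)) \<in> U}"
        using that by (auto simp: simplex_sum_def)
      then show ?thesis using openin_continuous_map_preimage[OF assms[OF that] U] by simp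
    qed
    moreover have "{x \<in> topspace (simplex_sum K). (f \<circ> glue_class K) x \<in> U}
        \<subseteq> Sigma (Sigma UNIV (simps K)) (topspace \<circ> (\<lambda>(A, \<sigma>). simplex_space A))"
      by (auto simp: simplex_sum_def)
    ultimately show "openin (simplex_sum K) {x \<in> topspace (simplex_sum K). (f \<circ> glue_class K) x \<in> U}"
      by (subst simplex_sum_def) (auto simp: openin_sum_topology)
  qed
  then show ?thesis
    unfolding realization_def by (rule continuous_compose_quotient_map[OF quotient_map_quotient_topology])
qed

lemma vertex_point_eq:
  assumes "\<sigma> \<in> simps K A" "a \<in> A"
  shows "vertex_point K a = glue_class K ((A, \<sigma>), corner a)"
proof -
  have "bdry K A {a} \<sigma> \<in> simps K {a}" using simplex_face[OF assms(1)] assms(2) by simp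
  moreover have "a \<in> verts K" using simplex_verts[OF assms(1)] assms(2) by blast
  ultimately have "bdry K A {a} \<sigma> = the_elem (simps K {a})" using vertex_simplex by blast
  then show ?thesis
    using glue_class_face[OF assms(1), of "{a}" "corner a"] assms(2)
    by (simp add: vertex_point_def corner_def affine_simplex_singleton)
qed

lemma path_component_cell:
  assumes "\<sigma> \<in> simps K A" "t \<in> affine_simplex A" "u \<in> affine_simplex A"
  shows "path_component_of (realization K) (glue_class K ((A, \<sigma>), t)) (glue_class K ((A, \<sigma>), u))"
proof -
  have "path_connectedin (simplex_space A) (affine_simplex A)"
    using path_connectedin_affine_simplex by (simp add: path_connectedin_subtopology)
  from path_connectedin_continuous_map_image[OF continuous_map_cell[OF assms(1)] this] show ?thesis
    unfolding path_component_of using assms(2,3) by blast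
qed

text \<open>
  Cells are path connected, so the preimage of a path component in a cell is either everything or empty.
\<close>

lemma openin_path_component:
  "openin (realization K) (path_component_of_set (realization K) x)"
proof -
  let ?P = "path_component_of_set (realization K) x"
  have "openin (simplex_sum K) {y \<in> topspace (simplex_sum K). glue_class K y \<in> ?P}"
  proof (subst simplex_sum_def, unfold openin_sum_topology, intro conjI ballI)
    fix i assume "i \<in> Sigma UNIV (simps K)"
    then obtain A \<sigma> where i: "i = (A, \<sigma>)" "\<sigma> \<in> simps K A" by blast
    let ?S = "{t \<in> affine_simplex A. glue_class K ((A, \<sigma>), t) \<in> ?P}"
    have "?S = {} \<or> ?S = affine_simplex A"
    proof (cases "?S = {}")
      case False
      then obtain t where t: "t \<in> affine_simplex A" "glue_class K ((A, \<sigma>), t) \<in> ?P" by blast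
      have "glue_class K ((A, \<sigma>), u) \<in> ?P" if "u \<in> affine_simplex A" for u
        using path_component_cell[OF i(2) t(1) that] t(2) path_component_of_trans by fastforce
      then show ?thesis by blast
    qed simp
    then have "openin (simplex_space A) ?S"
      using openin_topspace[of "simplex_space A"] openin_empty[of "simplex_space A"]
      unfolding topspace_simplex_space by presburger
    moreover have "{t. (i, t) \<in> {y \<in> topspace (simplex_sum K). glue_class K y \<in> ?P}} = ?S"
      using i by (auto simp: simplex_sum_def)
    ultimately show "openin (case i of (A, \<sigma>) \<Rightarrow> simplex_space A)
        {t. (i, t) \<in> {y \<in> topspace (simplex_sum K). glue_class K y \<in> ?P}}"
      using i by simp
  qed (auto simp: simplex_sum_def)
  moreover have "?P \<subseteq> topspace (realization K)" by (auto dest: path_component_in_topspace)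
  then have "?P \<subseteq> glue_class K ` topspace (simplex_sum K)"
    unfolding realization_def topspace_quotient_topology .
  ultimately show ?thesis unfolding realization_def openin_quotient_topology by simp
qed

text \<open>
  Largeness speaks of connected components, whereas straightening moves vertices along paths. Path
  components are open, hence also closed.
\<close>

lemma connected_component_imp_path_component:
  assumes "connected_component_of (realization K) x y"
  shows "path_component_of (realization K) x y"
proof -
  let ?X = "realization K"
  let ?P = "path_component_of_set ?X x"
  have x: "x \<in> topspace ?X" using assms connected_component_in_topspace by fastforce
  have eq: "topspace ?X - ?P = (\<Union>z\<in>topspace ?X - ?P. path_component_of_set ?X z)"
  proof (intro equalityI subsetI)
    fix z assume "z \<in> topspace ?X - ?P"
    then show "z \<in> (\<Union>z\<in>topspace ?X - ?P. path_component_of_set ?X z)"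
      by (auto simp: path_component_of_refl intro!: bexI[of _ z])
  next
    fix z assume "z \<in> (\<Union>z\<in>topspace ?X - ?P. path_component_of_set ?X z)"
    then obtain w where w: "w \<in> topspace ?X" "\<not> path_component_of ?X x w" "path_component_of ?X w z" by auto
    then show "z \<in> topspace ?X - ?P"
      using path_component_in_topspace path_component_of_trans path_component_of_sym by (metis DiffI mem_Collect_eq)
  qed
  have "openin ?X (\<Union>z\<in>topspace ?X - ?P. path_component_of_set ?X z)"
    by (intro openin_Union) (use openin_path_component in blast)
  from iffD2[OF arg_cong[where f="openin ?X", OF eq] this] have "openin ?X (topspace ?X - ?P)" .
  moreover have "?P \<subseteq> topspace ?X" using path_component_in_topspace by fastforce
  ultimately have "closedin ?X ?P" by (simp add: closedin_def)
  moreover obtain T where T: "connectedin ?X T" "x \<in> T" "y \<in> T"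
    using assms by (auto simp: connected_component_of_def)
  ultimately have "T \<subseteq> ?P \<or> disjnt T ?P"
    using connectedin_clopen_cases openin_path_component by blast
  moreover have "x \<in> ?P" using x by (simp add: path_component_of_refl)
  ultimately show ?thesis using T by (auto simp: disjnt_def)
qed

lemma infinite_component_vertices:
  assumes "large_multicomplex K" "x \<in> topspace (realization K)"
  shows "infinite (component_vertices K x)"
proof -
  have "infinite {v \<in> verts K. vertex_point K v \<in> connected_component_of_set (realization K) x}"
    using assms by (simp add: large_multicomplex_def connected_components_of_def)
  moreover have "{v \<in> verts K. vertex_point K v \<in> connected_component_of_set (realization K) x} \<subseteq> component_vertices K x"
    using connected_component_imp_path_component by (auto simp: component_vertices_def)
  ultimately show ?thesis using finite_subset by blast
qed

end

text \<open>
  Every representative of a point restricts to the same simplex on the support of the barycentric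
  coordinates, and simplicial maps commute with this restriction.
\<close>

lemma realization_map_glue_class:
  assumes K: "multicomplex K" and L: "multicomplex L" and f: "simplicial_map K L f F"
    and \<sigma>: "\<sigma> \<in> simps K A" and t: "t \<in> affine_simplex A"
  shows "realization_map L f F (glue_class K ((A, \<sigma>), t)) = glue_class L ((f ` A, F A \<sigma>), push f A t)"
proof -
  define S where "S = {v. t v \<noteq> 0}"
  have F: "F B \<tau> \<in> simps L (f ` B)" if "\<tau> \<in> simps K B" for B \<tau>
    using f that by (simp add: simplicial_map_def)
  have Fb: "F C (bdry K B C \<tau>) = bdry L (f ` B) (f ` C) (F B \<tau>)" if "\<tau> \<in> simps K B" "C \<subseteq> B" "C \<noteq> {}" for B C \<tau>
    using f that by (simp add: simplicial_map_def)
  have supp: "glue_class L ((f ` B, F B \<tau>), push f B t) = glue_class L ((f ` S, F S (bdry K B S \<tau>)), push f S t)"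
    if \<tau>: "\<tau> \<in> simps K B" and tB: "t \<in> affine_simplex B" for B \<tau>
  proof -
    have fin: "finite B" using simplex_finite[OF K \<tau>] .
    note s = affine_simplex_support[OF fin tB, folded S_def]
    have finS: "finite S" using s(1) fin finite_subset by blast
    have p: "push f S t = push f B t" by (rule push_superset[OF fin s(1)]) (simp add: S_def)
    have "push f S t \<in> affine_simplex (f ` S)"
      using finS s by (intro push_in_affine_simplex) auto
    then show ?thesis
      using glue_class_face[OF L F[OF \<tau>], of "f ` S" "push f S t"] s(1,2) p Fb[OF \<tau> s(1,2)] by auto
  qed
  have "realization_map L f F (glue_class K ((A, \<sigma>), t))
      = (\<Union>x\<in>glue_class K ((A, \<sigma>), t). glue_class L ((f ` S, F S (bdry K A S \<sigma>)), push f S t))"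
    unfolding realization_map_def
  proof (rule SUP_cong[OF refl], goal_cases)
    case (1 x)
    then obtain B \<tau> where x: "x = ((B, \<tau>), t)" "\<tau> \<in> simps K B" "t \<in> affine_simplex B" "bdry K B S \<tau> = bdry K A S \<sigma>"
      unfolding glue_class_eq[OF K \<sigma> t] S_def by blast
    then show ?case
      using supp[OF x(2,3)] by (simp add: push_def[abs_def])
  qed
  also have "\<dots> = glue_class L ((f ` S, F S (bdry K A S \<sigma>)), push f S t)"
    by (rule SUP_eq_const) (auto simp: glue_class_def)
  finally show ?thesis using supp[OF \<sigma> t] by simp
qed

section \<open>Extending homotopies over a simplex\<close>

abbreviation cylinder :: "'v set \<Rightarrow> (('v \<Rightarrow> real) \<times> real) topology" where
  "cylinder A \<equiv> prod_topology (simplex_space A) (top_of_set {0..1})"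

lemma continuous_map_cylinder_coordinate:
  "continuous_map (cylinder A) euclideanreal (\<lambda>x. fst x v)"
  "continuous_map (cylinder A) euclideanreal snd"
proof -
  have "continuous_map (simplex_space A) euclideanreal (\<lambda>t. t v)"
    by (intro continuous_map_from_subtopology continuous_map_product_coordinates) simp
  from continuous_map_compose[OF continuous_map_fst this]
  show "continuous_map (cylinder A) euclideanreal (\<lambda>x. fst x v)" by (simp add: o_def)
  show "continuous_map (cylinder A) euclideanreal snd"
    using continuous_map_snd[of "simplex_space A" "top_of_set {0..1::real}"] by (simp add: continuous_map_in_subtopology)
qed

text \<open>
  The prescribed values on the bottom and on the walls of the cylinder extend along the retraction that
  projects radially from the point at height \<open>2\<close> above the barycentre. A single function \<open>g\<close> carries the values on
  all walls, so that they agree on intersections.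
\<close>

lemma simplex_homotopy_extension:
  fixes A :: "'v set" and s :: "('v \<Rightarrow> real) \<Rightarrow> 'y"
  assumes A: "finite A" "A \<noteq> {}"
    and s: "continuous_map (simplex_space A) Y s"
    and g: "\<And>a. a \<in> A \<Longrightarrow> continuous_map (cylinder (A - {a})) Y g"
    and gs: "\<And>a t. a \<in> A \<Longrightarrow> t \<in> affine_simplex (A - {a}) \<Longrightarrow> g (t, 0) = s t"
  shows "\<exists>E. continuous_map (cylinder A) Y E \<and> (\<forall>t\<in>affine_simplex A. E (t, 0) = s t) \<and>
    (\<forall>a\<in>A. \<forall>t\<in>affine_simplex (A - {a}). \<forall>u\<in>{0..1}. E (t, u) = g (t, u))"
proof -
  define m where "m = real (card A)"
  have m: "m > 0" using A by (simp add: m_def card_gt_0_iff)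
  \<comment> \<open>\<open>r a\<close> is the projection to the wall over the face opposite to \<open>a\<close>, \<open>q\<close> the projection to the bottom\<close>
  define r where "r a = (\<lambda>(t, u :: real). (\<lambda>v. if v \<in> A then (t v - t a) / (1 - m * t a) else 0 :: real,
      2 - (2 - u) / (1 - m * t a)))" for a
  define q where "q = (\<lambda>(t, u :: real). \<lambda>v. if v \<in> A then (2 * t v - u / m) / (2 - u) else 0 :: real)"
  \<comment> \<open>the points whose ray hits the bottom, and for every \<open>a\<close> those whose ray hits the wall opposite to \<open>a\<close>, where \<open>t a\<close> is the least coordinate\<close>
  define D where "D = (\<lambda>c. case c of None \<Rightarrow> {x \<in> topspace (cylinder A). \<forall>a\<in>A. snd x \<le> 2 * m * fst x a}
      | Some a \<Rightarrow> {x \<in> topspace (cylinder A). (\<forall>b\<in>A. fst x a \<le> fst x b) \<and> 2 * m * fst x a \<le> snd x})"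
  define f where "f = (\<lambda>c. case c of None \<Rightarrow> s \<circ> q | Some a \<Rightarrow> g \<circ> r a)"
  note coord = continuous_map_cylinder_coordinate[of A]
  have sum_A: "sum t A = 1" if "t \<in> affine_simplex A" for t
    using that by (simp add: affine_simplex_def)
  have q_in: "q x \<in> affine_simplex A" if "x \<in> D None" for x
  proof -
    obtain t u where x: "x = (t, u)" by (cases x)
    have t: "t \<in> affine_simplex A" and u: "u \<le> 1" and *: "\<And>a. a \<in> A \<Longrightarrow> u \<le> 2 * m * t a"
      using that by (auto simp: D_def x)
    have "(\<Sum>v\<in>A. (2 * t v - u / m) / (2 - u)) = (\<Sum>v\<in>A. 2 * t v - u / m) / (2 - u)"
      by (simp add: sum_divide_distrib)
    also have "(\<Sum>v\<in>A. 2 * t v - u / m) = 2 - u"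
      using m by (simp add: sum_subtractf sum_A[OF t] m_def flip: sum_distrib_left)
    finally have "(\<Sum>v\<in>A. (2 * t v - u / m) / (2 - u)) = 1" using u by simp
    moreover have "0 \<le> (2 * t v - u / m) / (2 - u)" if "v \<in> A" for v
      using *[OF that] u m by (intro divide_nonneg_nonneg) (simp_all add: field_simps)
    ultimately show ?thesis unfolding q_def x affine_simplex_def by simp
  qed
  have r_in: "fst (r a x) \<in> affine_simplex (A - {a})" "snd (r a x) \<in> {0..1}" "1 - m * fst x a > 0"
    if a: "a \<in> A" and xD: "x \<in> D (Some a)" for a x
  proof -
    obtain t u where x: "x = (t, u)" by (cases x)
    have t: "t \<in> affine_simplex A" and u: "u \<le> 1" and *: "\<And>b. b \<in> A \<Longrightarrow> t a \<le> t b" "2 * m * t a \<le> u"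
      using xD by (auto simp: D_def x)
    have d: "1 - m * t a > 0" using *(2) u by linarith
    then show "1 - m * fst x a > 0" by (simp add: x)
    have ta: "0 \<le> m * t a" using t m by (simp add: affine_simplex_def)
    have "(\<Sum>v\<in>A - {a}. (t v - t a) / (1 - m * t a)) = (\<Sum>v\<in>A. (t v - t a) / (1 - m * t a))"
      using A a by (intro sum.mono_neutral_left) auto
    also have "\<dots> = (\<Sum>v\<in>A. t v - t a) / (1 - m * t a)" by (simp add: sum_divide_distrib)
    also have "(\<Sum>v\<in>A. t v - t a) = 1 - m * t a" by (simp add: sum_subtractf sum_A[OF t] m_def)
    finally have "(\<Sum>v\<in>A - {a}. (t v - t a) / (1 - m * t a)) = 1" using d by simp
    moreover have "0 \<le> (t v - t a) / (1 - m * t a)" if "v \<in> A" for v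
      using *(1)[OF that] d by simp
    ultimately show "fst (r a x) \<in> affine_simplex (A - {a})" unfolding r_def x affine_simplex_def by auto
    show "snd (r a x) \<in> {0..1}"
      using d *(2) u ta by (simp add: r_def x field_simps)
  qed
  have "\<exists>E. continuous_map (cylinder A) Y E \<and> (\<forall>x c. c \<in> insert None (Some ` A) \<longrightarrow> x \<in> topspace (cylinder A) \<inter> D c \<longrightarrow> E x = f c x)"
  proof (rule pasting_lemma_exists_closed[of "insert None (Some ` A)" "cylinder A" D Y f])
    show "finite (insert None (Some ` A))" using A by simp
    show "topspace (cylinder A) \<subseteq> \<Union> (D ` insert None (Some ` A))"
    proof
      fix x assume x: "x \<in> topspace (cylinder A)"
      define a where "a = arg_min_on (fst x) A"
      have a: "a \<in> A" "\<And>b. b \<in> A \<Longrightarrow> fst x a \<le> fst x b"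
        unfolding a_def using arg_min_if_finite(1)[OF A] arg_min_least[OF A] by auto
      show "x \<in> \<Union> (D ` insert None (Some ` A))"
      proof (cases "2 * m * fst x a \<le> snd x")
        case True
        then have "x \<in> D (Some a)" using x a by (simp add: D_def)
        then show ?thesis using a by blast
      next
        case False
        have "2 * m * fst x a \<le> 2 * m * fst x b" if "b \<in> A" for b using a(2)[OF that] m by simp
        then have "x \<in> D None" using x False by (fastforce simp: D_def)
        then show ?thesis by blast
      qed
    qed
    fix c assume c: "c \<in> insert None (Some ` A)"
    have le: "closedin (cylinder A) {x \<in> topspace (cylinder A). p x \<le> p' x}"
      if "continuous_map (cylinder A) euclideanreal p" "continuous_map (cylinder A) euclideanreal p'" for p p'
    proof -
      have "continuous_map (cylinder A) euclideanreal (\<lambda>x. p' x - p x)"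
        using that by (intro continuous_intros)
      from closedin_continuous_map_preimage[OF this, of "{0..}"] show ?thesis by simp
    qed
    show "closedin (cylinder A) (D c)"
    proof (cases c)
      case None
      have "D None = (\<Inter>a\<in>A. {x \<in> topspace (cylinder A). snd x \<le> 2 * m * fst x a})"
        using A by (auto simp: D_def)
      moreover have "closedin (cylinder A) \<dots>"
        using A by (intro closedin_INT le continuous_intros coord) auto
      ultimately show ?thesis using None by simp
    next
      case (Some a)
      have "D (Some a) = (\<Inter>b\<in>A. {x \<in> topspace (cylinder A). fst x a \<le> fst x b}) \<inter>
          {x \<in> topspace (cylinder A). 2 * m * fst x a \<le> snd x}"
        using A by (auto simp: D_def)
      moreover have "closedin (cylinder A) \<dots>"
        using A by (intro closedin_Int closedin_INT le continuous_intros coord) auto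
      ultimately show ?thesis using Some by simp
    qed
    note coord' = continuous_map_from_subtopology[OF coord(1)] continuous_map_from_subtopology[OF coord(2)]
    show "continuous_map (subtopology (cylinder A) (D c)) Y (f c)"
    proof (cases c)
      case None
      have "continuous_map (subtopology (cylinder A) (D None)) euclideanreal (\<lambda>x. q x v)" for v
      proof (cases "v \<in> A")
        case True
        have "continuous_map (subtopology (cylinder A) (D None)) euclideanreal (\<lambda>x. (2 * fst x v - snd x / m) / (2 - snd x))"
          using m by (intro continuous_intros coord') auto
        then show ?thesis using True by (simp add: q_def case_prod_unfold)
      qed (simp add: q_def case_prod_unfold)
      then have "continuous_map (subtopology (cylinder A) (D None)) (simplex_space A) q"
        using q_in by (auto simp: continuous_map_in_subtopology continuous_map_componentwise_UNIV)
      then show ?thesis using None s by (simp add: f_def continuous_map_compose)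
    next
      case (Some a)
      then have a: "a \<in> A" using c by auto
      have nz: "1 - m * fst x a \<noteq> 0" if "x \<in> topspace (subtopology (cylinder A) (D (Some a)))" for x
        using r_in(3)[OF a, of x] that by auto
      have "continuous_map (subtopology (cylinder A) (D (Some a))) euclideanreal (\<lambda>x. fst (r a x) v)" for v
      proof (cases "v \<in> A")
        case True
        have "continuous_map (subtopology (cylinder A) (D (Some a))) euclideanreal (\<lambda>x. (fst x v - fst x a) / (1 - m * fst x a))"
          using nz by (intro continuous_intros coord') auto
        then show ?thesis using True by (simp add: r_def case_prod_unfold)
      qed (simp add: r_def case_prod_unfold)
      moreover have "continuous_map (subtopology (cylinder A) (D (Some a))) euclideanreal (\<lambda>x. 2 - (2 - snd x) / (1 - m * fst x a))"
        using nz by (intro continuous_intros coord') auto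
      then have "continuous_map (subtopology (cylinder A) (D (Some a))) euclideanreal (snd \<circ> r a)"
        by (simp add: r_def case_prod_unfold o_def)
      ultimately have "continuous_map (subtopology (cylinder A) (D (Some a))) (cylinder (A - {a})) (r a)"
        using r_in(1,2)[OF a] unfolding continuous_map_pairwise
        by (auto simp: continuous_map_in_subtopology continuous_map_componentwise_UNIV)
      then show ?thesis using Some g[OF a] by (simp add: f_def continuous_map_compose)
    qed
    have mixed: "f None x = f (Some a) x" if a: "a \<in> A" and x1: "x \<in> D None" and x2: "x \<in> D (Some a)" for a x
    proof -
      obtain t u where x: "x = (t, u)" by (cases x)
      have e: "2 * m * t a = u" and u: "u \<le> 1" using x1 x2 a by (fastforce simp: D_def x)+
      then have d: "1 - m * t a = (2 - u) / 2" "u / m = 2 * t a" using m by (simp_all add: field_simps)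
      have "q x = fst (r a x)"
        unfolding q_def r_def x using u by (auto simp: d field_simps)
      moreover have "2 - u = 2 * (1 - m * t a)" "1 - m * t a \<noteq> 0" using u d(1) by simp_all
      then have "(2 - u) / (1 - m * t a) = 2" by (metis nonzero_mult_div_cancel_right)
      then have "snd (r a x) = 0" by (simp add: r_def x)
      ultimately show ?thesis
        using gs[OF a r_in(1)[OF a x2]] by (simp add: f_def) (metis prod.collapse)
    qed
    fix d x assume d: "d \<in> insert None (Some ` A)" and x: "x \<in> topspace (cylinder A) \<inter> D c \<inter> D d"
    consider "c = d" | a where "c = None" "d = Some a" "a \<in> A" | a where "d = None" "c = Some a" "a \<in> A"
      | a b where "c = Some a" "d = Some b" "a \<in> A" "b \<in> A" using c d by blast
    then show "f c x = f d x"
    proof cases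
      case 4
      then have "fst x a = fst x b" using x by (force simp: D_def intro: antisym)
      then have "r a x = r b x" by (simp only: r_def case_prod_unfold)
      then show ?thesis using 4 by (simp add: f_def)
    qed (use x mixed in auto)
  qed blast
  then obtain E where E: "continuous_map (cylinder A) Y E"
    "\<And>x c. c \<in> insert None (Some ` A) \<Longrightarrow> x \<in> topspace (cylinder A) \<inter> D c \<Longrightarrow> E x = f c x" by blast
  show ?thesis
  proof (intro exI conjI ballI)
    show "continuous_map (cylinder A) Y E" by (rule E)
    fix t assume t: "t \<in> affine_simplex A"
    have x: "(t, 0) \<in> topspace (cylinder A) \<inter> D None"
      using t m by (auto simp: D_def affine_simplex_def)
    have "q (t, 0) = t" using t by (auto simp: q_def affine_simplex_def)
    then show "E (t, 0) = s t" using E(2)[OF _ x] by (simp add: f_def)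
  next
    fix a t u assume a: "a \<in> A" and t: "t \<in> affine_simplex (A - {a})" and u: "u \<in> {0..1 :: real}"
    have tA: "t \<in> affine_simplex A" using affine_simplex_mono[of A "A - {a}"] A t by auto
    have ta: "t a = 0" using t by (simp add: affine_simplex_def)
    have x: "(t, u) \<in> topspace (cylinder A) \<inter> D (Some a)"
      using tA u ta by (auto simp: D_def affine_simplex_def)
    have "r a (t, u) = (t, u)" using tA by (auto simp: r_def ta affine_simplex_def)
    then show "E (t, u) = g (t, u)" using E(2)[OF _ x] a by (simp add: f_def)
  qed
qed

section \<open>Filling a simplex with prescribed faces\<close>

text \<open>
  All representatives of a point have the same barycentric coordinates, so any of them may be chosen.
\<close>

definition coordinates :: "('v, 's) pre_point set \<Rightarrow> 'v \<Rightarrow> real" where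
  "coordinates p = snd (SOME x. x \<in> p)"

lemma coordinates_glue_class:
  assumes "multicomplex K" "\<sigma> \<in> simps K A" "t \<in> affine_simplex A"
  shows "coordinates (glue_class K ((A, \<sigma>), t)) = t"
proof -
  have "((A, \<sigma>), t) \<in> glue_class K ((A, \<sigma>), t)" by (simp add: glue_class_def)
  then have "(SOME x. x \<in> glue_class K ((A, \<sigma>), t)) \<in> glue_class K ((A, \<sigma>), t)" by (rule someI)
  then show ?thesis unfolding coordinates_def glue_class_eq[OF assms] by auto
qed

lemma push_push_inverse:
  assumes A: "finite A" "t \<in> affine_simplex A" and \<beta>: "bij_betw \<beta> I A" and I: "finite I"
    and f: "\<And>i. i \<in> I \<Longrightarrow> f i = \<beta> i"
  shows "push f I (push (the_inv_into I \<beta>) A t) = t"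
proof
  fix w
  let ?\<gamma> = "the_inv_into I \<beta>"
  have \<gamma>: "bij_betw ?\<gamma> A I" using \<beta> by (rule bij_betw_the_inv_into)
  have fI: "f ` I = A" "inj_on f I" using \<beta> f by (auto simp: bij_betw_def inj_on_def)
  show "push f I (push ?\<gamma> A t) w = t w"
  proof (cases "w \<in> A")
    case True
    have "?\<gamma> w \<in> I" "f (?\<gamma> w) = w"
      using True \<beta> \<gamma> f by (auto simp: bij_betw_def the_inv_into_f_f)
    then show ?thesis
      using push_inj[OF fI(2), of "?\<gamma> w"] push_inj[of ?\<gamma> A w t] \<gamma> True by (simp add: bij_betw_def)
  next
    case False
    have "push ?\<gamma> A t \<in> affine_simplex I"
      using push_in_affine_simplex[OF A] \<gamma> by (metis bij_betw_def)
    from push_in_affine_simplex[OF I this, of f] have "push f I (push ?\<gamma> A t) \<in> affine_simplex A" by (simp add: fI)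
    then show ?thesis using False A by (simp add: affine_simplex_def)
  qed
qed

lemma simps_simplex_mc: "simps (simplex_mc n) B = (if B \<noteq> {} \<and> B \<subseteq> {..n} then UNIV else {})"
  and bdry_simplex_mc: "bdry (simplex_mc n) B C x = x"
  and verts_simplex_mc: "verts (simplex_mc n) = {..n}"
  and simps_simplex_boundary_mc: "simps (simplex_boundary_mc n) B = (if B \<noteq> {} \<and> B \<subset> {..n} then UNIV else {})"
  and bdry_simplex_boundary_mc: "bdry (simplex_boundary_mc n) B C x = x"
  and verts_simplex_boundary_mc: "n \<ge> 1 \<Longrightarrow> verts (simplex_boundary_mc n) = {..n}"
  by (simp_all add: simplex_mc_def simplex_boundary_mc_def)

lemma push_id:
  assumes "t \<in> affine_simplex B" shows "push id B t = t"
proof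
  fix v
  have "{w. w \<in> B \<and> w = v} = (if v \<in> B then {v} else {})" by auto
  then show "push id B t v = t v" using assms by (simp add: push_def affine_simplex_def)
qed

lemma boundary_inclusion_glue_class:
  assumes "B \<noteq> {}" "B \<subset> {..n}" "t \<in> affine_simplex B"
  shows "boundary_inclusion n (glue_class (simplex_boundary_mc n) ((B, ()), t)) = glue_class (simplex_mc n) ((B, ()), t)"
proof -
  have "simplicial_map (simplex_boundary_mc n) (simplex_mc n) id (\<lambda>A. id)"
    by (auto simp: simplicial_map_def simplex_mc_def simplex_boundary_mc_def split: if_splits)
  from realization_map_glue_class[OF multicomplex_simplex_boundary_mc multicomplex_simplex_mc this, of "()" B t]
  show ?thesis using assms by (simp add: simps_simplex_boundary_mc push_id)
qed

lemma continuous_map_simplex_inclusion: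
  assumes "finite A" "B \<subseteq> A"
  shows "continuous_map (simplex_space B) (simplex_space A) id"
  using affine_simplex_mono[OF assms] by (auto simp: continuous_map_in_subtopology intro: continuous_map_from_subtopology)

text \<open>
  Completeness, transported from the standard simplex to the simplex with vertex set \<open>A\<close> by an enumeration
  \<open>\<beta>\<close> of \<open>A\<close>. The embedding provided by completeness agrees with \<open>\<beta>\<close> on vertices because they lie on the boundary,
  where the homotopy is fixed.
\<close>

lemma complete_filling:
  fixes K :: "('v, 's) multicomplex"
  assumes K: "multicomplex K" and complete: "complete_multicomplex K"
    and A: "finite A" "card A \<ge> 2"
    and f: "continuous_map (simplex_space A) (realization K) f"
    and \<tau>: "\<And>B. B \<subset> A \<Longrightarrow> B \<noteq> {} \<Longrightarrow> \<tau> B \<in> simps K B"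
    and f\<tau>: "\<And>B t. B \<subset> A \<Longrightarrow> B \<noteq> {} \<Longrightarrow> t \<in> affine_simplex B \<Longrightarrow> f t = glue_class K ((B, \<tau> B), t)"
  shows "\<exists>\<sigma>\<in>simps K A. \<exists>k. continuous_map (cylinder A) (realization K) k \<and>
    (\<forall>t\<in>affine_simplex A. k (t, 0) = f t \<and> k (t, 1) = glue_class K ((A, \<sigma>), t)) \<and>
    (\<forall>B t u. B \<subset> A \<longrightarrow> B \<noteq> {} \<longrightarrow> t \<in> affine_simplex B \<longrightarrow> u \<in> {0..1} \<longrightarrow> k (t, u) = f t)"
proof -
  define n where "n = card A - 1"
  have n: "n \<ge> 1" "{0..<card A} = {..n}" using A by (auto simp: n_def)
  obtain \<beta> where \<beta>: "bij_betw \<beta> {..n} A" using ex_bij_betw_nat_finite[OF A(1)] n by auto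
  define \<gamma> where "\<gamma> = the_inv_into {..n} \<beta>"
  have \<gamma>: "bij_betw \<gamma> A {..n}" unfolding \<gamma>_def using \<beta> by (rule bij_betw_the_inv_into)
  have \<beta>A: "\<beta> ` {..n} = A" and \<beta>i: "inj_on \<beta> {..n}" and \<gamma>A: "\<gamma> ` A = {..n}" and \<gamma>i: "inj_on \<gamma> A"
    using \<beta> \<gamma> by (auto simp: bij_betw_def)
  have \<beta>ss: "\<beta> ` B \<subset> A" if "B \<subset> {..n}" for B
    using that \<beta>A \<beta>i by (metis image_strict_mono)
  have \<gamma>ss: "\<gamma> ` B \<subset> {..n}" if "B \<subset> A" for B
    using that \<gamma>A \<gamma>i by (metis image_strict_mono)
  let ?\<Delta> = "simplex_mc n" and ?bd = "simplex_boundary_mc n"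
  note mc\<Delta> = multicomplex_simplex_mc[of n] and mcbd = multicomplex_simplex_boundary_mc[of n]
  define F where "F = (\<lambda>p :: (nat, unit) pre_point set. f (push \<beta> {..n} (coordinates p)))"
  have F: "F (glue_class ?\<Delta> ((B, ()), t)) = f (push \<beta> {..n} t)" if "B \<noteq> {}" "B \<subseteq> {..n}" "t \<in> affine_simplex B" for B t
    using coordinates_glue_class[OF mc\<Delta>, of "()" B t] that by (simp add: F_def simps_simplex_mc)
  have contF: "continuous_map (realization ?\<Delta>) (realization K) F"
  proof (rule continuous_map_from_realization[OF mc\<Delta>])
    fix B and x :: unit assume "x \<in> simps ?\<Delta> B"
    then have B: "B \<noteq> {}" "B \<subseteq> {..n}" by (auto simp: simps_simplex_mc split: if_splits)
    have "continuous_map (simplex_space B) (realization K) (f \<circ> (push \<beta> {..n} \<circ> id))"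
      using continuous_map_push_simplex[of "{..n}" \<beta>] \<beta>A B
      by (intro continuous_map_compose[OF _ f] continuous_map_compose[OF continuous_map_simplex_inclusion[of "{..n}"]]) auto
    then show "continuous_map (simplex_space B) (realization K) (\<lambda>t. F (glue_class ?\<Delta> ((B, x), t)))"
      by (rule continuous_map_eq) (use F B in auto)
  qed
  have \<tau>face: "\<tau> C = bdry K B C (\<tau> B)" if B: "B \<subset> A" and C: "C \<subseteq> B" "C \<noteq> {}" for B C
  proof (rule simplex_determined[OF K])
    have B': "B \<noteq> {}" "C \<subset> A" "finite B" using B C A finite_subset by auto
    show "\<tau> C \<in> simps K C" using \<tau>[OF B'(2) C(2)] .
    show "bdry K B C (\<tau> B) \<in> simps K C" using simplex_face[OF K \<tau>[OF B B'(1)] C] .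
    fix t assume t: "t \<in> affine_simplex C"
    then have tB: "t \<in> affine_simplex B" using affine_simplex_mono[OF B'(3) C(1)] by blast
    show "glue_class K ((C, \<tau> C), t) = glue_class K ((C, bdry K B C (\<tau> B)), t)"
      using f\<tau>[OF B'(2) C(2) t] f\<tau>[OF B B'(1) tB] glue_class_face[OF K \<tau>[OF B B'(1)] C t] by simp
  qed
  have vertsA: "A \<subseteq> verts K"
  proof
    fix a assume a: "a \<in> A"
    have "{a} \<noteq> A" using A by auto
    then have "\<tau> {a} \<in> simps K {a}" using a by (intro \<tau>) auto
    then show "a \<in> verts K" using simplex_verts[OF K] by blast
  qed
  define G where "G = (\<lambda>B (x :: unit). \<tau> (\<beta> ` B))"
  have emb: "simplicial_embedding ?bd K \<beta> G"
    unfolding simplicial_embedding_def simplicial_map_def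
  proof (intro conjI allI ballI impI)
    show "\<beta> ` verts ?bd \<subseteq> verts K" using vertsA \<beta>A n by (simp add: verts_simplex_boundary_mc)
    show "inj_on \<beta> (verts ?bd)" using \<beta>i n by (simp add: verts_simplex_boundary_mc)
    fix B and x :: unit assume "x \<in> simps ?bd B"
    then have B: "B \<noteq> {}" "B \<subset> {..n}" by (auto simp: simps_simplex_boundary_mc split: if_splits)
    show "G B x \<in> simps K (\<beta> ` B)" unfolding G_def using B \<beta>ss by (intro \<tau>) auto
    fix C assume C: "C \<subseteq> B \<and> C \<noteq> {}"
    then show "G C (bdry ?bd B C x) = bdry K (\<beta> ` B) (\<beta> ` C) (G B x)"
      unfolding G_def using B by (intro \<tau>face \<beta>ss) auto
  qed (auto simp: inj_on_def)
  have incl: "F (boundary_inclusion n p) = realization_map K \<beta> G p" if p0: "p \<in> topspace (realization ?bd)" for p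
  proof -
    obtain B x t where p': "p = glue_class ?bd ((B, x), t)" "x \<in> simps ?bd B" "t \<in> affine_simplex B"
      using p0 unfolding topspace_realization[OF mcbd] by blast
    then have p: "p = glue_class ?bd ((B, ()), t)" "B \<noteq> {}" "B \<subset> {..n}" "t \<in> affine_simplex B"
      by (auto simp: simps_simplex_boundary_mc split: if_splits)
    have fB: "finite B" using p(3) finite_subset by auto
    have "push \<beta> B t = push \<beta> {..n} t"
      by (rule push_superset) (use p in \<open>auto simp: affine_simplex_def\<close>)
    moreover have "push \<beta> B t \<in> affine_simplex (\<beta> ` B)" using push_in_affine_simplex[OF fB p(4)] .
    ultimately have "f (push \<beta> {..n} t) = glue_class K ((\<beta> ` B, \<tau> (\<beta> ` B)), push \<beta> B t)"
      using f\<tau>[OF \<beta>ss[OF p(3)]] p(2) by simp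
    moreover have "realization_map K \<beta> G p = glue_class K ((\<beta> ` B, G B ()), push \<beta> B t)"
      unfolding p(1) by (rule realization_map_glue_class[OF mcbd K])
        (use emb p in \<open>auto simp: simplicial_embedding_def simps_simplex_boundary_mc\<close>)
    ultimately show ?thesis
      using p F by (simp add: boundary_inclusion_glue_class G_def psubset_imp_subset)
  qed
  from complete[unfolded complete_multicomplex_def, rule_format, OF n(1), of F] contF emb incl
  obtain h H where hH: "simplicial_embedding ?\<Delta> K h H"
    and hom: "homotopic_with
             (\<lambda>k. \<forall>p\<in>topspace (realization ?bd). k (boundary_inclusion n p) = F (boundary_inclusion n p))
             (realization ?\<Delta>) (realization K) F (realization_map K h H)" by blast
  from hom[unfolded homotopic_with_def] obtain q where
    q: "continuous_map (prod_topology (top_of_set {0..1 :: real}) (realization ?\<Delta>)) (realization K) q"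
    and q0: "\<And>x. q (0, x) = F x" and q1: "\<And>x. q (1, x) = realization_map K h H x"
    and qb: "\<And>u p. u \<in> {0..1} \<Longrightarrow> p \<in> topspace (realization ?bd) \<Longrightarrow> q (u, boundary_inclusion n p) = F (boundary_inclusion n p)"
    by blast
  have hmap: "simplicial_map ?\<Delta> K h H" using hH by (simp add: simplicial_embedding_def)
  have qface: "q (u, glue_class ?\<Delta> ((B, ()), t)) = f (push \<beta> {..n} t)"
    if "u \<in> {0..1}" "B \<noteq> {}" "B \<subset> {..n}" "t \<in> affine_simplex B" for u B t
  proof -
    have "glue_class ?bd ((B, ()), t) \<in> topspace (realization ?bd)"
      unfolding topspace_realization[OF mcbd] using that by (auto simp: simps_simplex_boundary_mc)
    from qb[OF that(1) this] show ?thesis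
      using that F by (simp add: boundary_inclusion_glue_class psubset_imp_subset)
  qed
  have h\<beta>: "h i = \<beta> i" if "i \<in> {..n}" for i
  proof -
    have "{i} \<noteq> {..n}"
    proof
      assume "{i} = {..n}"
      then have "card {..n} = card {i}" by simp
      then show False using n by simp
    qed
    then have i: "{i} \<subset> {..n}" using that by auto
    have c: "corner i \<in> affine_simplex {i}" by (simp add: affine_simplex_singleton)
    have \<beta>i': "{\<beta> i} \<subset> A" using \<beta>ss[OF i] by simp
    have pc: "push \<beta> {..n} (corner i) = corner (\<beta> i)" using that by (simp add: push_corner)
    have "glue_class K (({h i}, H {i} ()), corner (h i)) = realization_map K h H (glue_class ?\<Delta> (({i}, ()), corner i))"
      using realization_map_glue_class[OF mc\<Delta> K hmap, of "()" "{i}" "corner i"] c i that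
      by (simp add: simps_simplex_mc push_corner)
    also have "\<dots> = f (corner (\<beta> i))"
      using qface[of 1 "{i}" "corner i"] q1 i c pc by simp
    also have "\<dots> = glue_class K (({\<beta> i}, \<tau> {\<beta> i}), corner (\<beta> i))"
      by (rule f\<tau>[OF \<beta>i']) (auto simp: affine_simplex_singleton)
    finally have "corner (h i) = corner (\<beta> i)"
    proof (rule glue_class_inj(1)[OF K, rotated -1])
      show "H {i} () \<in> simps K {h i}"
        using hmap i by (auto simp: simplicial_map_def simps_simplex_mc dest!: spec[of _ "{i}"])
      show "\<tau> {\<beta> i} \<in> simps K {\<beta> i}" by (rule \<tau>[OF \<beta>i']) simp
    qed (simp_all add: affine_simplex_singleton)
    then have "corner (h i) (h i) = corner (\<beta> i) (h i)" by simp
    then show ?thesis by (simp add: corner_def split: if_splits)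
  qed
  have hA: "h ` {..n} = A" using h\<beta> \<beta>A by auto
  define \<sigma> where "\<sigma> = H {..n} ()"
  have \<sigma>: "\<sigma> \<in> simps K A"
    using hmap hA by (auto simp: simplicial_map_def simps_simplex_mc \<sigma>_def dest!: spec[of _ "{..n}"])
  define k where "k = (\<lambda>x. q (snd x, glue_class ?\<Delta> (({..n}, ()), push \<gamma> A (fst x))))"
  have p\<gamma>: "push \<gamma> A t \<in> affine_simplex {..n}" if "t \<in> affine_simplex A" for t
    using push_in_affine_simplex[OF A(1) that, of \<gamma>] \<gamma>A by simp
  have "continuous_map (cylinder A) (realization ?\<Delta>) ((\<lambda>t. glue_class ?\<Delta> (({..n}, ()), t)) \<circ> (push \<gamma> A \<circ> fst))"
  proof (intro continuous_map_compose)
    show "continuous_map (cylinder A) (simplex_space A) fst" by (rule continuous_map_fst)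
    show "continuous_map (simplex_space A) (simplex_space {..n}) (push \<gamma> A)"
      using continuous_map_push_simplex[OF A(1), of \<gamma>] \<gamma>A by simp
    show "continuous_map (simplex_space {..n}) (realization ?\<Delta>) (\<lambda>t. glue_class ?\<Delta> (({..n}, ()), t))"
      by (rule continuous_map_cell[OF mc\<Delta>]) (auto simp: simps_simplex_mc)
  qed
  then have "continuous_map (cylinder A) (prod_topology (top_of_set {0..1}) (realization ?\<Delta>))
      (\<lambda>x. (snd x, glue_class ?\<Delta> (({..n}, ()), push \<gamma> A (fst x))))"
    by (intro continuous_map_pairedI continuous_map_snd) (simp add: o_def)
  from continuous_map_compose[OF this q] have contk: "continuous_map (cylinder A) (realization K) k"
    by (simp add: k_def o_def)
  note inv = push_push_inverse[OF A(1) _ \<beta> finite_atMost, folded \<gamma>_def]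
  have k0: "k (t, 0) = f t" if "t \<in> affine_simplex A" for t
    using F[of "{..n}" "push \<gamma> A t"] p\<gamma>[OF that] inv[OF that, of \<beta>] by (simp add: k_def q0)
  have k1: "k (t, 1) = glue_class K ((A, \<sigma>), t)" if "t \<in> affine_simplex A" for t
  proof -
    have "k (t, 1) = glue_class K ((h ` {..n}, H {..n} ()), push h {..n} (push \<gamma> A t))"
      unfolding k_def using q1 realization_map_glue_class[OF mc\<Delta> K hmap, of "()" "{..n}" "push \<gamma> A t"] p\<gamma>[OF that]
      by (auto simp: simps_simplex_mc)
    then show ?thesis using inv[OF that, of h] h\<beta> hA by (simp add: \<sigma>_def)
  qed
  have kb: "k (t, u) = f t" if B: "B \<subset> A" "B \<noteq> {}" and t: "t \<in> affine_simplex B" and u: "u \<in> {0..1}" for B t u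
  proof -
    have fB: "finite B" using B A finite_subset by auto
    have tA: "t \<in> affine_simplex A" using affine_simplex_mono[OF A(1), of B] B t by auto
    have e: "push \<gamma> B t = push \<gamma> A t"
      by (rule push_superset) (use A B t in \<open>auto simp: affine_simplex_def\<close>)
    have "push \<gamma> A t \<in> affine_simplex (\<gamma> ` B)" using push_in_affine_simplex[OF fB t, of \<gamma>] e by simp
    then have "k (t, u) = f (push \<beta> {..n} (push \<gamma> A t))"
      unfolding k_def
      using qface[OF u _ \<gamma>ss[OF B(1)], of "push \<gamma> A t"] B \<gamma>ss[OF B(1)]
        glue_class_face[OF mc\<Delta>, of "()" "{..n}" "\<gamma> ` B" "push \<gamma> A t"]
      by (auto simp: simps_simplex_mc bdry_simplex_mc)
    then show ?thesis using inv[OF tA, of \<beta>] by simp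
  qed
  show ?thesis using \<sigma> contk k0 k1 kb by blast
qed

section \<open>Straightening homotopies\<close>

text \<open>
  The straightening of a simplex with \<open>N\<close> vertices comes to rest at time \<open>stage N\<close>. Its proper faces have
  come to rest strictly earlier, which leaves time for a homotopy relative to the boundary.
\<close>

definition stage :: "nat \<Rightarrow> real" where
  "stage N = real N / (real N + 1)"

lemma stage_bounds: "0 \<le> stage N" "stage N < 1" "M \<le> N \<Longrightarrow> stage M \<le> stage N" "M < N \<Longrightarrow> stage M < stage N"
proof -
  have *: "stage N = 1 - 1 / (real N + 1)" for N by (simp add: stage_def field_simps)
  show "0 \<le> stage N" "stage N < 1" by (simp_all add: stage_def)
  show "M \<le> N \<Longrightarrow> stage M \<le> stage N" unfolding * by (simp add: frac_le)
  show "M < N \<Longrightarrow> stage M < stage N" unfolding * by (simp add: frac_less2)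
qed

text \<open>
  The last condition keeps simplices of \<open>K\<close> fixed. It makes an algebraic simplex reappear as the
  bottom of the prism over it.
\<close>

definition straightening ::
  "('v, 's) multicomplex \<Rightarrow> 'v set \<Rightarrow> (('v \<Rightarrow> real) \<Rightarrow> ('v, 's) pre_point set) \<Rightarrow>
    (('v \<Rightarrow> real) \<times> real \<Rightarrow> ('v, 's) pre_point set) \<Rightarrow> bool" where
  "straightening K A s h \<longleftrightarrow>
     continuous_map (cylinder A) (realization K) h \<and>
     (\<forall>t\<in>affine_simplex A. h (t, 0) = s t) \<and>
     (\<exists>\<sigma>\<in>simps K A. \<forall>t\<in>affine_simplex A. \<forall>u\<in>{stage (card A)..1}. h (t, u) = glue_class K ((A, \<sigma>), t)) \<and>
     (\<forall>\<sigma>\<in>simps K A. (\<forall>t\<in>affine_simplex A. s t = glue_class K ((A, \<sigma>), t)) \<longrightarrow>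
        (\<forall>t\<in>affine_simplex A. \<forall>u\<in>{0..1}. h (t, u) = s t))"

text \<open>
  The domain of a labelled singular simplex is the affine simplex on the set of its labels, so the domain of
  a face is a subset of it, and compatibility with faces becomes an equation between restrictions that involves no
  ordering of the labels.
\<close>

definition labelled_simplex ::
  "('v, 's) multicomplex \<Rightarrow> 'v set \<Rightarrow> (('v \<Rightarrow> real) \<Rightarrow> ('v, 's) pre_point set) \<Rightarrow> bool" where
  "labelled_simplex K A s \<longleftrightarrow>
     finite A \<and> A \<noteq> {} \<and> A \<subseteq> verts K \<and> continuous_map (simplex_space A) (realization K) s \<and>
     (\<forall>a\<in>A. path_component_of (realization K) (s (corner a)) (vertex_point K a))"

lemma straightening_cong:
  assumes "\<And>t. t \<in> affine_simplex A \<Longrightarrow> s t = s' t"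
  shows "straightening K A s h \<longleftrightarrow> straightening K A s' h"
  using assms unfolding straightening_def by simp

text \<open>
  The induction step of the straightening construction: the homotopies \<open>g B\<close> on the proper faces extend
  to \<open>A\<close>. Extend them to \<open>E\<close> until all faces have come to rest; at this time \<open>E\<close> is a simplicial embedding on the
  boundary, and the remaining time is used for the homotopy \<open>k\<close> obtained from completeness.
\<close>

lemma straightening_exists:
  fixes K :: "('v, 's) multicomplex"
  assumes K: "multicomplex K" and complete: "complete_multicomplex K"
    and s: "labelled_simplex K A s"
    and g: "\<And>B. B \<subset> A \<Longrightarrow> B \<noteq> {} \<Longrightarrow> straightening K B s (g B)"
    and compat: "\<And>B C t u. B \<subset> A \<Longrightarrow> C \<subseteq> B \<Longrightarrow> C \<noteq> {} \<Longrightarrow> t \<in> affine_simplex C \<Longrightarrow> u \<in> {0..1} \<Longrightarrow> g B (t, u) = g C (t, u)"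
  shows "\<exists>h. straightening K A s h \<and>
    (\<forall>B t u. B \<subset> A \<longrightarrow> B \<noteq> {} \<longrightarrow> t \<in> affine_simplex B \<longrightarrow> u \<in> {0..1} \<longrightarrow> h (t, u) = g B (t, u))"
proof -
  have A: "finite A" "A \<noteq> {}" "A \<subseteq> verts K" and cont: "continuous_map (simplex_space A) (realization K) s"
    and path: "\<And>a. a \<in> A \<Longrightarrow> path_component_of (realization K) (s (corner a)) (vertex_point K a)"
    using s by (auto simp: labelled_simplex_def)
  note sub = affine_simplex_mono[OF A(1)]
  consider (simplex) \<sigma> where "\<sigma> \<in> simps K A" "\<forall>t\<in>affine_simplex A. s t = glue_class K ((A, \<sigma>), t)"
    | (vertex) a where "A = {a}"
    | (general) "card A \<ge> 2" "\<not> (\<exists>\<sigma>\<in>simps K A. \<forall>t\<in>affine_simplex A. s t = glue_class K ((A, \<sigma>), t))"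
  proof (cases "card A \<ge> 2")
    case False
    then have "card A = 1" using A(1,2) by (simp add: card_gt_0_iff Suc_leI le_antisym not_less_eq_eq numeral_2_eq_2)
    then show ?thesis using that(2) card_1_singletonE by metis
  qed (use that in blast)
  then show ?thesis
  proof cases
    case simplex
    have "straightening K A s (s \<circ> fst)"
      unfolding straightening_def
      using continuous_map_compose[OF continuous_map_fst cont] simplex by auto
    moreover have "(s \<circ> fst) (t, u) = g B (t, u)" if B: "B \<subset> A" "B \<noteq> {}" and t: "t \<in> affine_simplex B" "u \<in> {0..1}" for B t u
    proof -
      have "s x = glue_class K ((B, bdry K A B \<sigma>), x)" if "x \<in> affine_simplex B" for x
        using glue_class_face[OF K simplex(1) _ B(2) that] simplex(2) B(1) sub[of B] that by auto
      moreover have "bdry K A B \<sigma> \<in> simps K B" using simplex_face[OF K simplex(1) _ B(2)] B(1) by blast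
      ultimately show ?thesis using g[OF B] t unfolding straightening_def by auto
    qed
    ultimately show ?thesis by blast
  next
    case vertex
    have "path_component_of (realization K) (s (corner a)) (vertex_point K a)" using path[of a] vertex by simp
    then have vt: "vertex_point K a \<in> topspace (realization K)" by (blast dest: path_component_in_topspace)
    from \<open>path_component_of (realization K) (s (corner a)) (vertex_point K a)\<close>
    obtain p where p: "continuous_map (top_of_set {0..1 :: real}) (realization K) p"
      "p 0 = s (corner a)" "p 1 = vertex_point K a"
      unfolding path_component_of_def pathin_def by blast
    have a: "the_elem (simps K {a}) \<in> simps K {a}" using vertex_simplex[OF K, of a] A vertex by auto
    \<comment> \<open>\<open>stage 1\<close> is one half, hence the factor \<open>2\<close>\<close>
    define h where "h = (\<lambda>x :: ('v \<Rightarrow> real) \<times> real. p (min 1 (2 * snd x)))"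
    have "continuous_map (cylinder A) euclideanreal (\<lambda>x. min 1 (2 * snd x))"
      by (intro continuous_intros continuous_map_cylinder_coordinate)
    then have "continuous_map (cylinder A) (top_of_set {0..1}) (\<lambda>x. min 1 (2 * snd x))"
      by (auto simp: continuous_map_in_subtopology)
    from continuous_map_compose[OF this p(1)] have h: "continuous_map (cylinder A) (realization K) h"
      by (simp add: h_def o_def)
    have vp: "glue_class K (({a}, \<sigma>), corner a) = vertex_point K a" if "\<sigma> \<in> simps K {a}" for \<sigma>
      using vertex_point_eq[OF K that, of a] by simp
    have end_: "h (t, u) = vertex_point K a" if "u \<in> {stage 1..1}" for t u
      using that p(3) by (simp add: h_def stage_def min_def)
    show ?thesis
    proof (cases "s (corner a) = vertex_point K a")
      case True
      have "straightening K A s (\<lambda>x. vertex_point K a)"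
        unfolding straightening_def vertex affine_simplex_singleton
        using a True vp vt by (auto intro!: bexI[of _ "the_elem (simps K {a})"])
      then show ?thesis using vertex by auto
    next
      case False
      have "straightening K A s h"
        unfolding straightening_def
      proof (intro conjI)
        show "continuous_map (cylinder A) (realization K) h" by (rule h)
        show "\<forall>t\<in>affine_simplex A. h (t, 0) = s t"
          by (simp add: vertex affine_simplex_singleton h_def p(2))
        show "\<exists>\<sigma>\<in>simps K A. \<forall>t\<in>affine_simplex A. \<forall>u\<in>{stage (card A)..1}. h (t, u) = glue_class K ((A, \<sigma>), t)"
          unfolding vertex affine_simplex_singleton by (rule bexI[OF _ a]) (simp add: vp[OF a] end_)
        show "\<forall>\<sigma>\<in>simps K A. (\<forall>t\<in>affine_simplex A. s t = glue_class K ((A, \<sigma>), t)) \<longrightarrow>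
            (\<forall>t\<in>affine_simplex A. \<forall>u\<in>{0..1}. h (t, u) = s t)"
          unfolding vertex affine_simplex_singleton by (intro ballI impI) (simp add: vp False)
      qed
      then show ?thesis using vertex by auto
    qed
  next
    case general
    define N where "N = card A"
    define supp where "supp t = {v. t v \<noteq> (0 :: real)}" for t :: "'v \<Rightarrow> real"
    \<comment> \<open>one function for all walls: use the smallest face containing the point\<close>
    define G where "G = (\<lambda>x :: ('v \<Rightarrow> real) \<times> real. g (supp (fst x)) x)"
    have G: "G (t, u) = g B (t, u)" if B: "B \<subset> A" and t: "t \<in> affine_simplex B" and u: "u \<in> {0..1}" for B t u
    proof -
      have "finite B" using B A finite_subset by auto
      from affine_simplex_support[OF this t] show ?thesis
        using compat[OF B, of "supp t" t u] u affine_simplex_support(3)[OF \<open>finite B\<close> t, of "supp t"] \<open>finite B\<close> finite_subset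
        unfolding G_def supp_def by auto
    qed
    have gc: "continuous_map (cylinder B) (realization K) (g B)" if "B \<subset> A" "B \<noteq> {}" for B
      using g[OF that] by (simp add: straightening_def)
    have "\<exists>E. continuous_map (cylinder A) (realization K) E \<and> (\<forall>t\<in>affine_simplex A. E (t, 0) = s t) \<and>
      (\<forall>a\<in>A. \<forall>t\<in>affine_simplex (A - {a}). \<forall>u\<in>{0..1}. E (t, u) = G (t, u))"
    proof (rule simplex_homotopy_extension[OF A(1,2) cont])
      fix a assume a: "a \<in> A"
      have ne: "A - {a} \<noteq> {}" using general(1) a by (auto simp: subset_singleton_iff)
      have ss: "A - {a} \<subset> A" using a by blast
      show "continuous_map (cylinder (A - {a})) (realization K) G"
        by (rule continuous_map_eq[OF gc[OF ss ne]]) (use G[OF ss] in auto)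
      fix t assume t: "t \<in> affine_simplex (A - {a})"
      show "G (t, 0) = s t" using G[OF ss t, of 0] g[OF ss ne] t by (simp add: straightening_def)
    qed
    then obtain E where E: "continuous_map (cylinder A) (realization K) E" "\<And>t. t \<in> affine_simplex A \<Longrightarrow> E (t, 0) = s t"
      "\<And>a t u. a \<in> A \<Longrightarrow> t \<in> affine_simplex (A - {a}) \<Longrightarrow> u \<in> {0..1} \<Longrightarrow> E (t, u) = G (t, u)" by blast
    have Eg: "E (t, u) = g B (t, u)" if B: "B \<subset> A" and t: "t \<in> affine_simplex B" and u: "u \<in> {0..1}" for B t u
    proof -
      obtain a where "a \<in> A" "B \<subseteq> A - {a}" using B by blast
      then have "E (t, u) = G (t, u)" using E(3) affine_simplex_mono[of "A - {a}" B] A(1) t u by blast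
      then show ?thesis using G[OF B t u] by simp
    qed
    define a b where "a = stage (N - 1)" and "b = stage N"
    have N: "N \<ge> 2" using general(1) by (simp add: N_def)
    have ab: "0 \<le> a" "a < b" "b < 1" using stage_bounds N by (auto simp: a_def b_def)
    define \<tau> where "\<tau> B = (SOME \<sigma>. \<sigma> \<in> simps K B \<and>
        (\<forall>t\<in>affine_simplex B. \<forall>u\<in>{stage (card B)..1}. g B (t, u) = glue_class K ((B, \<sigma>), t)))" for B
    have \<tau>: "\<tau> B \<in> simps K B \<and> (\<forall>t\<in>affine_simplex B. \<forall>u\<in>{stage (card B)..1}. g B (t, u) = glue_class K ((B, \<tau> B), t))"
      if "B \<subset> A" "B \<noteq> {}" for B
      unfolding \<tau>_def by (rule someI_ex) (use g[OF that] in \<open>auto simp: straightening_def\<close>)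
    have \<tau>a: "g B (t, u) = glue_class K ((B, \<tau> B), t)" if B: "B \<subset> A" "B \<noteq> {}" and "t \<in> affine_simplex B" "u \<in> {a..1}" for B t u
    proof -
      have "card B \<le> N - 1" using psubset_card_mono[OF A(1) B(1)] by (simp add: N_def)
      then have "stage (card B) \<le> a" unfolding a_def by (rule stage_bounds)
      then show ?thesis using \<tau>[OF B] that by auto
    qed
    have contf: "continuous_map (simplex_space A) (realization K) (\<lambda>t. E (t, a))"
    proof -
      have "continuous_map (simplex_space A) (cylinder A) (\<lambda>t. (t, a))"
        using ab by (intro continuous_map_pairedI) (auto simp: continuous_map_in_subtopology)
      from continuous_map_compose[OF this E(1)] show ?thesis by (simp add: o_def)
    qed
    obtain \<sigma> k where \<sigma>: "\<sigma> \<in> simps K A" and k: "continuous_map (cylinder A) (realization K) k"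
      "\<And>t. t \<in> affine_simplex A \<Longrightarrow> k (t, 0) = E (t, a)" "\<And>t. t \<in> affine_simplex A \<Longrightarrow> k (t, 1) = glue_class K ((A, \<sigma>), t)"
      "\<And>B t u. B \<subset> A \<Longrightarrow> B \<noteq> {} \<Longrightarrow> t \<in> affine_simplex B \<Longrightarrow> u \<in> {0..1} \<Longrightarrow> k (t, u) = E (t, a)"
      using complete_filling[OF K complete A(1) general(1) contf, of \<tau>] \<tau> \<tau>a Eg ab by (auto simp: less_imp_le)
    \<comment> \<open>\<open>max 0\<close> and \<open>min 1\<close> keep the time of \<open>k\<close> in the unit interval before \<open>a\<close> and after \<open>b\<close>\<close>
    define h where "h = (\<lambda>x. if snd x \<le> a then E x else k (fst x, max 0 (min 1 ((snd x - a) / (b - a)))))"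
    have conth: "continuous_map (cylinder A) (realization K) h"
      unfolding h_def
    proof (rule continuous_map_cases_le)
      show "continuous_map (cylinder A) euclideanreal snd" by (rule continuous_map_cylinder_coordinate)
      show "continuous_map (cylinder A) euclideanreal (\<lambda>x. a)" by simp
      show "continuous_map (subtopology (cylinder A) {x \<in> topspace (cylinder A). snd x \<le> a}) (realization K) E"
        by (rule continuous_map_from_subtopology[OF E(1)])
      have "continuous_map (cylinder A) euclideanreal (\<lambda>x. max 0 (min 1 ((snd x - a) / (b - a))))"
        using ab by (intro continuous_intros continuous_map_cylinder_coordinate) auto
      then have "continuous_map (cylinder A) (cylinder A) (\<lambda>x. (fst x, max 0 (min 1 ((snd x - a) / (b - a)))))"
        by (intro continuous_map_pairedI continuous_map_fst) (auto simp: continuous_map_in_subtopology)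
      from continuous_map_compose[OF this k(1)]
      show "continuous_map (subtopology (cylinder A) {x \<in> topspace (cylinder A). a \<le> snd x}) (realization K)
          (\<lambda>x. k (fst x, max 0 (min 1 ((snd x - a) / (b - a)))))"
        by (intro continuous_map_from_subtopology) (simp add: o_def)
      fix x assume "x \<in> topspace (cylinder A)" "snd x = a"
      then show "E x = k (fst x, max 0 (min 1 ((snd x - a) / (b - a))))"
        using k(2) by (cases x) auto
    qed
    have "straightening K A s h"
      unfolding straightening_def
    proof (intro conjI ballI)
      fix t assume t: "t \<in> affine_simplex A"
      show "h (t, 0) = s t" using E(2)[OF t] ab by (simp add: h_def)
    next
      show "\<exists>\<sigma>\<in>simps K A. \<forall>t\<in>affine_simplex A. \<forall>u\<in>{stage (card A)..1}. h (t, u) = glue_class K ((A, \<sigma>), t)"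
      proof (intro bexI[OF _ \<sigma>] ballI)
        fix t u assume t: "t \<in> affine_simplex A" and u: "u \<in> {stage (card A)..1}"
        then have "b \<le> u" by (simp add: b_def N_def)
        then have "(u - a) / (b - a) \<ge> 1" "\<not> u \<le> a" using ab by (simp_all add: field_simps)
        then show "h (t, u) = glue_class K ((A, \<sigma>), t)" using k(3)[OF t] by (simp add: h_def)
      qed
    qed (use conth general(2) in auto)
    moreover have "h (t, u) = g B (t, u)" if B: "B \<subset> A" "B \<noteq> {}" and t: "t \<in> affine_simplex B" and u: "u \<in> {0..1}" for B t u
    proof (cases "u \<le> a")
      case True
      then show ?thesis using Eg[OF B(1) t u] by (simp add: h_def)
    next
      case False
      then have "h (t, u) = E (t, a)" using k(4)[OF B t] by (simp add: h_def)
      also have "\<dots> = g B (t, a)" using Eg[OF B(1) t] ab by simp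
      also have "\<dots> = g B (t, u)" using \<tau>a[OF B t] False u ab by simp
      finally show ?thesis .
    qed
    ultimately show ?thesis by blast
  qed
qed

text \<open>
  The choice for \<open>A\<close> is made after the choices for its proper subsets. Restricting \<open>s\<close> makes the homotopy on a face
  depend on the face alone, so that simplices with a common face have the same homotopy on it.
\<close>

function straighten ::
  "('v, 's) multicomplex \<Rightarrow> 'v set \<Rightarrow> (('v \<Rightarrow> real) \<Rightarrow> ('v, 's) pre_point set) \<Rightarrow>
    ('v \<Rightarrow> real) \<times> real \<Rightarrow> ('v, 's) pre_point set" where
  "straighten K A s = (SOME h. straightening K A s h \<and>
     (\<forall>B. if B \<subset> A \<and> B \<noteq> {} \<and> finite A
        then \<forall>t\<in>affine_simplex B. \<forall>u\<in>{0..1}. h (t, u) = straighten K B (restrict s (affine_simplex B)) (t, u)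
        else True))"
  by pat_completeness auto
termination
  by (relation "Wellfounded.measure (\<lambda>(K, A, s). card A)") (auto intro: psubset_card_mono)

declare straighten.simps [simp del]

lemma labelled_simplex_face:
  assumes "labelled_simplex K A s" "B \<subseteq> A" "B \<noteq> {}"
  shows "labelled_simplex K B (restrict s (affine_simplex B))"
proof -
  have A: "finite A" and fB: "finite B" using assms finite_subset by (auto simp: labelled_simplex_def)
  have "continuous_map (simplex_space B) (realization K) (s \<circ> id)"
    using assms by (intro continuous_map_compose[OF continuous_map_simplex_inclusion[OF A assms(2)]]) (simp add: labelled_simplex_def)
  then have "continuous_map (simplex_space B) (realization K) (restrict s (affine_simplex B))"
    by (rule continuous_map_eq) simp
  then show ?thesis using assms fB corner_in_affine_simplex[OF fB] by (auto simp: labelled_simplex_def)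
qed

lemma straighten_correct:
  assumes K: "multicomplex K" and complete: "complete_multicomplex K" and s: "labelled_simplex K A s"
  shows "straightening K A s (straighten K A s)"
    and "B \<subset> A \<Longrightarrow> B \<noteq> {} \<Longrightarrow> t \<in> affine_simplex B \<Longrightarrow> u \<in> {0..1} \<Longrightarrow>
      straighten K A s (t, u) = straighten K B (restrict s (affine_simplex B)) (t, u)"
proof -
  have "finite A" using s by (simp add: labelled_simplex_def)
  then have *: "straightening K A s (straighten K A s) \<and>
      (\<forall>B t u. B \<subset> A \<longrightarrow> B \<noteq> {} \<longrightarrow> t \<in> affine_simplex B \<longrightarrow> u \<in> {0..1} \<longrightarrow>
        straighten K A s (t, u) = straighten K B (restrict s (affine_simplex B)) (t, u))"
    if "labelled_simplex K A s" for s
    using that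
  proof (induction A arbitrary: s rule: finite_psubset_induct)
    case (psubset A)
    define g where "g B = straighten K B (restrict s (affine_simplex B))" for B
    have lab: "labelled_simplex K B (restrict s (affine_simplex B))" if "B \<subset> A" "B \<noteq> {}" for B
      using labelled_simplex_face[OF psubset.prems] that by blast
    have rr: "restrict (restrict s (affine_simplex B)) (affine_simplex C) = restrict s (affine_simplex C)"
      if "B \<subset> A" "C \<subseteq> B" for B C
    proof -
      have "finite B" using that psubset.hyps finite_subset by auto
      from affine_simplex_mono[OF this that(2)] show ?thesis by (simp add: Int_absorb1)
    qed
    have ex: "\<exists>h. straightening K A s h \<and>
      (\<forall>B t u. B \<subset> A \<longrightarrow> B \<noteq> {} \<longrightarrow> t \<in> affine_simplex B \<longrightarrow> u \<in> {0..1} \<longrightarrow> h (t, u) = g B (t, u))"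
    proof (rule straightening_exists[OF K complete psubset.prems, where g=g])
      fix B assume B: "B \<subset> A" "B \<noteq> {}"
      have "straightening K B (restrict s (affine_simplex B)) (g B)"
        unfolding g_def using psubset.IH[OF B(1) lab[OF B]] by blast
      then show "straightening K B s (g B)" using straightening_cong[of B "restrict s (affine_simplex B)" s] by simp
    next
      fix B C t u assume B: "B \<subset> A" and C: "C \<subseteq> B" "C \<noteq> {}" and t: "t \<in> affine_simplex C" "u \<in> {0..1 :: real}"
      show "g B (t, u) = g C (t, u)"
      proof (cases "C = B")
        case False
        then have "C \<subset> B" "B \<noteq> {}" using C by auto
        with psubset.IH[OF B lab[OF B \<open>B \<noteq> {}\<close>]] C t
        have "g B (t, u) = straighten K C (restrict (restrict s (affine_simplex B)) (affine_simplex C)) (t, u)"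
          unfolding g_def by blast
        then show ?thesis by (simp only: rr[OF B C(1)] g_def)
      qed simp
    qed
    define P where "P h \<longleftrightarrow> straightening K A s h \<and>
       (\<forall>B. if B \<subset> A \<and> B \<noteq> {} \<and> finite A
          then \<forall>t\<in>affine_simplex B. \<forall>u\<in>{0..1}. h (t, u) = straighten K B (restrict s (affine_simplex B)) (t, u)
          else True)" for h
    have "straighten K A s = (SOME h. P h)"
      unfolding P_def by (rule straighten.simps)
    moreover obtain h where h: "straightening K A s h"
      "\<And>B t u. B \<subset> A \<Longrightarrow> B \<noteq> {} \<Longrightarrow> t \<in> affine_simplex B \<Longrightarrow> u \<in> {0..1} \<Longrightarrow> h (t, u) = g B (t, u)"
      using ex by (elim exE conjE) (rule that, assumption, blast)
    have "P h" unfolding P_def using h by (simp add: g_def)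
    then have "P (SOME h. P h)" by (rule someI[of P])
    ultimately have P: "P (straighten K A s)" by simp
    have "straighten K A s (t, u) = straighten K B (restrict s (affine_simplex B)) (t, u)"
      if "B \<subset> A" "B \<noteq> {}" "t \<in> affine_simplex B" "u \<in> {0..1}" for B t u
      using conjunct2[OF P[unfolded P_def], rule_format, of B] that psubset.hyps by simp
    then show ?case using conjunct1[OF P[unfolded P_def]] by blast
  qed
  show "straightening K A s (straighten K A s)" using *[OF s] by blast
  show "B \<subset> A \<Longrightarrow> B \<noteq> {} \<Longrightarrow> t \<in> affine_simplex B \<Longrightarrow> u \<in> {0..1} \<Longrightarrow>
      straighten K A s (t, u) = straighten K B (restrict s (affine_simplex B)) (t, u)"
    using *[OF s] by blast
qed

definition straight_simplex ::
  "('v, 's) multicomplex \<Rightarrow> 'v set \<Rightarrow> (('v \<Rightarrow> real) \<Rightarrow> ('v, 's) pre_point set) \<Rightarrow> 's" where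
  "straight_simplex K A s = (SOME \<sigma>. \<sigma> \<in> simps K A \<and>
     (\<forall>t\<in>affine_simplex A. straighten K A s (t, 1) = glue_class K ((A, \<sigma>), t)))"

lemma straight_simplex:
  assumes "multicomplex K" "complete_multicomplex K" "labelled_simplex K A s"
  shows "straight_simplex K A s \<in> simps K A"
    and "t \<in> affine_simplex A \<Longrightarrow> straighten K A s (t, 1) = glue_class K ((A, straight_simplex K A s), t)"
proof -
  have "\<exists>\<sigma>. \<sigma> \<in> simps K A \<and> (\<forall>t\<in>affine_simplex A. straighten K A s (t, 1) = glue_class K ((A, \<sigma>), t))"
    using straighten_correct(1)[OF assms] stage_bounds(2)[of "card A"] unfolding straightening_def
    by (auto simp: less_imp_le)
  from someI_ex[OF this]
  show "straight_simplex K A s \<in> simps K A"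
    "t \<in> affine_simplex A \<Longrightarrow> straighten K A s (t, 1) = glue_class K ((A, straight_simplex K A s), t)"
    unfolding straight_simplex_def by blast+
qed

text \<open>
  A simplex of \<open>K\<close> is determined by its points, so compatibility of the homotopies with faces at time \<open>1\<close>
  gives compatibility of the simplices.
\<close>

lemma straight_simplex_face:
  assumes K: "multicomplex K" and c: "complete_multicomplex K" and s: "labelled_simplex K A s"
    and B: "B \<subset> A" "B \<noteq> {}"
  shows "bdry K A B (straight_simplex K A s) = straight_simplex K B (restrict s (affine_simplex B))"
proof (rule simplex_determined[OF K])
  note B' = psubset_imp_subset[OF B(1)] B(2)
  note sB = labelled_simplex_face[OF s B']
  note JA = straight_simplex[OF K c s] and JB = straight_simplex[OF K c sB]
  show "bdry K A B (straight_simplex K A s) \<in> simps K B" by (rule simplex_face[OF K JA(1) B'])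
  show "straight_simplex K B (restrict s (affine_simplex B)) \<in> simps K B" by (rule JB(1))
  fix t assume t: "t \<in> affine_simplex B"
  then have tA: "t \<in> affine_simplex A" using affine_simplex_mono[of A B] B' s by (auto simp: labelled_simplex_def)
  show "glue_class K ((B, bdry K A B (straight_simplex K A s)), t)
      = glue_class K ((B, straight_simplex K B (restrict s (affine_simplex B))), t)"
    using JA(2)[OF tA] JB(2)[OF t] straighten_correct(2)[OF K c s B t, of 1] glue_class_face[OF K JA(1) B' t] by simp
qed

lemma straight_simplex_id:
  assumes K: "multicomplex K" and c: "complete_multicomplex K" and s: "labelled_simplex K A s"
    and \<sigma>: "\<sigma> \<in> simps K A" "\<And>t. t \<in> affine_simplex A \<Longrightarrow> s t = glue_class K ((A, \<sigma>), t)"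
  shows "straight_simplex K A s = \<sigma>"
proof (rule simplex_determined[OF K straight_simplex(1)[OF K c s] \<sigma>(1)])
  fix t assume t: "t \<in> affine_simplex A"
  have "straighten K A s (t, 1) = s t"
    using straighten_correct(1)[OF K c s] \<sigma> t unfolding straightening_def by auto
  then show "glue_class K ((A, straight_simplex K A s), t) = glue_class K ((A, \<sigma>), t)"
    using straight_simplex(2)[OF K c s t] \<sigma>(2)[OF t] by simp
qed

section \<open>Vertex lists and prisms\<close>

lemma push_cong: "(\<And>a. a \<in> A \<Longrightarrow> f a = g a) \<Longrightarrow> push f A t = push g A t"
  unfolding push_def by (intro ext sum.cong) auto

lemma push_push:
  assumes "finite A" "finite B" "g ` A \<subseteq> B"
  shows "push f B (push g A t) = push (f \<circ> g) A t"
proof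
  fix x
  have "push f B (push g A t) x = (\<Sum>b\<in>{b \<in> B. f b = x}. \<Sum>a\<in>{a \<in> {a \<in> A. f (g a) = x}. g a = b}. t a)"
    unfolding push_def by (intro sum.cong refl) auto
  also have "\<dots> = (\<Sum>a\<in>{a \<in> A. f (g a) = x}. t a)"
    using assms by (intro sum.group) auto
  finally show "push f B (push g A t) x = push (f \<circ> g) A t x" by (simp add: push_def)
qed

definition skip :: "nat \<Rightarrow> nat \<Rightarrow> nat" where
  "skip k i = (if i < k then i else Suc i)"

lemma length_delete_nth: "k < length xs \<Longrightarrow> length (delete_nth k xs) = length xs - 1"
  by (simp add: delete_nth_def)

lemma nth_delete_nth: "k < length xs \<Longrightarrow> i < length xs - 1 \<Longrightarrow> delete_nth k xs ! i = xs ! skip k i"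
  by (auto simp: delete_nth_def nth_append skip_def)

lemma set_delete_nth: "set (delete_nth k xs) \<subseteq> set xs"
  unfolding delete_nth_def by (auto dest: in_set_takeD in_set_dropD)

lemma distinct_delete_nth:
  assumes "distinct xs" "k < length xs"
  shows "distinct (delete_nth k xs)" "set (delete_nth k xs) = set xs - {xs ! k}"
proof -
  have e: "xs = take k xs @ xs ! k # drop (Suc k) xs" by (rule id_take_nth_drop[OF assms(2)])
  have d: "distinct (take k xs @ xs ! k # drop (Suc k) xs)" by (rule subst[where P=distinct, OF e assms(1)])
  then show "distinct (delete_nth k xs)" by (auto simp: delete_nth_def)
  have "set xs = set (take k xs @ xs ! k # drop (Suc k) xs)" by (rule arg_cong[where f=set, OF e])
  also have "\<dots> - {xs ! k} = set (delete_nth k xs)" using d by (auto simp: delete_nth_def)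
  finally show "set (delete_nth k xs) = set xs - {xs ! k}" by simp
qed

lemma delete_nth_delete_nth:
  assumes "i \<le> j" "Suc j < length xs"
  shows "delete_nth j (delete_nth i xs) = delete_nth i (delete_nth (Suc j) xs)"
proof (rule nth_equalityI)
  show "length (delete_nth j (delete_nth i xs)) = length (delete_nth i (delete_nth (Suc j) xs))"
    using assms by (simp add: length_delete_nth)
  fix l assume "l < length (delete_nth j (delete_nth i xs))"
  then have "l < length xs - 2" using assms by (simp add: length_delete_nth)
  then show "delete_nth j (delete_nth i xs) ! l = delete_nth i (delete_nth (Suc j) xs) ! l"
    using assms by (simp add: nth_delete_nth length_delete_nth skip_def)
qed

text \<open>
  The vertices of the \<open>i\<close>-th simplex in the triangulation of the prism with bottom \<open>v\<close> and top \<open>w\<close>.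
\<close>

definition prism_list :: "nat \<Rightarrow> 'v list \<Rightarrow> 'v list \<Rightarrow> 'v list" where
  "prism_list i v w = take (Suc i) v @ drop i w"

lemma length_prism_list: "length v = Suc n \<Longrightarrow> length w = Suc n \<Longrightarrow> i \<le> n \<Longrightarrow> length (prism_list i v w) = Suc (Suc n)"
  by (simp add: prism_list_def)

lemma nth_prism_list:
  "length v = Suc n \<Longrightarrow> length w = Suc n \<Longrightarrow> i \<le> n \<Longrightarrow> j \<le> Suc n \<Longrightarrow>
    prism_list i v w ! j = (if j \<le> i then v ! j else w ! (j - 1))"
  by (auto simp: prism_list_def nth_append)

lemma set_prism_list: "set (prism_list i v w) \<subseteq> set v \<union> set w"
  by (auto simp: prism_list_def dest: in_set_takeD in_set_dropD)

text \<open>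
  The simplicial homotopy identities, which both prism constructions inherit from their lists of vertices.
\<close>

lemma delete_nth_prism_list:
  assumes "length v = Suc n" "length w = Suc n"
  shows "n = Suc p \<Longrightarrow> k \<le> i \<Longrightarrow> i \<le> p \<Longrightarrow>
      delete_nth k (prism_list (Suc i) v w) = prism_list i (delete_nth k v) (delete_nth k w)"
    and "n = Suc p \<Longrightarrow> i < k \<Longrightarrow> k \<le> n \<Longrightarrow>
      delete_nth (Suc k) (prism_list i v w) = prism_list i (delete_nth k v) (delete_nth k w)"
    and "i < n \<Longrightarrow> delete_nth (Suc i) (prism_list (Suc i) v w) = delete_nth (Suc i) (prism_list i v w)"
    and "delete_nth 0 (prism_list 0 v w) = w"
    and "delete_nth (Suc n) (prism_list n v w) = v"
proof -
  have del: "delete_nth k (prism_list i v w) ! l = (if skip k l \<le> i then v ! skip k l else w ! (skip k l - 1))"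
    if "i \<le> n" "k \<le> Suc n" "l \<le> n" for i k l
  proof -
    have "skip k l \<le> Suc n" using that by (simp add: skip_def)
    then show ?thesis
      using that assms by (simp add: nth_delete_nth length_prism_list nth_prism_list)
  qed
  have len: "length (delete_nth k (prism_list i v w)) = Suc n" if "i \<le> n" "k \<le> Suc n" for i k
    using that assms by (simp add: length_delete_nth length_prism_list)
  {
    assume n: "n = Suc p"
    have lens: "length (delete_nth k v) = Suc p" "length (delete_nth k w) = Suc p" if "k \<le> n" for k
      using that assms n by (simp_all add: length_delete_nth)
    have rhs: "prism_list i (delete_nth k v) (delete_nth k w) ! l
        = (if l \<le> i then v ! skip k l else w ! skip k (l - 1))" if "i \<le> p" "k \<le> n" "l \<le> n" for i k l
      using that assms n by (simp add: nth_prism_list[OF lens(1,2)] nth_delete_nth)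
    show "k \<le> i \<Longrightarrow> i \<le> p \<Longrightarrow>
      delete_nth k (prism_list (Suc i) v w) = prism_list i (delete_nth k v) (delete_nth k w)"
      by (rule nth_equalityI) (use n in \<open>auto simp: len length_prism_list[OF lens] del rhs skip_def\<close>)
    show "i < k \<Longrightarrow> k \<le> n \<Longrightarrow>
      delete_nth (Suc k) (prism_list i v w) = prism_list i (delete_nth k v) (delete_nth k w)"
      by (rule nth_equalityI) (use n in \<open>auto simp: len length_prism_list[OF lens] del rhs skip_def\<close>)
  }
  show "i < n \<Longrightarrow> delete_nth (Suc i) (prism_list (Suc i) v w) = delete_nth (Suc i) (prism_list i v w)"
    by (rule nth_equalityI) (auto simp: len del skip_def)
  show "delete_nth 0 (prism_list 0 v w) = w"
    by (rule nth_equalityI) (auto simp: len del skip_def assms)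
  show "delete_nth (Suc n) (prism_list n v w) = v"
    by (rule nth_equalityI) (auto simp: len del skip_def assms)
qed

definition position :: "'v list \<Rightarrow> 'v \<Rightarrow> nat" where
  "position w x = (THE j. j < length w \<and> w ! j = x)"

lemma position_nth: "distinct w \<Longrightarrow> j < length w \<Longrightarrow> position w (w ! j) = j"
  unfolding position_def by (rule the_equality) (auto simp: nth_eq_iff_index_eq)

lemma position_bound: "distinct w \<Longrightarrow> x \<in> set w \<Longrightarrow> position w x < length w \<and> w ! position w x = x"
  by (metis in_set_conv_nth position_nth)

lemma position_image: "distinct w \<Longrightarrow> length w = Suc n \<Longrightarrow> position w ` set w = {..n}"
proof -
  assume w: "distinct w" "length w = Suc n"
  have "j \<in> position w ` set w" if "j \<le> n" for j
    using position_nth[OF w(1), of j] that w by (intro image_eqI[of _ _ "w ! j"]) auto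
  then show ?thesis using position_bound[OF w(1)] w by (auto simp: less_Suc_eq_le)
qed

lemma position_delete_nth:
  assumes "distinct w" "k < length w" "x \<in> set (delete_nth k w)"
  shows "position w x = skip k (position (delete_nth k w) x)"
proof -
  let ?d = "delete_nth k w"
  have d: "distinct ?d" by (rule distinct_delete_nth[OF assms(1,2)])
  have p: "position ?d x < length w - 1" "?d ! position ?d x = x"
    using position_bound[OF d assms(3)] length_delete_nth[OF assms(2)] by auto
  then have "w ! skip k (position ?d x) = x" using nth_delete_nth[OF assms(2) p(1)] by simp
  moreover have "skip k (position ?d x) < length w" using p(1) by (auto simp: skip_def)
  ultimately show ?thesis using position_nth[OF assms(1)] by metis
qed

lemma nth_image_set: "length w = Suc n \<Longrightarrow> (!) w ` {..n} = set w"
  by (auto simp: set_conv_nth less_Suc_eq_le)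

lemma simplical_face_push:
  assumes "q \<in> affine_simplex {..n}" "k \<le> Suc n"
  shows "simplical_face k q = push (skip k) {..n} q"
proof
  fix i
  have "{j. j \<in> {..n} \<and> skip k j = i}
      = (if i < k then {i} \<inter> {..n} else if i = k then {} else {i - 1} \<inter> {..n})"
    by (auto simp: skip_def)
  then show "simplical_face k q i = push (skip k) {..n} q i"
    using assms by (auto simp: simplical_face_def push_def affine_simplex_def Int_insert_left)
qed

lemma push_nth_simplical_face:
  assumes "length w = Suc (Suc n)" "k \<le> Suc n" "q \<in> affine_simplex {..n}"
  shows "push ((!) w) {..Suc n} (simplical_face k q) = push ((!) (delete_nth k w)) {..n} q"
proof -
  have "push ((!) w) {..Suc n} (push (skip k) {..n} q) = push ((!) w \<circ> skip k) {..n} q"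
    by (rule push_push) (auto simp: skip_def)
  also have "\<dots> = push ((!) (delete_nth k w)) {..n} q"
    by (rule push_cong) (use assms in \<open>simp add: nth_delete_nth\<close>)
  finally show ?thesis by (simp only: simplical_face_push[OF assms(3,2)])
qed

lemma push_position_delete_nth:
  assumes w: "distinct w" "length w = Suc (Suc n)" and k: "k \<le> Suc n"
    and t: "t \<in> affine_simplex (set (delete_nth k w))"
  shows "push (position w) (set w) t = simplical_face k (push (position (delete_nth k w)) (set (delete_nth k w)) t)"
proof -
  let ?d = "delete_nth k w"
  have k': "k < length w" using w k by simp
  have d: "distinct ?d" "length ?d = Suc n" using distinct_delete_nth[OF w(1) k'] length_delete_nth[OF k'] w by auto
  have pos: "position ?d ` set ?d = {..n}" by (rule position_image[OF d])
  have "push (position w) (set w) t = push (position w) (set ?d) t"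
    by (rule push_superset[symmetric]) (use t set_delete_nth[of k w] in \<open>auto simp: affine_simplex_def\<close>)
  also have "\<dots> = push (skip k \<circ> position ?d) (set ?d) t"
    by (rule push_cong) (simp add: position_delete_nth[OF w(1) k'])
  also have "\<dots> = push (skip k) {..n} (push (position ?d) (set ?d) t)"
    by (rule push_push[symmetric]) (use pos in auto)
  also have "\<dots> = simplical_face k (push (position ?d) (set ?d) t)"
    by (rule simplical_face_push[symmetric]) (use push_in_affine_simplex[OF _ t, of "position ?d"] pos k in auto)
  finally show ?thesis .
qed

lemma push_position_nth:
  assumes w: "distinct w" "length w = Suc n" and q: "q \<in> affine_simplex {..n}"
  shows "push (position w) (set w) (push ((!) w) {..n} q) = q"
proof -
  have "push (position w) (set w) (push ((!) w) {..n} q) = push (position w \<circ> (!) w) {..n} q"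
    by (rule push_push) (use nth_image_set[OF w(2)] in auto)
  also have "\<dots> = push id {..n} q" by (rule push_cong) (use w in \<open>simp add: position_nth\<close>)
  finally show ?thesis using push_id[OF q] by simp
qed

lemma sum_simplical_face:
  fixes t :: "nat \<Rightarrow> real"
  shows "k \<le> i \<Longrightarrow> (\<Sum>j\<le>i. simplical_face k t j) = (\<Sum>j<i. t j)"
    and "i < k \<Longrightarrow> (\<Sum>j\<le>i. simplical_face k t j) = (\<Sum>j\<le>i. t j)"
proof -
  show "i < k \<Longrightarrow> (\<Sum>j\<le>i. simplical_face k t j) = (\<Sum>j\<le>i. t j)"
    by (intro sum.cong) (auto simp: simplical_face_def)
  show "k \<le> i \<Longrightarrow> (\<Sum>j\<le>i. simplical_face k t j) = (\<Sum>j<i. t j)"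
  proof (induction i)
    case (Suc i)
    show ?case
    proof (cases "k \<le> i")
      case False
      then have "k = Suc i" using Suc by simp
      then have "(\<Sum>j\<le>i. simplical_face k t j) = (\<Sum>j\<le>i. t j)" by (intro sum.cong) (auto simp: simplical_face_def)
      then show ?thesis using \<open>k = Suc i\<close> by (simp add: simplical_face_def lessThan_Suc_atMost)
    qed (use Suc in \<open>simp add: simplical_face_def\<close>)
  qed (simp add: simplical_face_def)
qed

section \<open>The two cell systems\<close>

lemma cells_singular_system: "cells (singular_system Y) n = {s. singular_simplex n Y s}"
  and face_singular_system: "face (singular_system Y) = singular_face"
  and cells_algebraic_system: "(\<sigma>, vs) \<in> cells (algebraic_system K) n \<longleftrightarrow> length vs = Suc n \<and> \<sigma> \<in> simps K (set vs)"
  and face_algebraic_system: "face (algebraic_system K) n i (\<sigma>, vs)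
    = (bdry K (set vs) (set (delete_nth i vs)) \<sigma>, delete_nth i vs)"
  by (simp_all add: singular_system_def algebraic_system_def)

lemma simplicial_faces_singular_system: "simplicial_faces (singular_system Y)"
proof -
  have "singular_face (Suc n) j (singular_face (Suc (Suc n)) i s) = singular_face (Suc n) i (singular_face (Suc (Suc n)) (Suc j) s)"
    if "i \<le> j" "j \<le> Suc n" for n i j and s :: "(nat \<Rightarrow> real) \<Rightarrow> 'a"
  proof
    fix t
    show "singular_face (Suc n) j (singular_face (Suc (Suc n)) i s) t
        = singular_face (Suc n) i (singular_face (Suc (Suc n)) (Suc j) s) t"
    proof (cases "t \<in> standard_simplex n")
      case True
      then have in_: "simplical_face j t \<in> standard_simplex (Suc n)" "simplical_face i t \<in> standard_simplex (Suc n)"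
        using simplical_face_in_standard_simplex[of "Suc n" _ t] that by auto
      have "simplical_face i (simplical_face j t) = simplical_face (Suc j) (simplical_face i t)"
        by (rule ext) (use that in \<open>auto simp: simplical_face_def\<close>)
      then show ?thesis using True in_ by (simp add: singular_face_def)
    qed (simp add: singular_face_def)
  qed
  then show ?thesis
    by (auto simp: simplicial_faces_def closed_faces_def cells_singular_system face_singular_system
        intro: singular_simplex_singular_face[of "Suc n" for n, simplified])
qed

lemma simplicial_faces_algebraic_system:
  assumes K: "multicomplex K"
  shows "simplicial_faces (algebraic_system K)"
proof -
  have ne: "set (delete_nth i vs) \<noteq> {}" if "length vs = Suc (Suc n)" "i \<le> Suc n" for i n and vs :: "'a list"
    using length_delete_nth[of i vs] that by auto
  have "closed_faces (algebraic_system K)"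
    unfolding closed_faces_def
  proof (intro allI impI)
    fix n i and c :: "'b \<times> 'a list" assume c: "c \<in> cells (algebraic_system K) (Suc n)" and i: "i \<le> Suc n"
    obtain \<sigma> vs where e: "c = (\<sigma>, vs)" by (cases c)
    then have vs: "length vs = Suc (Suc n)" "\<sigma> \<in> simps K (set vs)" using c by (simp_all add: cells_algebraic_system)
    show "face (algebraic_system K) (Suc n) i c \<in> cells (algebraic_system K) n"
      using simplex_face[OF K vs(2) set_delete_nth ne[OF vs(1) i]] vs(1) i
      by (simp add: e face_algebraic_system cells_algebraic_system length_delete_nth)
  qed
  moreover have "face (algebraic_system K) (Suc n) j (face (algebraic_system K) (Suc (Suc n)) i c)
      = face (algebraic_system K) (Suc n) i (face (algebraic_system K) (Suc (Suc n)) (Suc j) c)"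
    if c: "c \<in> cells (algebraic_system K) (Suc (Suc n))" and ij: "i \<le> j" "j \<le> Suc n" for n i j and c :: "'b \<times> 'a list"
  proof -
    obtain \<sigma> vs where e: "c = (\<sigma>, vs)" by (cases c)
    then have vs: "length vs = Suc (Suc (Suc n))" "\<sigma> \<in> simps K (set vs)" using c by (simp_all add: cells_algebraic_system)
    have d: "delete_nth j (delete_nth i vs) = delete_nth i (delete_nth (Suc j) vs)"
      by (rule delete_nth_delete_nth) (use vs ij in auto)
    have "length (delete_nth i vs) = Suc (Suc n)" "length (delete_nth (Suc j) vs) = Suc (Suc n)"
      using vs ij by (simp_all add: length_delete_nth)
    note ne' = ne[OF this(1) ij(2)]
    show ?thesis
      using simplex_face_face[OF K vs(2) set_delete_nth set_delete_nth ne']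
        simplex_face_face[OF K vs(2) set_delete_nth[of "Suc j" vs], of "set (delete_nth i (delete_nth (Suc j) vs))"]
        set_delete_nth[of i "delete_nth (Suc j) vs"] ne' d
      by (simp add: e face_algebraic_system)
  qed
  ultimately show ?thesis by (simp add: simplicial_faces_def)
qed

lemma canonical_simplex_eq:
  assumes "t \<in> standard_simplex n"
  shows "canonical_simplex K n (\<sigma>, vs) t = glue_class K ((set vs, \<sigma>), push ((!) vs) {..n} t)"
  using assms by (simp add: canonical_simplex_def push_def)

lemma canonical_simplex_cell:
  assumes K: "multicomplex K" and c: "c \<in> cells (algebraic_system K) n"
  shows "canonical_simplex K n c \<in> cells (singular_system (realization K)) n"
proof -
  obtain \<sigma> vs where e: "c = (\<sigma>, vs)" by (cases c)
  then have vs: "length vs = Suc n" "\<sigma> \<in> simps K (set vs)" using c by (simp_all add: cells_algebraic_system)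
  have "continuous_map (simplex_space {..n}) (simplex_space (set vs)) (push ((!) vs) {..n})"
    using continuous_map_push_simplex[of "{..n}" "(!) vs"] nth_image_set[OF vs(1)] by simp
  from continuous_map_compose[OF this continuous_map_cell[OF K vs(2)]]
  have "continuous_map (simplex_space {..n}) (realization K) (canonical_simplex K n c)"
    by (rule continuous_map_eq) (simp add: e canonical_simplex_eq standard_simplex_affine)
  moreover have "canonical_simplex K n c \<in> extensional (standard_simplex n)"
    by (simp add: e canonical_simplex_def)
  ultimately show ?thesis by (simp add: cells_singular_system singular_simplex_def standard_simplex_affine)
qed

lemma canonical_simplex_face:
  assumes K: "multicomplex K" and c: "c \<in> cells (algebraic_system K) (Suc n)" and k: "k \<le> Suc n"
  shows "face (singular_system (realization K)) (Suc n) k (canonical_simplex K (Suc n) c)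
    = canonical_simplex K n (face (algebraic_system K) (Suc n) k c)"
proof
  fix t
  obtain \<sigma> vs where e: "c = (\<sigma>, vs)" by (cases c)
  then have vs: "length vs = Suc (Suc n)" "\<sigma> \<in> simps K (set vs)" using c by (simp_all add: cells_algebraic_system)
  have ld: "length (delete_nth k vs) = Suc n" using vs k by (simp add: length_delete_nth)
  show "face (singular_system (realization K)) (Suc n) k (canonical_simplex K (Suc n) c) t
    = canonical_simplex K n (face (algebraic_system K) (Suc n) k c) t"
  proof (cases "t \<in> standard_simplex n")
    case True
    then have f: "simplical_face k t \<in> standard_simplex (Suc n)"
      using simplical_face_in_standard_simplex[of "Suc n" k t] k by simp
    have t: "t \<in> affine_simplex {..n}" using True by (simp add: standard_simplex_affine)
    have "push ((!) (delete_nth k vs)) {..n} t \<in> affine_simplex (set (delete_nth k vs))"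
      using push_in_affine_simplex[OF _ t, of "(!) (delete_nth k vs)"] nth_image_set[OF ld] by simp
    moreover have "set (delete_nth k vs) \<noteq> {}" using ld by auto
    ultimately show ?thesis
      using True f glue_class_face[OF K vs(2) set_delete_nth, of k]
      by (simp add: e face_singular_system singular_face_def face_algebraic_system canonical_simplex_eq
          push_nth_simplical_face[OF vs(1) k t])
  next
    case False
    then show ?thesis by (simp add: e face_singular_system singular_face_def face_algebraic_system canonical_simplex_def)
  qed
qed

section \<open>Straightening labelled singular simplices\<close>

definition relabel :: "'v list \<Rightarrow> ((nat \<Rightarrow> real) \<Rightarrow> 'p) \<Rightarrow> ('v \<Rightarrow> real) \<Rightarrow> 'p" where
  "relabel w s = restrict (\<lambda>t. s (push (position w) (set w) t)) (affine_simplex (set w))"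

definition straight_cell ::
  "('v, 's) multicomplex \<Rightarrow> ((nat \<Rightarrow> real) \<Rightarrow> ('v, 's) pre_point set) \<Rightarrow> 'v list \<Rightarrow> 's \<times> 'v list" where
  "straight_cell K s w = (straight_simplex K (set w) (relabel w s), w)"

definition simplex_vertices ::
  "('v, 's) multicomplex \<Rightarrow> ((nat \<Rightarrow> real) \<Rightarrow> ('v, 's) pre_point set) \<Rightarrow> 'v set" where
  "simplex_vertices K s = component_vertices K (s (corner 0))"

text \<open>
  The mean depends on \<open>s\<close> only through its component, so faces of \<open>s\<close> have the same mean as \<open>s\<close>.
\<close>

definition simplex_mean ::
  "('v, 's) multicomplex \<Rightarrow> ((nat \<Rightarrow> real) \<Rightarrow> ('v, 's) pre_point set) \<Rightarrow> ('v \<Rightarrow> real) \<Rightarrow> real" where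
  "simplex_mean K s = (SOME m. vertex_mean (simplex_vertices K s) m)"

lemma singular_simplex_points:
  assumes s: "singular_simplex n Y s" and "t \<in> affine_simplex {..n}" "u \<in> affine_simplex {..n}"
  shows "path_component_of Y (s t) (s u)"
proof -
  have "path_connectedin (simplex_space {..n}) (affine_simplex {..n})"
    using path_connectedin_standard_simplex[of n]
    by (simp add: path_connectedin_subtopology standard_simplex_affine)
  moreover have "continuous_map (simplex_space {..n}) Y s"
    using s by (simp add: singular_simplex_def standard_simplex_affine)
  ultimately have "path_connectedin Y (s ` affine_simplex {..n})" by (rule path_connectedin_continuous_map_image[rotated])
  then show ?thesis unfolding path_component_of using assms by blast
qed

lemma simplex_vertices_face:
  assumes s: "singular_simplex (Suc n) (realization K) s" and k: "k \<le> Suc n"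
  shows "simplex_vertices K (singular_face (Suc n) k s) = simplex_vertices K s"
proof -
  have c: "corner 0 \<in> affine_simplex {..m}" for m :: nat by (rule corner_in_affine_simplex) auto
  have "simplical_face k (corner 0) \<in> affine_simplex {..Suc n}"
    using simplical_face_in_standard_simplex[of "Suc n" k "corner 0"] k c[of n] by (simp add: standard_simplex_affine)
  then have "path_component_of (realization K) (s (simplical_face k (corner 0))) (s (corner 0))"
    by (rule singular_simplex_points[OF s _ c])
  then show ?thesis
    using component_vertices_eq c[of n] by (simp add: simplex_vertices_def singular_face_def standard_simplex_affine)
qed

lemma relabel_face:
  assumes w: "distinct w" "length w = Suc (Suc n)" and k: "k \<le> Suc n"
  shows "restrict (relabel w s) (affine_simplex (set (delete_nth k w))) = relabel (delete_nth k w) (singular_face (Suc n) k s)"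
proof
  fix t
  let ?d = "delete_nth k w"
  have d: "distinct ?d" "length ?d = Suc n" using distinct_delete_nth(1)[of w k] length_delete_nth[of k w] w k by auto
  show "restrict (relabel w s) (affine_simplex (set ?d)) t = relabel ?d (singular_face (Suc n) k s) t"
  proof (cases "t \<in> affine_simplex (set ?d)")
    case True
    then have "t \<in> affine_simplex (set w)" using affine_simplex_mono[of "set w" "set ?d"] set_delete_nth[of k w] by auto
    moreover have "push (position ?d) (set ?d) t \<in> affine_simplex {..n}"
      using push_in_affine_simplex[OF _ True, of "position ?d"] position_image[OF d] by simp
    ultimately show ?thesis
      using True push_position_delete_nth[OF w k True]
      by (simp add: relabel_def singular_face_def standard_simplex_affine)
  qed (simp add: relabel_def)
qed

text \<open>
  The straightening homotopy on the \<open>i\<close>-th simplex of the triangulated prism. The time \<open>1 - (\<Sum>j\<le>i. t j)\<close> is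
  the total weight of the vertices on top; in this form it does not depend on \<open>n\<close>.
\<close>

definition singular_prism ::
  "('v, 's) multicomplex \<Rightarrow> nat \<Rightarrow> nat \<Rightarrow> ((nat \<Rightarrow> real) \<Rightarrow> ('v, 's) pre_point set) \<Rightarrow> 'v list \<Rightarrow>
    (nat \<Rightarrow> real) \<Rightarrow> ('v, 's) pre_point set" where
  "singular_prism K n i s w = restrict (\<lambda>t. straighten K (set w) (relabel w s)
     (push ((!) (prism_list i w w)) {..Suc n} t, 1 - (\<Sum>j\<le>i. t j))) (standard_simplex (Suc n))"

definition collapse :: "'v list \<Rightarrow> 'v list \<Rightarrow> 'v \<Rightarrow> 'v" where
  "collapse v w x = (if x \<in> set v then x else v ! position w x)"

text \<open>
  The realization of \<open>\<sigma>\<close>, spread over a simplex with the additional vertices \<open>w\<close> by collapsing them to \<open>v\<close>. On \<open>v\<close> it is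
  \<open>\<sigma>\<close>, and on \<open>w\<close> it is the canonical singular simplex of \<open>(\<sigma>, v)\<close> labelled by \<open>w\<close>. Entries of \<open>v\<close> may repeat,
  while those of \<open>w\<close> are distinct.
\<close>

definition join_singular ::
  "('v, 's) multicomplex \<Rightarrow> 's \<Rightarrow> 'v list \<Rightarrow> 'v list \<Rightarrow> ('v \<Rightarrow> real) \<Rightarrow> ('v, 's) pre_point set" where
  "join_singular K \<sigma> v w = restrict
     (\<lambda>t. glue_class K ((set v, \<sigma>), push (collapse v w) (set v \<union> set w) t)) (affine_simplex (set v \<union> set w))"

definition join_simplex :: "('v, 's) multicomplex \<Rightarrow> 's \<Rightarrow> 'v list \<Rightarrow> 'v list \<Rightarrow> 's" where
  "join_simplex K \<sigma> v w = straight_simplex K (set v \<union> set w) (join_singular K \<sigma> v w)"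

definition algebraic_prism ::
  "('v, 's) multicomplex \<Rightarrow> nat \<Rightarrow> 's \<times> 'v list \<Rightarrow> 'v list \<Rightarrow> 's \<times> 'v list" where
  "algebraic_prism K i = (\<lambda>(\<sigma>, v) w.
     (bdry K (set v \<union> set w) (set (prism_list i v w)) (join_simplex K \<sigma> v w), prism_list i v w))"

context
  fixes K :: "('v, 's) multicomplex"
  assumes K: "multicomplex K" and complete: "complete_multicomplex K" and large: "large_multicomplex K"
begin

abbreviation "SX \<equiv> singular_system (realization K)"
abbreviation "AX \<equiv> algebraic_system K"

lemma simplex_mean:
  assumes s: "s \<in> cells SX n"
  shows "vertex_mean (simplex_vertices K s) (simplex_mean K s)"
proof -
  have "corner 0 \<in> affine_simplex {..n}" by (rule corner_in_affine_simplex) auto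
  then have "s (corner 0) \<in> topspace (realization K)"
    using singular_simplex_points[of n "realization K" s "corner 0" "corner 0"] s
    by (auto simp: cells_singular_system path_component_of_refl)
  then have "infinite (simplex_vertices K s)"
    unfolding simplex_vertices_def by (rule infinite_component_vertices[OF K large])
  from vertex_mean_exists[OF this] show ?thesis unfolding simplex_mean_def by (rule someI_ex)
qed

lemma simplex_mean_face:
  "s \<in> cells SX (Suc n) \<Longrightarrow> k \<le> Suc n \<Longrightarrow> simplex_mean K (face SX (Suc n) k s) = simplex_mean K s"
  by (simp add: simplex_mean_def cells_singular_system face_singular_system simplex_vertices_face)

lemma labelled_relabel:
  assumes s: "s \<in> cells SX n" and w: "w \<in> generic_lists (simplex_vertices K s) F (Suc n)"
  shows "labelled_simplex K (set w) (relabel w s)"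
proof -
  have s': "singular_simplex n (realization K) s" using s by (simp add: cells_singular_system)
  have d: "distinct w" "length w = Suc n" "set w \<subseteq> simplex_vertices K s" using w by (auto simp: generic_lists_def)
  have "continuous_map (simplex_space (set w)) (simplex_space {..n}) (push (position w) (set w))"
    using continuous_map_push_simplex[of "set w" "position w"] position_image[OF d(1,2)] by simp
  moreover have "continuous_map (simplex_space {..n}) (realization K) s"
    using s' by (simp add: singular_simplex_def standard_simplex_affine)
  ultimately have "continuous_map (simplex_space (set w)) (realization K) (s \<circ> push (position w) (set w))"
    by (rule continuous_map_compose)
  then have "continuous_map (simplex_space (set w)) (realization K) (relabel w s)"
    by (rule continuous_map_eq) (simp add: relabel_def)
  moreover have "path_component_of (realization K) (relabel w s (corner a)) (vertex_point K a)" if a: "a \<in> set w" for a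
  proof -
    have "position w a \<le> n" using position_bound[OF d(1) a] d(2) by simp
    then have c: "corner (position w a) \<in> affine_simplex {..n}" "corner 0 \<in> affine_simplex {..n}"
      by (auto intro: corner_in_affine_simplex)
    have "relabel w s (corner a) = s (corner (position w a))"
      using corner_in_affine_simplex[OF _ a] a by (simp add: relabel_def push_corner)
    moreover have "path_component_of (realization K) (s (corner 0)) (vertex_point K a)"
      using a d(3) by (auto simp: simplex_vertices_def component_vertices_def)
    ultimately show ?thesis using singular_simplex_points[OF s' c] path_component_of_trans by metis
  qed
  moreover have "set w \<subseteq> verts K" using d(3) by (auto simp: simplex_vertices_def component_vertices_def)
  ultimately show ?thesis using d(2) by (auto simp: labelled_simplex_def)
qed

lemma straight_cell_cell:
  assumes "s \<in> cells SX n" "w \<in> generic_lists (simplex_vertices K s) F (Suc n)"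
  shows "straight_cell K s w \<in> cells AX n"
  using straight_simplex(1)[OF K complete labelled_relabel[OF assms]] assms(2)
  by (simp add: straight_cell_def cells_algebraic_system generic_lists_def)

lemma delete_nth_psubset:
  assumes "distinct w" "length w = Suc (Suc n)" "k \<le> Suc n"
  shows "set (delete_nth k w) \<subset> set w" "set (delete_nth k w) \<noteq> {}"
proof -
  have "w ! k \<in> set w" "set (delete_nth k w) = set w - {w ! k}"
    using assms by (simp_all add: distinct_delete_nth(2))
  then show "set (delete_nth k w) \<subset> set w" by blast
  show "set (delete_nth k w) \<noteq> {}" using length_delete_nth[of k w] assms by auto
qed

lemma straight_cell_face:
  assumes s: "s \<in> cells SX (Suc n)" and w: "w \<in> generic_lists (simplex_vertices K s) F (Suc (Suc n))" and k: "k \<le> Suc n"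
  shows "face AX (Suc n) k (straight_cell K s w) = straight_cell K (face SX (Suc n) k s) (delete_nth k w)"
proof -
  have d: "distinct w" "length w = Suc (Suc n)" using w by (auto simp: generic_lists_def)
  show ?thesis
    using straight_simplex_face[OF K complete labelled_relabel[OF s w] delete_nth_psubset[OF d k]]
    by (simp add: straight_cell_def face_algebraic_system face_singular_system relabel_face[OF d k])
qed

section \<open>Prisms over singular simplices\<close>

lemma prism_coordinates:
  assumes w: "length w = Suc n" and i: "i \<le> n" and t: "t \<in> affine_simplex {..Suc n}"
  shows "push ((!) (prism_list i w w)) {..Suc n} t \<in> affine_simplex (set w)" "1 - (\<Sum>j\<le>i. t j) \<in> {0..1}"
proof -
  have "push ((!) (prism_list i w w)) {..Suc n} t \<in> affine_simplex (set (prism_list i w w))"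
    using push_in_affine_simplex[OF _ t, of "(!) (prism_list i w w)"] nth_image_set[OF length_prism_list[OF w w i]] by simp
  moreover have "affine_simplex (set (prism_list i w w)) \<subseteq> affine_simplex (set w)"
    using set_prism_list[of i w w] by (intro affine_simplex_mono) auto
  ultimately show "push ((!) (prism_list i w w)) {..Suc n} t \<in> affine_simplex (set w)" by blast
  have "(\<Sum>j\<le>i. t j) \<le> (\<Sum>j\<le>Suc n. t j)"
    using t i by (intro sum_mono2) (auto simp: affine_simplex_def)
  moreover have "0 \<le> (\<Sum>j\<le>i. t j)" using t by (intro sum_nonneg) (auto simp: affine_simplex_def)
  ultimately show "1 - (\<Sum>j\<le>i. t j) \<in> {0..1}" using t by (simp add: affine_simplex_def)
qed

lemma singular_prism_cell:
  assumes s: "s \<in> cells SX n" and w: "w \<in> generic_lists (simplex_vertices K s) F (Suc n)" and i: "i \<le> n"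
  shows "singular_prism K n i s w \<in> cells SX (Suc n)"
proof -
  have d: "distinct w" "length w = Suc n" using w by (auto simp: generic_lists_def)
  let ?p = "\<lambda>t :: nat \<Rightarrow> real. (push ((!) (prism_list i w w)) {..Suc n} t, 1 - (\<Sum>j\<le>i. t j))"
  have "continuous_map (simplex_space {..Suc n}) (simplex_space (set w)) (push ((!) (prism_list i w w)) {..Suc n})"
    using prism_coordinates(1)[OF d(2) i] continuous_map_push by (auto simp: continuous_map_in_subtopology)
  moreover have "continuous_map (simplex_space {..Suc n}) euclideanreal (\<lambda>t. 1 - (\<Sum>j\<le>i. t j))"
    by (intro continuous_intros continuous_map_from_subtopology continuous_map_product_coordinates) auto
  then have "continuous_map (simplex_space {..Suc n}) (top_of_set {0..1}) (\<lambda>t. 1 - (\<Sum>j\<le>i. t j))"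
    using prism_coordinates(2)[OF d(2) i] by (auto simp: continuous_map_in_subtopology)
  ultimately have "continuous_map (simplex_space {..Suc n}) (cylinder (set w)) ?p"
    by (rule continuous_map_pairedI)
  moreover have "continuous_map (cylinder (set w)) (realization K) (straighten K (set w) (relabel w s))"
    using straighten_correct(1)[OF K complete labelled_relabel[OF s w]] by (simp add: straightening_def)
  ultimately have "continuous_map (simplex_space {..Suc n}) (realization K) (straighten K (set w) (relabel w s) \<circ> ?p)"
    by (rule continuous_map_compose)
  then have "continuous_map (simplex_space {..Suc n}) (realization K) (singular_prism K n i s w)"
    by (rule continuous_map_eq) (simp add: singular_prism_def standard_simplex_affine)
  then show ?thesis
    by (simp add: cells_singular_system singular_simplex_def standard_simplex_affine singular_prism_def)
qed

lemma singular_prism_face: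
  assumes w: "length w = Suc n" and i: "i \<le> n" and k: "k \<le> Suc n" and t: "t \<in> standard_simplex n"
  shows "face SX (Suc n) k (singular_prism K n i s w) t
    = straighten K (set w) (relabel w s) (push ((!) (delete_nth k (prism_list i w w))) {..n} t,
        1 - (if k \<le> i then \<Sum>j<i. t j else \<Sum>j\<le>i. t j))"
proof -
  have t': "t \<in> affine_simplex {..n}" using t by (simp add: standard_simplex_affine)
  have "simplical_face k t \<in> standard_simplex (Suc n)"
    using simplical_face_in_standard_simplex[of "Suc n" k t] k t by simp
  then show ?thesis
    using t push_nth_simplical_face[OF length_prism_list[OF w w i] k t'] sum_simplical_face(1)[of k i t] sum_simplical_face(2)[of i k t]
    by (simp add: face_singular_system singular_face_def singular_prism_def)
qed

lemma face_restrict: "t \<notin> standard_simplex n \<Longrightarrow> face SX (Suc n) k s t = undefined"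
  by (simp add: face_singular_system singular_face_def)

lemma singular_prism_delete:
  assumes s: "s \<in> cells SX (Suc n)" and w: "w \<in> generic_lists (simplex_vertices K s) F (Suc (Suc n))"
    and k: "k \<le> Suc n" and i: "i \<le> n" and t: "t \<in> standard_simplex (Suc n)"
  shows "singular_prism K n i (face SX (Suc n) k s) (delete_nth k w) t
    = straighten K (set w) (relabel w s) (push ((!) (prism_list i (delete_nth k w) (delete_nth k w))) {..Suc n} t, 1 - (\<Sum>j\<le>i. t j))"
proof -
  have d: "distinct w" "length w = Suc (Suc n)" using w by (auto simp: generic_lists_def)
  let ?d = "delete_nth k w"
  have ld: "length ?d = Suc n" using d k by (simp add: length_delete_nth)
  have t': "t \<in> affine_simplex {..Suc n}" using t by (simp add: standard_simplex_affine)
  show ?thesis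
    using straighten_correct(2)[OF K complete labelled_relabel[OF s w] delete_nth_psubset[OF d k] prism_coordinates[OF ld i t']] t
    by (simp add: singular_prism_def relabel_face[OF d k] face_singular_system)
qed

lemma singular_prism_homotopy:
  fixes F :: "'v set"
  shows "s \<in> cells SX (Suc n) \<Longrightarrow> w \<in> generic_lists (simplex_vertices K s) F (Suc (Suc n)) \<Longrightarrow> k \<le> i \<Longrightarrow> i \<le> n \<Longrightarrow>
      face SX (Suc (Suc n)) k (singular_prism K (Suc n) (Suc i) s w) = singular_prism K n i (face SX (Suc n) k s) (delete_nth k w)"
    and "s \<in> cells SX (Suc n) \<Longrightarrow> w \<in> generic_lists (simplex_vertices K s) F (Suc (Suc n)) \<Longrightarrow> i < k \<Longrightarrow> k \<le> Suc n \<Longrightarrow>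
      face SX (Suc (Suc n)) (Suc k) (singular_prism K (Suc n) i s w) = singular_prism K n i (face SX (Suc n) k s) (delete_nth k w)"
    and "s \<in> cells SX n \<Longrightarrow> w \<in> generic_lists (simplex_vertices K s) F (Suc n) \<Longrightarrow> i < n \<Longrightarrow>
      face SX (Suc n) (Suc i) (singular_prism K n (Suc i) s w) = face SX (Suc n) (Suc i) (singular_prism K n i s w)"
    and "s \<in> cells SX n \<Longrightarrow> w \<in> generic_lists (simplex_vertices K s) F (Suc n) \<Longrightarrow>
      face SX (Suc n) 0 (singular_prism K n 0 s w) = canonical_simplex K n (straight_cell K s w)"
    and "s \<in> cells SX n \<Longrightarrow> w \<in> generic_lists (simplex_vertices K s) F (Suc n) \<Longrightarrow>
      face SX (Suc n) (Suc n) (singular_prism K n n s w) = s"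
proof -
  have off: "singular_prism K m i s w t = undefined" if "t \<notin> standard_simplex (Suc m)" for m i s w t
    using that by (simp add: singular_prism_def)
  {
    assume s: "s \<in> cells SX (Suc n)" and w: "w \<in> generic_lists (simplex_vertices K s) F (Suc (Suc n))"
    then have l: "length w = Suc (Suc n)" by (simp add: generic_lists_def)
    show "face SX (Suc (Suc n)) k (singular_prism K (Suc n) (Suc i) s w) = singular_prism K n i (face SX (Suc n) k s) (delete_nth k w)"
      if "k \<le> i" "i \<le> n"
    proof
      fix t
      show "face SX (Suc (Suc n)) k (singular_prism K (Suc n) (Suc i) s w) t = singular_prism K n i (face SX (Suc n) k s) (delete_nth k w) t"
      proof (cases "t \<in> standard_simplex (Suc n)")
        case True
        show ?thesis
          using singular_prism_face[OF l, of "Suc i" k t s] singular_prism_delete[OF s w, of k i t]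
            delete_nth_prism_list(1)[OF l l refl that] that True
          by (simp add: lessThan_Suc_atMost)
      qed (simp add: face_restrict off)
    qed
    show "face SX (Suc (Suc n)) (Suc k) (singular_prism K (Suc n) i s w) = singular_prism K n i (face SX (Suc n) k s) (delete_nth k w)"
      if "i < k" "k \<le> Suc n"
    proof
      fix t
      show "face SX (Suc (Suc n)) (Suc k) (singular_prism K (Suc n) i s w) t = singular_prism K n i (face SX (Suc n) k s) (delete_nth k w) t"
      proof (cases "t \<in> standard_simplex (Suc n)")
        case True
        show ?thesis
          using singular_prism_face[OF l, of i "Suc k" t s] singular_prism_delete[OF s w, of k i t]
            delete_nth_prism_list(2)[OF l l refl that] that True
          by simp
      qed (simp add: face_restrict off)
    qed
  }
  {
    assume s: "s \<in> cells SX n" and w: "w \<in> generic_lists (simplex_vertices K s) F (Suc n)"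
    then have l: "length w = Suc n" and d: "distinct w" by (simp_all add: generic_lists_def)
    note lab = labelled_relabel[OF s w]
    have spread: "push ((!) w) {..n} t \<in> affine_simplex (set w)" if "t \<in> standard_simplex n" for t
      using push_in_affine_simplex[of "{..n}" t "(!) w"] that nth_image_set[OF l] by (simp add: standard_simplex_affine)
    show "face SX (Suc n) (Suc i) (singular_prism K n (Suc i) s w) = face SX (Suc n) (Suc i) (singular_prism K n i s w)"
      if "i < n"
    proof
      fix t
      show "face SX (Suc n) (Suc i) (singular_prism K n (Suc i) s w) t = face SX (Suc n) (Suc i) (singular_prism K n i s w) t"
      proof (cases "t \<in> standard_simplex n")
        case True
        show ?thesis
          using singular_prism_face[OF l, of "Suc i" "Suc i" t s] singular_prism_face[OF l, of i "Suc i" t s]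
            delete_nth_prism_list(3)[OF l l that] that True
          by (simp add: lessThan_Suc_atMost)
      qed (simp add: face_restrict)
    qed
    show "face SX (Suc n) 0 (singular_prism K n 0 s w) = canonical_simplex K n (straight_cell K s w)"
    proof
      fix t
      show "face SX (Suc n) 0 (singular_prism K n 0 s w) t = canonical_simplex K n (straight_cell K s w) t"
      proof (cases "t \<in> standard_simplex n")
        case True
        show ?thesis
          using singular_prism_face[OF l, of 0 0 t s] delete_nth_prism_list(4)[OF l l] True
            straight_simplex(2)[OF K complete lab spread[OF True]]
          by (simp add: straight_cell_def canonical_simplex_eq)
      qed (simp add: face_restrict straight_cell_def canonical_simplex_def)
    qed
    show "face SX (Suc n) (Suc n) (singular_prism K n n s w) = s"
    proof
      fix t
      show "face SX (Suc n) (Suc n) (singular_prism K n n s w) t = s t"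
      proof (cases "t \<in> standard_simplex n")
        case True
        then have t: "t \<in> affine_simplex {..n}" by (simp add: standard_simplex_affine)
        then have "(\<Sum>j\<le>n. t j) = 1" by (simp add: affine_simplex_def)
        then have "face SX (Suc n) (Suc n) (singular_prism K n n s w) t
            = straighten K (set w) (relabel w s) (push ((!) w) {..n} t, 0)"
          using singular_prism_face[OF l, of n "Suc n" t s] delete_nth_prism_list(5)[OF l l] True by simp
        also have "\<dots> = relabel w s (push ((!) w) {..n} t)"
          using straighten_correct(1)[OF K complete lab] spread[OF True] by (simp add: straightening_def)
        also have "\<dots> = s t" using spread[OF True] push_position_nth[OF d l t] by (simp add: relabel_def)
        finally show ?thesis .
      next
        case False
        then show ?thesis
          using s by (simp add: face_restrict cells_singular_system singular_simplex_def extensional_def)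
      qed
    qed
  }
qed

section \<open>Prisms over algebraic simplices\<close>

lemma generic_listsD:
  assumes "w \<in> generic_lists W F n"
  shows "distinct w" "length w = n" "set w \<subseteq> W" "set w \<inter> F = {}"
  using assms by (auto simp: generic_lists_def)

lemma collapse_nth:
  assumes "distinct w" "set w \<inter> set v = {}" "x \<in> set w"
  shows "collapse v w x = v ! position w x"
  using assms by (auto simp: collapse_def)

lemma collapse_image:
  assumes w: "distinct w" "length w = Suc n" and v: "length v = Suc n"
  shows "collapse v w ` (set v \<union> set w) = set v"
proof -
  have "v ! position w x \<in> set v" if "x \<in> set w" for x
    using position_bound[OF w(1) that] w v by simp
  then show ?thesis by (force simp: collapse_def)
qed

lemma joined_labelled:
  assumes c: "(\<sigma>, v) \<in> cells AX n"
    and w: "w \<in> generic_lists (simplex_vertices K (canonical_simplex K n (\<sigma>, v))) (set v) (Suc n)"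
  shows "labelled_simplex K (set v \<union> set w) (join_singular K \<sigma> v w)"
proof -
  let ?A = "set v \<union> set w"
  have v: "length v = Suc n" "\<sigma> \<in> simps K (set v)" using c by (simp_all add: cells_algebraic_system)
  note w' = generic_listsD[OF w]
  note im = collapse_image[OF w'(1,2) v(1)]
  have ne: "set v \<noteq> {}" using v by auto
  have 0: "corner 0 \<in> affine_simplex {..n}" by (rule corner_in_affine_simplex) auto
  have base: "canonical_simplex K n (\<sigma>, v) (corner 0) = glue_class K ((set v, \<sigma>), push ((!) v) {..n} (corner 0))"
    using 0 by (simp add: canonical_simplex_eq standard_simplex_affine)
  have "continuous_map (simplex_space ?A) (simplex_space (set v)) (push (collapse v w) ?A)"
    using continuous_map_push_simplex[of ?A "collapse v w"] im by simp
  from continuous_map_compose[OF this continuous_map_cell[OF K v(2)]]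
  have "continuous_map (simplex_space ?A) (realization K) (join_singular K \<sigma> v w)"
    by (rule continuous_map_eq) (simp add: join_singular_def)
  moreover have "path_component_of (realization K) (join_singular K \<sigma> v w (corner a)) (vertex_point K a)" if a: "a \<in> ?A" for a
  proof -
    have e: "join_singular K \<sigma> v w (corner a) = glue_class K ((set v, \<sigma>), corner (collapse v w a))"
      using corner_in_affine_simplex[OF _ a] a by (simp add: join_singular_def push_corner)
    have ca: "collapse v w a \<in> set v" using im a by blast
    show ?thesis
    proof (cases "a \<in> set v")
      case True
      then have "join_singular K \<sigma> v w (corner a) = vertex_point K a"
        using vertex_point_eq[OF K v(2) True] e by (simp add: collapse_def)
      moreover have "path_component_of (realization K) (glue_class K ((set v, \<sigma>), corner a)) (glue_class K ((set v, \<sigma>), corner a))"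
        using True by (intro path_component_cell[OF K v(2)] corner_in_affine_simplex) auto
      ultimately show ?thesis using vertex_point_eq[OF K v(2) True] by simp
    next
      case False
      have "push ((!) v) {..n} (corner 0) \<in> affine_simplex (set v)"
        using push_in_affine_simplex[OF _ 0, of "(!) v"] nth_image_set[OF v(1)] by simp
      then have "path_component_of (realization K) (glue_class K ((set v, \<sigma>), corner (collapse v w a)))
          (glue_class K ((set v, \<sigma>), push ((!) v) {..n} (corner 0)))"
        using ca by (intro path_component_cell[OF K v(2)] corner_in_affine_simplex) auto
      moreover have "path_component_of (realization K) (glue_class K ((set v, \<sigma>), push ((!) v) {..n} (corner 0))) (vertex_point K a)"
        unfolding base[symmetric] using False a w'(3) by (auto simp: simplex_vertices_def component_vertices_def)
      ultimately show ?thesis unfolding e by (rule path_component_of_trans)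
    qed
  qed
  moreover have "?A \<subseteq> verts K"
    using simplex_verts[OF K v(2)] w'(3) by (auto simp: simplex_vertices_def component_vertices_def)
  ultimately show ?thesis using ne by (auto simp: labelled_simplex_def)
qed

lemma join_singular_left:
  assumes w: "distinct w" "set w \<inter> set v = {}" and t: "t \<in> affine_simplex (set v)"
  shows "join_singular K \<sigma> v w t = glue_class K ((set v, \<sigma>), t)"
proof -
  have "push (collapse v w) (set v \<union> set w) t = push (collapse v w) (set v) t"
    by (rule push_superset[symmetric]) (use t in \<open>auto simp: affine_simplex_def\<close>)
  also have "\<dots> = push id (set v) t" by (rule push_cong) (simp add: collapse_def)
  finally have "push (collapse v w) (set v \<union> set w) t = t" using push_id[OF t] by simp
  moreover have "t \<in> affine_simplex (set v \<union> set w)"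
    using affine_simplex_mono[of "set v \<union> set w" "set v"] t by auto
  ultimately show ?thesis by (simp add: join_singular_def)
qed

lemma join_singular_right:
  assumes w: "distinct w" "length w = Suc n" "set w \<inter> set v = {}" and v: "length v = Suc n"
  shows "restrict (join_singular K \<sigma> v w) (affine_simplex (set w)) = relabel w (canonical_simplex K n (\<sigma>, v))"
proof
  fix t
  show "restrict (join_singular K \<sigma> v w) (affine_simplex (set w)) t = relabel w (canonical_simplex K n (\<sigma>, v)) t"
  proof (cases "t \<in> affine_simplex (set w)")
    case True
    have "push (collapse v w) (set v \<union> set w) t = push (collapse v w) (set w) t"
      by (rule push_superset[symmetric]) (use True in \<open>auto simp: affine_simplex_def\<close>)
    also have "\<dots> = push ((!) v \<circ> position w) (set w) t"
      by (rule push_cong) (simp add: collapse_nth[OF w(1,3)])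
    also have "\<dots> = push ((!) v) {..n} (push (position w) (set w) t)"
      by (rule push_push[symmetric]) (use position_image[OF w(1,2)] in auto)
    finally have e: "push (collapse v w) (set v \<union> set w) t = push ((!) v) {..n} (push (position w) (set w) t)" .
    have "t \<in> affine_simplex (set v \<union> set w)"
      using affine_simplex_mono[of "set v \<union> set w" "set w"] True by auto
    moreover have "push (position w) (set w) t \<in> standard_simplex n"
      using push_in_affine_simplex[OF _ True, of "position w"] position_image[OF w(1,2)] by (simp add: standard_simplex_affine)
    ultimately show ?thesis using True e by (simp add: join_singular_def relabel_def canonical_simplex_eq)
  qed (simp add: relabel_def)
qed

lemma join_singular_face:
  assumes c: "(\<sigma>, v) \<in> cells AX (Suc n)"
    and w: "distinct w" "length w = Suc (Suc n)" "set w \<inter> set v = {}" and k: "k \<le> Suc n"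
  defines "v' \<equiv> delete_nth k v" and "w' \<equiv> delete_nth k w"
  shows "restrict (join_singular K \<sigma> v w) (affine_simplex (set v' \<union> set w'))
    = join_singular K (bdry K (set v) (set v') \<sigma>) v' w'"
proof
  fix t
  let ?A = "set v \<union> set w" and ?B = "set v' \<union> set w'"
  have v: "length v = Suc (Suc n)" "\<sigma> \<in> simps K (set v)" using c by (simp_all add: cells_algebraic_system)
  have k': "k < length v" "k < length w" using v w k by simp_all
  have sub: "set v' \<subseteq> set v" "set w' \<subseteq> set w" unfolding v'_def w'_def by (rule set_delete_nth)+
  have l: "length v' = Suc n" "length w' = Suc n" "distinct w'"
    using v w k' distinct_delete_nth(1)[OF w(1) k'(2)] by (simp_all add: v'_def w'_def length_delete_nth)
  have ne: "set v' \<noteq> {}" using l by auto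
  have "collapse v w x = collapse v' w' x" if x: "x \<in> ?B" for x
  proof (cases "x \<in> set v'")
    case True
    then show ?thesis using sub by (auto simp: collapse_def)
  next
    case False
    then have xw: "x \<in> set w'" using x by blast
    then have "collapse v w x = v ! skip k (position w' x)"
      using collapse_nth[OF w(1,3)] sub position_delete_nth[OF w(1) k'(2)] by (auto simp: w'_def)
    also have "\<dots> = v' ! position w' x"
      using nth_delete_nth[OF k'(1)] position_bound[OF l(3) xw] l v by (simp add: v'_def)
    finally show ?thesis using False by (simp add: collapse_def)
  qed
  then have cong: "push (collapse v w) ?B t = push (collapse v' w') ?B t" for t by (rule push_cong)
  show "restrict (join_singular K \<sigma> v w) (affine_simplex ?B) t = join_singular K (bdry K (set v) (set v') \<sigma>) v' w' t"
  proof (cases "t \<in> affine_simplex ?B")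
    case True
    have "push (collapse v w) ?A t = push (collapse v w) ?B t"
      by (rule push_superset[symmetric]) (use True sub in \<open>auto simp: affine_simplex_def\<close>)
    moreover have "push (collapse v' w') ?B t \<in> affine_simplex (set v')"
      using push_in_affine_simplex[OF _ True, of "collapse v' w'"] collapse_image[OF l(3,2,1)] by simp
    moreover have "t \<in> affine_simplex ?A"
      using affine_simplex_mono[of ?A ?B] True sub by auto
    ultimately show ?thesis
      using True cong[of t] glue_class_face[OF K v(2) sub(1) ne] by (simp add: join_singular_def)
  qed (simp add: join_singular_def)
qed

text \<open>
  Since straightening fixes simplices of \<open>K\<close> and is compatible with faces, the straightening of \<open>join_singular\<close>
  joins \<open>\<sigma>\<close> to its own straightening with labels \<open>w\<close>.
\<close>

lemma join_simplex_faces: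
  assumes c: "(\<sigma>, v) \<in> cells AX n"
    and w: "w \<in> generic_lists (simplex_vertices K (canonical_simplex K n (\<sigma>, v))) (set v) (Suc n)"
  shows "join_simplex K \<sigma> v w \<in> simps K (set v \<union> set w)"
    and "bdry K (set v \<union> set w) (set v) (join_simplex K \<sigma> v w) = \<sigma>"
    and "(bdry K (set v \<union> set w) (set w) (join_simplex K \<sigma> v w), w) = straight_cell K (canonical_simplex K n (\<sigma>, v)) w"
proof -
  have v: "length v = Suc n" "\<sigma> \<in> simps K (set v)" using c by (simp_all add: cells_algebraic_system)
  note w' = generic_listsD[OF w]
  note lab = joined_labelled[OF c w]
  have ne: "set v \<noteq> {}" "set w \<noteq> {}" using v w' by auto
  have "hd v \<in> set v" "hd w \<in> set w" using ne by simp_all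
  with w'(4) have "hd v \<in> set v" "hd v \<notin> set w" "hd w \<in> set w" "hd w \<notin> set v" by blast+
  then have ss: "set v \<subset> set v \<union> set w" "set w \<subset> set v \<union> set w" by blast+
  show "join_simplex K \<sigma> v w \<in> simps K (set v \<union> set w)"
    unfolding join_simplex_def by (rule straight_simplex(1)[OF K complete lab])
  have "straight_simplex K (set v) (restrict (join_singular K \<sigma> v w) (affine_simplex (set v))) = \<sigma>"
    by (rule straight_simplex_id[OF K complete labelled_simplex_face[OF lab _ ne(1)] v(2)])
      (use join_singular_left[OF w'(1,4)] in auto)
  then show "bdry K (set v \<union> set w) (set v) (join_simplex K \<sigma> v w) = \<sigma>"
    unfolding join_simplex_def straight_simplex_face[OF K complete lab ss(1) ne(1)] .
  show "(bdry K (set v \<union> set w) (set w) (join_simplex K \<sigma> v w), w) = straight_cell K (canonical_simplex K n (\<sigma>, v)) w"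
    unfolding join_simplex_def straight_simplex_face[OF K complete lab ss(2) ne(2)] straight_cell_def
    by (simp add: join_singular_right[OF w'(1,2,4) v(1)])
qed

lemma join_simplex_delete:
  assumes c: "(\<sigma>, v) \<in> cells AX (Suc n)"
    and w: "w \<in> generic_lists (simplex_vertices K (canonical_simplex K (Suc n) (\<sigma>, v))) (set v) (Suc (Suc n))"
    and k: "k \<le> Suc n"
  shows "join_simplex K (bdry K (set v) (set (delete_nth k v)) \<sigma>) (delete_nth k v) (delete_nth k w)
    = bdry K (set v \<union> set w) (set (delete_nth k v) \<union> set (delete_nth k w)) (join_simplex K \<sigma> v w)"
proof -
  note w' = generic_listsD[OF w]
  have "set (delete_nth k v) \<union> set (delete_nth k w) \<subset> set v \<union> set w"
    using set_delete_nth[of k v] delete_nth_psubset(1)[OF w'(1,2) k] w'(4) by blast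
  moreover have "set (delete_nth k v) \<union> set (delete_nth k w) \<noteq> {}"
    using delete_nth_psubset(2)[OF w'(1,2) k] by blast
  ultimately show ?thesis
    unfolding join_simplex_def
    using straight_simplex_face[OF K complete joined_labelled[OF c w]] join_singular_face[OF c w'(1,2,4) k] by simp
qed

lemma algebraic_prism_face:
  assumes c: "(\<sigma>, v) \<in> cells AX n"
    and w: "w \<in> generic_lists (simplex_vertices K (canonical_simplex K n (\<sigma>, v))) (set v) (Suc n)"
    and i: "i \<le> n" and k: "k \<le> Suc n"
  shows "face AX (Suc n) k (algebraic_prism K i (\<sigma>, v) w)
    = (bdry K (set v \<union> set w) (set (delete_nth k (prism_list i v w))) (join_simplex K \<sigma> v w), delete_nth k (prism_list i v w))"
proof -
  have v: "length v = Suc n" using c by (simp add: cells_algebraic_system)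
  note w' = generic_listsD[OF w]
  have "length (delete_nth k (prism_list i v w)) = Suc n"
    using length_prism_list[OF v w'(2) i] k by (simp add: length_delete_nth)
  then have "set (delete_nth k (prism_list i v w)) \<noteq> {}" by auto
  from simplex_face_face[OF K join_simplex_faces(1)[OF c w] set_prism_list set_delete_nth this]
  show ?thesis by (simp add: algebraic_prism_def face_algebraic_system)
qed

lemma algebraic_prism_homotopy:
  shows "c \<in> cells AX n \<Longrightarrow> w \<in> generic_lists (simplex_vertices K (canonical_simplex K n c)) (set (snd c)) (Suc n) \<Longrightarrow> i \<le> n \<Longrightarrow>
      algebraic_prism K i c w \<in> cells AX (Suc n)"
    and "c \<in> cells AX (Suc n) \<Longrightarrow> w \<in> generic_lists (simplex_vertices K (canonical_simplex K (Suc n) c)) (set (snd c)) (Suc (Suc n)) \<Longrightarrow>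
      k \<le> i \<Longrightarrow> i \<le> n \<Longrightarrow>
      face AX (Suc (Suc n)) k (algebraic_prism K (Suc i) c w) = algebraic_prism K i (face AX (Suc n) k c) (delete_nth k w)"
    and "c \<in> cells AX (Suc n) \<Longrightarrow> w \<in> generic_lists (simplex_vertices K (canonical_simplex K (Suc n) c)) (set (snd c)) (Suc (Suc n)) \<Longrightarrow>
      i < k \<Longrightarrow> k \<le> Suc n \<Longrightarrow>
      face AX (Suc (Suc n)) (Suc k) (algebraic_prism K i c w) = algebraic_prism K i (face AX (Suc n) k c) (delete_nth k w)"
    and "c \<in> cells AX n \<Longrightarrow> w \<in> generic_lists (simplex_vertices K (canonical_simplex K n c)) (set (snd c)) (Suc n) \<Longrightarrow> i < n \<Longrightarrow>
      face AX (Suc n) (Suc i) (algebraic_prism K (Suc i) c w) = face AX (Suc n) (Suc i) (algebraic_prism K i c w)"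
    and "c \<in> cells AX n \<Longrightarrow> w \<in> generic_lists (simplex_vertices K (canonical_simplex K n c)) (set (snd c)) (Suc n) \<Longrightarrow>
      face AX (Suc n) 0 (algebraic_prism K 0 c w) = straight_cell K (canonical_simplex K n c) w"
    and "c \<in> cells AX n \<Longrightarrow> w \<in> generic_lists (simplex_vertices K (canonical_simplex K n c)) (set (snd c)) (Suc n) \<Longrightarrow>
      face AX (Suc n) (Suc n) (algebraic_prism K n c w) = c"
proof -
  obtain \<sigma> v where e: "c = (\<sigma>, v)" by (cases c)
  {
    assume c: "c \<in> cells AX n" and w: "w \<in> generic_lists (simplex_vertices K (canonical_simplex K n c)) (set (snd c)) (Suc n)"
    note c' = c[unfolded e] and w' = w[unfolded e snd_conv]
    have v: "length v = Suc n" using c' by (simp add: cells_algebraic_system)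
    note l = generic_listsD(2)[OF w]
    note pf = algebraic_prism_face[OF c' w', folded e]
    show "algebraic_prism K i c w \<in> cells AX (Suc n)" if "i \<le> n"
    proof -
      have lp: "length (prism_list i v w) = Suc (Suc n)" by (rule length_prism_list[OF v l that])
      then have "set (prism_list i v w) \<noteq> {}" by auto
      then show ?thesis
        using simplex_face[OF K join_simplex_faces(1)[OF c' w'] set_prism_list] lp
        by (simp add: e algebraic_prism_def cells_algebraic_system)
    qed
    show "face AX (Suc n) (Suc i) (algebraic_prism K (Suc i) c w) = face AX (Suc n) (Suc i) (algebraic_prism K i c w)" if "i < n"
      using pf[of "Suc i" "Suc i"] pf[of i "Suc i"] delete_nth_prism_list(3)[OF v l that] that by simp
    show "face AX (Suc n) 0 (algebraic_prism K 0 c w) = straight_cell K (canonical_simplex K n c) w"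
      using pf[of 0 0] delete_nth_prism_list(4)[OF v l] join_simplex_faces(3)[OF c' w'] by (simp add: e)
    show "face AX (Suc n) (Suc n) (algebraic_prism K n c w) = c"
      using pf[of n "Suc n"] delete_nth_prism_list(5)[OF v l] join_simplex_faces(2)[OF c' w'] by (simp add: e)
  }
  {
    assume c: "c \<in> cells AX (Suc n)"
      and w: "w \<in> generic_lists (simplex_vertices K (canonical_simplex K (Suc n) c)) (set (snd c)) (Suc (Suc n))"
    note c' = c[unfolded e] and w' = w[unfolded e snd_conv]
    have v: "length v = Suc (Suc n)" using c' by (simp add: cells_algebraic_system)
    note l = generic_listsD(2)[OF w]
    note pf = algebraic_prism_face[OF c' w', folded e]
    have del: "algebraic_prism K i (face AX (Suc n) k c) (delete_nth k w)
        = (bdry K (set v \<union> set w) (set (prism_list i (delete_nth k v) (delete_nth k w))) (join_simplex K \<sigma> v w),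
           prism_list i (delete_nth k v) (delete_nth k w))" if k: "k \<le> Suc n" and i: "i \<le> n" for i k
    proof -
      have "length (prism_list i (delete_nth k v) (delete_nth k w)) = Suc (Suc n)"
        by (rule length_prism_list) (use v l k i in \<open>simp_all add: length_delete_nth\<close>)
      then have "set (prism_list i (delete_nth k v) (delete_nth k w)) \<noteq> {}" by auto
      moreover have "set (delete_nth k v) \<union> set (delete_nth k w) \<subseteq> set v \<union> set w"
        using set_delete_nth[of k v] set_delete_nth[of k w] by blast
      ultimately show ?thesis
        using simplex_face_face[OF K join_simplex_faces(1)[OF c' w'] _ set_prism_list]
        by (simp add: e algebraic_prism_def face_algebraic_system join_simplex_delete[OF c' w' k])
    qed
    show "face AX (Suc (Suc n)) k (algebraic_prism K (Suc i) c w) = algebraic_prism K i (face AX (Suc n) k c) (delete_nth k w)"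
      if "k \<le> i" "i \<le> n"
      using pf[of "Suc i" k] del[of k i] delete_nth_prism_list(1)[OF v l refl that] that by simp
    show "face AX (Suc (Suc n)) (Suc k) (algebraic_prism K i c w) = algebraic_prism K i (face AX (Suc n) k c) (delete_nth k w)"
      if "i < k" "k \<le> Suc n"
      using pf[of i "Suc k"] del[of k i] delete_nth_prism_list(2)[OF v l refl that] that by simp
  }
qed

section \<open>The isometric isomorphism\<close>

text \<open>
  The averaged straightening \<open>M\<close> is inverse to the canonical map \<open>P\<close> up to coboundaries.
\<close>

lemma canonical_map_isometric_isomorphism: "isometric_isomorphism SX AX n (canonical_cohomology_map K n)"
proof -
  have SX: "simplicial_faces SX" by (rule simplicial_faces_singular_system)
  have AX: "simplicial_faces AX" by (rule simplicial_faces_algebraic_system[OF K])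
  have cf: "closed_faces SX" "closed_faces AX" using SX AX by (simp_all add: simplicial_faces_def)
  define P where "P = canonical_cochain_map K"
  have P_eq: "P = (\<lambda>n \<phi> c. if c \<in> chains AX n then \<phi> (linear_extend (\<lambda>s. basis_chain (canonical_simplex K n s)) c) else 0)"
    by (auto simp: P_def canonical_cochain_map_def canonical_chain_map_def fun_eq_iff)
  have pull: "cocycle_contraction SX AX n (P n)"
    "\<And>\<phi> s. s \<in> cells AX n \<Longrightarrow> P n \<phi> (basis_chain s) = \<phi> (basis_chain (canonical_simplex K n s))" for n
    unfolding P_eq
    by (rule pullback_contraction[OF cf canonical_simplex_cell[OF K] canonical_simplex_face[OF K]]; assumption)+
  define M where "M = (\<lambda>n \<phi>. cell_cochain SX n (\<lambda>s. iterated_mean (simplex_mean K s) (Suc n) (\<lambda>w. \<phi> (basis_chain (straight_cell K s w)))))"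
  have M: "cocycle_contraction AX SX n (M n)" for n
    unfolding M_def
    by (rule mean_contraction[where W="\<lambda>n. simplex_vertices K" and m="\<lambda>n. simplex_mean K" and j="\<lambda>n. straight_cell K", OF cf])
      (use simplex_mean simplex_mean_face straight_cell_cell straight_cell_face in blast)+
  have Mc: "M n \<phi> \<in> cochains SX n" for n \<phi> unfolding M_def by (rule cell_cochain_cochain)
  have Mb: "M n \<phi> (basis_chain s) = iterated_mean (simplex_mean K s) (Suc n) (\<lambda>w. \<phi> (basis_chain (straight_cell K s w)))"
    if "s \<in> cells SX n" for n \<phi> s using that by (simp add: M_def)
  have PM: "(\<lambda>c. P n (M n \<psi>) c - \<psi> c) \<in> bounded_coboundaries AX n" if \<psi>: "\<psi> \<in> bounded_cocycles AX n" for \<psi>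
  proof (rule mean_homotopy[where W="\<lambda>n c. simplex_vertices K (canonical_simplex K n c)"
        and m="\<lambda>n c. simplex_mean K (canonical_simplex K n c)" and F="\<lambda>n c. set (snd c)"
        and h="\<lambda>n. algebraic_prism K" and upper="\<lambda>n c. straight_cell K (canonical_simplex K n c)", OF cf(2) _ _ _ _ _ _ _ _ _ \<psi>])
    show "P n (M n \<psi>) \<in> cochains AX n"
      using cocycle_contractionD(1)[OF pull(1) cocycle_contractionD(1)[OF M \<psi>]]
      by (simp add: bounded_cocycles_def bounded_cochains_def)
    show "P n (M n \<psi>) (basis_chain s) = iterated_mean (simplex_mean K (canonical_simplex K n s)) (Suc n)
        (\<lambda>w. \<psi> (basis_chain (straight_cell K (canonical_simplex K n s) w)))" if "s \<in> cells AX n" for s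
      unfolding pull(2)[OF that] by (rule Mb[OF canonical_simplex_cell[OF K that]])
    show "simplex_mean K (canonical_simplex K n (face AX (Suc n) k s)) = simplex_mean K (canonical_simplex K (Suc n) s)"
      if "s \<in> cells AX (Suc n)" "k \<le> Suc n" for n s k
      using simplex_mean_face[OF canonical_simplex_cell[OF K that(1)] that(2)] canonical_simplex_face[OF K that] by simp
    show "vertex_mean (simplex_vertices K (canonical_simplex K n s)) (simplex_mean K (canonical_simplex K n s))"
      if "s \<in> cells AX n" for n s
      by (rule simplex_mean[OF canonical_simplex_cell[OF K that]])
  qed (blast intro: algebraic_prism_homotopy finite_set)+
  have MP: "(\<lambda>c. M n (P n \<phi>) c - \<phi> c) \<in> bounded_coboundaries SX n" if \<phi>: "\<phi> \<in> bounded_cocycles SX n" for \<phi>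
  proof (rule mean_homotopy[where W="\<lambda>n. simplex_vertices K"
        and m="\<lambda>n. simplex_mean K" and F="\<lambda>n c. {}"
        and h="singular_prism K" and upper="\<lambda>n s w. canonical_simplex K n (straight_cell K s w)", OF cf(1) _ _ _ _ _ _ _ _ _ \<phi> Mc])
    fix s assume s: "s \<in> cells SX n"
    have \<phi>': "\<phi> \<in> bounded_cochains SX n" using \<phi> by (simp add: bounded_cocycles_def)
    have "P n \<phi> \<in> bounded_cochains AX n"
      using cocycle_contractionD(1)[OF pull(1) \<phi>] by (simp add: bounded_cocycles_def)
    then have "bounded (range (\<lambda>w. P n \<phi> (basis_chain (straight_cell K s w))))"
      using bounded_cochain_bound(1) unfolding bounded_iff by fastforce
    moreover have "bounded (range (\<lambda>w. \<phi> (basis_chain (canonical_simplex K n (straight_cell K s w)))))"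
      using bounded_cochain_bound(1)[OF \<phi>'] unfolding bounded_iff by fastforce
    ultimately show "M n (P n \<phi>) (basis_chain s) = iterated_mean (simplex_mean K s) (Suc n)
        (\<lambda>w. \<phi> (basis_chain (canonical_simplex K n (straight_cell K s w))))"
      unfolding Mb[OF s]
      by (rule iterated_mean_cong[OF simplex_mean[OF s] finite.emptyI]) (rule pull(2)[OF straight_cell_cell[OF s]])
  qed (blast intro: simplex_mean simplex_mean_face singular_prism_cell singular_prism_homotopy)+
  show ?thesis
    using isometric_isomorphism_criterion[OF SX AX pull(1) M MP PM]
    unfolding canonical_cohomology_map_def[abs_def] P_def by simp
qed

end

theorem theorem2:
  fixes K :: "('v, 's) multicomplex" and n :: nat
  assumes "multicomplex K"
    and "complete_multicomplex K"
    and "large_multicomplex K"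
  shows "isometric_isomorphism (singular_system (realization K)) (algebraic_system K) n
           (canonical_cohomology_map K n)"
  using assms by (rule canonical_map_isometric_isomorphism)

end
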